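(* Let $A=A_N=\frac{1}{\sqrt N}X$, $X=[x_{ij}]_{1\le i,j\le N}$, be a sequence of real elliptic random matrices with exploding moments with parameter $\alpha=1$ and limiting constants $(C_{k,l})_{k,l\ge0}$ (as defined in the context). For any partition $\pi\in\bigcup_{k\ge1}\mathcal P(k)$ with associated directed multigraph $T_\pi=(V,E)$ let $$\tau_N^e[T_\pi]=\frac1N\sum_{\substack{\phi:V\to[N]\\ \text{injective}}}\ \prod_{(u,v)\in E}a_{\phi(u)\phi(v)},\qquad Z_N(T_\pi)=\sqrt N\big(\tau_N^e[T_\pi]-\mathbb E[\tau_N^e[T_\pi]]\big).$$ Then, as $N\to\infty$, the family $(Z_N(T_\pi))_{\pi\in\bigcup_k\mathcal P(k)}$ converges to a centered Gaussian process $(z(T_\pi))_{\pi\in\bigcup_k\mathcal P(k)}$. Moreover, for any two partitions $\pi_1,\pi_2$, $$\mathrm{Cov}\big(z(T_{\pi_1}),z(T_{\pi_2})\big)=\sum_{T\in\mathcal P^{\#}(T_{\pi_1},T_{\pi_2})}\tau^e[T],$$ where $\mathcal P^{\#}(T_{\pi_1},T_{\pi_2})$ is the collection of graphs obtained by taking disjoint copies of $T_{\pi_1}$ and $T_{\pi_2}$ and gluing them with at least one common edge, and $$\tau^e[T]=\begin{cases}\displaystyle\prod_{\substack{k,l\ge0\\ k+l\ge2}}C_{k,l}^{\,q_{k,l}}, & \text{if } T \text{ is a thick tree},\\ 0,&\text{otherwise,}\end{cases}$$ with $q_{k,l}$ the number of vertex pairs $(i,j)$, $i<j$, of $T$ such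 that there are exactly $k$ edges from $i$ to $j$ and exactly $l$ edges from $j$ to $i$.
   Context: Elliptic random matrices with exploding moments, with parameter $\alpha>0$: for each $N$, $X=X_N=[x_{ij}]_{1\le i,j\le N}$ is a real random matrix and $A=\frac1{\sqrt N}X=[a_{ij}]$, such that (1) $\mathbb E[x_{ij}]=0$ and $\mathbb E[x_{ij}^2]=1$ for all $1\le i,j\le N$; (2) the diagonal entries are independent among themselves and of the off-diagonal entries; the only dependence among off-diagonal entries is within the pairs $(x_{ij},x_{ji})$, i.e. $(x_{ij},x_{ji})$ is independent of $(x_{kl},x_{lk})$ whenever $\{i,j\}\ne\{k,l\}$ (the family of such pairs is independent); (3) for all $k,l\ge0$ with $k+l\ge2$ and $i<j$, $\ \mathbb E[x_{ij}^kx_{ji}^l]/N^{(k+l)/2-\alpha}\to C_{k,l}$ as $N\to\infty$, where the $C_{k,l}$ are finite constants; and for all $k\ge1$, $\ \mathbb E[|x_{ii}|^k]/N^{k/2-\alpha}=O(1)$; (4) the joint distribution of the entries is invariant under simultaneous relabeling (permutation) of the row and column indices. $[N]=\{1,\dots,N\}$; $\mathcal P(k)$ is the set of partitions of $\{1,\dots,k\}$. For $\pi\in\mathcal P(k)$, $T_\pi=(V,E)$ is the directed multigraph whose vertices are the blocks of $\pi$ and whose multiset of edges contains, for each $m\in\{1,\dots,k\}$, one edge from the block containing $m$ to the block containing $m+1$ (with $k+1$ identified with $1$). Products over $E$ are taken with multiplicity. In the definition of $q_{k,l}$ an arbitrary total order on the vertices is fixed. Thick tree: a directed multigraph $T=(V,E)$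 that is connected, has no loops, has no vertex pair $\{u,v\}$ connected only by a single directed edge (i.e. any two adjacent vertices are joined by at least two edges, counting both orientations), and whose underlying simple graph $(V,\mathcal E)$, obtained by ignoring orientation and multiplicity, satisfies $|V|=|\mathcal E|+1$. Gluing: for $T_1=(V_1,E_1)$, $T_2=(V_2,E_2)$, consider partitions $\sigma$ of the disjoint union $V_1\sqcup V_2$ each of whose blocks contains at most one vertex of each $V_j$. The glued graph $T_\sigma$ is the directed multigraph obtained from the disjoint union of $T_1$ and $T_2$ by merging vertices in the same block of $\sigma$ (keeping all edges with multiplicity). $\mathcal P^{\#}(T_1,T_2)$ consists of the $T_\sigma$, one for each $\sigma$ such that some edge of $T_1$ and some edge of $T_2$ have the same (unordered) pair of endpoints in $T_\sigma$; the sum over $\mathcal P^{\#}(T_1,T_2)$ is over such $\sigma$. Convergence of the family of random variables means convergence of finite-dimensional distributions. *)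

theory Defs
  imports
    "HOL-Probability.Probability"
    "HOL-Library.Landau_Symbols"
    "HOL-Library.Disjoint_Sets"
    "HOL-Combinatorics.Permutations"
    "Graph_Theory.Digraph_Component"
begin

section \<open>Elliptic random matrices with exploding moments\<close>

text \<open>
  Indices run over \<open>{1..N}\<close>; \<open>X N i j\<close> is irrelevant for \<open>i\<close> or \<open>j\<close> outside this range, and so
  are the data for \<open>N = 0\<close>. The probability space may depend on \<open>N\<close>.
\<close>

locale exploding_elliptic_matrices =
  fixes M :: "nat \<Rightarrow> 'a measure"
    and X :: "nat \<Rightarrow> nat \<Rightarrow> nat \<Rightarrow> 'a \<Rightarrow> real"
    and \<alpha> :: real
    and C :: "nat \<Rightarrow> nat \<Rightarrow> real"
  assumes alpha_pos: "\<alpha> > 0"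
    and prob_space: "N \<ge> 1 \<Longrightarrow> prob_space (M N)"
    and measurable: "\<lbrakk>N \<ge> 1; i \<in> {1..N}; j \<in> {1..N}\<rbrakk> \<Longrightarrow> X N i j \<in> borel_measurable (M N)"
    and mean: "\<lbrakk>N \<ge> 1; i \<in> {1..N}; j \<in> {1..N}\<rbrakk> \<Longrightarrow>
          integrable (M N) (X N i j) \<and> (\<integral>\<omega>. X N i j \<omega> \<partial>M N) = 0"
    and second_moment: "\<lbrakk>N \<ge> 1; i \<in> {1..N}; j \<in> {1..N}\<rbrakk> \<Longrightarrow>
          integrable (M N) (\<lambda>\<omega>. (X N i j \<omega>)\<^sup>2) \<and> (\<integral>\<omega>. (X N i j \<omega>)\<^sup>2 \<partial>M N) = 1"
      \<comment> \<open>The index set contains the diagonal, where the pair is \<open>(x\<^sub>i\<^sub>i, x\<^sub>i\<^sub>i)\<close>: the diagonal entries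
          and the pairs \<open>(x\<^sub>i\<^sub>j, x\<^sub>j\<^sub>i)\<close>, \<open>i < j\<close>, together form a mutually independent family.\<close>
    and independent: "N \<ge> 1 \<Longrightarrow>
          prob_space.indep_vars (M N) (\<lambda>_. borel \<Otimes>\<^sub>M borel)
            (\<lambda>(i, j) \<omega>. (X N i j \<omega>, X N j i \<omega>)) {(i, j). 1 \<le> i \<and> i \<le> j \<and> j \<le> N}"
      \<comment> \<open>All moments are finite; stated separately because the integral of a non-integrable
          function is \<open>0\<close>.\<close>
    and off_diagonal_integrable: "\<lbrakk>N \<ge> 1; 1 \<le> i; i < j; j \<le> N; k + l \<ge> 2\<rbrakk> \<Longrightarrow>
          integrable (M N) (\<lambda>\<omega>. X N i j \<omega> ^ k * X N j i \<omega> ^ l)"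
    and off_diagonal_moments: "\<lbrakk>1 \<le> i; i < j; k + l \<ge> 2\<rbrakk> \<Longrightarrow>
          (\<lambda>N. (\<integral>\<omega>. X N i j \<omega> ^ k * X N j i \<omega> ^ l \<partial>M N) / real N powr (real (k + l) / 2 - \<alpha>))
            \<longlonglongrightarrow> C k l"
    and diagonal_integrable: "\<lbrakk>N \<ge> 1; i \<in> {1..N}; k \<ge> 1\<rbrakk> \<Longrightarrow>
          integrable (M N) (\<lambda>\<omega>. \<bar>X N i i \<omega>\<bar> ^ k)"
    and diagonal_moments: "\<lbrakk>1 \<le> i; k \<ge> 1\<rbrakk> \<Longrightarrow>
          (\<lambda>N. (\<integral>\<omega>. \<bar>X N i i \<omega>\<bar> ^ k \<partial>M N) / real N powr (real k / 2 - \<alpha>)) \<in> O(\<lambda>_. 1)"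
    and permutation_invariant: "\<lbrakk>N \<ge> 1; p permutes {1..N}\<rbrakk> \<Longrightarrow>
          distr (M N) (PiM ({1..N} \<times> {1..N}) (\<lambda>_. borel))
            (\<lambda>\<omega>. \<lambda>(i, j) \<in> {1..N} \<times> {1..N}. X N (p i) (p j) \<omega>) =
          distr (M N) (PiM ({1..N} \<times> {1..N}) (\<lambda>_. borel))
            (\<lambda>\<omega>. \<lambda>(i, j) \<in> {1..N} \<times> {1..N}. X N i j \<omega>)"


section \<open>Directed multigraphs\<close>

text \<open>
  A directed multigraph is a \<open>pre_digraph\<close> of the AFP entry Graph_Theory: the arcs are abstract
  names, so that sums and products over arcs take multiplicity into account.
\<close>

definition block_of :: "'v set set \<Rightarrow> 'v \<Rightarrow> 'v set" where
  "block_of \<sigma> x = (THE B. B \<in> \<sigma> \<and> x \<in> B)"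

text \<open>\<open>\<Union>k\<ge>1. \<P>(k)\<close>. The number \<open>k\<close> is recovered from \<open>\<pi>\<close> as \<open>card (\<Union>\<pi>)\<close>.\<close>

definition all_partitions :: "nat set set set" where
  "all_partitions = {\<pi>. \<exists>k\<ge>1. partition_on {1..k} \<pi>}"

text \<open>The arc \<open>m \<in> {1..k}\<close> goes from the block of \<open>m\<close> to the block of its cyclic successor.\<close>

definition partition_graph :: "nat set set \<Rightarrow> (nat set, nat) pre_digraph" where
  "partition_graph \<pi> = (let k = card (\<Union>\<pi>) in
     \<lparr> verts = \<pi>,
       arcs = {1..k},
       tail = (\<lambda>m. block_of \<pi> m),
       head = (\<lambda>m. block_of \<pi> (if m = k then 1 else m + 1)) \<rparr>)"

definition arc_count :: "('v, 'e) pre_digraph \<Rightarrow> 'v \<Rightarrow> 'v \<Rightarrow> nat" where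
  "arc_count T u v = card {e \<in> arcs T. tail T e = u \<and> head T e = v}"

definition simple_edges :: "('v, 'e) pre_digraph \<Rightarrow> 'v set set" where
  "simple_edges T = (\<lambda>e. {tail T e, head T e}) ` arcs T"

text \<open>\<open>Digraph_Component.connected\<close> is connectedness of the underlying undirected graph.\<close>

definition thick_tree :: "('v, 'e) pre_digraph \<Rightarrow> bool" where
  "thick_tree T \<longleftrightarrow>
     fin_digraph T \<and> loopfree_digraph T \<and> Digraph_Component.connected T \<and>
     (\<forall>u\<in>verts T. \<forall>v\<in>verts T. {u, v} \<in> simple_edges T \<longrightarrow> arc_count T u v + arc_count T v u \<ge> 2) \<and>
     card (verts T) = card (simple_edges T) + 1"

text \<open>\<open>r\<close> is the chosen total order on the vertices.\<close>

definition pair_count :: "'v rel \<Rightarrow> ('v, 'e) pre_digraph \<Rightarrow> nat \<Rightarrow> nat \<Rightarrow> nat" where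
  "pair_count r T k l =
     card {(u, v). u \<in> verts T \<and> v \<in> verts T \<and> (u, v) \<in> r \<and> u \<noteq> v \<and>
                   arc_count T u v = k \<and> arc_count T v u = l}"

text \<open>
  Only finitely many exponents \<open>q\<^sub>k\<^sub>,\<^sub>l\<close> are nonzero; the product is restricted to these because
  \<open>prod\<close> over an infinite set is \<open>1\<close>.
\<close>

definition tau_limit :: "(nat \<Rightarrow> nat \<Rightarrow> real) \<Rightarrow> 'v rel \<Rightarrow> ('v, 'e) pre_digraph \<Rightarrow> real" where
  "tau_limit C r T =
     (if thick_tree T
      then \<Prod>(k, l) \<in> {(k, l). k + l \<ge> 2 \<and> pair_count r T k l \<noteq> 0}. C k l ^ pair_count r T k l
      else 0)"


section \<open>Gluing\<close>

definition gluing_partitions :: "'v set \<Rightarrow> 'w set \<Rightarrow> ('v + 'w) set set set" where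
  "gluing_partitions V W =
     {\<sigma>. partition_on (V <+> W) \<sigma> \<and>
         (\<forall>B\<in>\<sigma>. (\<forall>x y. Inl x \<in> B \<and> Inl y \<in> B \<longrightarrow> x = y) \<and>
                 (\<forall>x y. Inr x \<in> B \<and> Inr y \<in> B \<longrightarrow> x = y))}"

definition glue ::
    "('v, 'e) pre_digraph \<Rightarrow> ('w, 'f) pre_digraph \<Rightarrow> ('v + 'w) set set
      \<Rightarrow> (('v + 'w) set, 'e + 'f) pre_digraph" where
  "glue T\<^sub>1 T\<^sub>2 \<sigma> =
     \<lparr> verts = \<sigma>,
       arcs = arcs T\<^sub>1 <+> arcs T\<^sub>2,
       tail = case_sum (\<lambda>e. block_of \<sigma> (Inl (tail T\<^sub>1 e))) (\<lambda>e. block_of \<sigma> (Inr (tail T\<^sub>2 e))),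
       head = case_sum (\<lambda>e. block_of \<sigma> (Inl (head T\<^sub>1 e))) (\<lambda>e. block_of \<sigma> (Inr (head T\<^sub>2 e))) \<rparr>"

text \<open>
  \<open>\<P>\<^sup>#(T\<^sub>1, T\<^sub>2)\<close> is represented by the set of its indices \<open>\<sigma>\<close>: distinct \<open>\<sigma>\<close> contribute
  separately, even if the glued graphs are isomorphic.
\<close>

definition common_edge_gluings ::
    "('v, 'e) pre_digraph \<Rightarrow> ('w, 'f) pre_digraph \<Rightarrow> ('v + 'w) set set set" where
  "common_edge_gluings T\<^sub>1 T\<^sub>2 =
     {\<sigma> \<in> gluing_partitions (verts T\<^sub>1) (verts T\<^sub>2).
        \<exists>e\<in>arcs T\<^sub>1. \<exists>f\<in>arcs T\<^sub>2.
          let T = glue T\<^sub>1 T\<^sub>2 \<sigma>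
          in {tail T (Inl e), head T (Inl e)} = {tail T (Inr f), head T (Inr f)}}"


section \<open>Injective traces and their fluctuations\<close>

definition tau_e :: "(nat \<Rightarrow> nat \<Rightarrow> nat \<Rightarrow> 'a \<Rightarrow> real) \<Rightarrow> nat \<Rightarrow> ('v, 'e) pre_digraph \<Rightarrow> 'a \<Rightarrow> real" where
  "tau_e A N T \<omega> =
     1 / real N * (\<Sum>\<phi> \<in> {\<phi> \<in> verts T \<rightarrow>\<^sub>E {1..N}. inj_on \<phi> (verts T)}.
       \<Prod>e\<in>arcs T. A N (\<phi> (tail T e)) (\<phi> (head T e)) \<omega>)"

definition fluctuation ::
    "(nat \<Rightarrow> 'a measure) \<Rightarrow> (nat \<Rightarrow> nat \<Rightarrow> nat \<Rightarrow> 'a \<Rightarrow> real) \<Rightarrow> nat \<Rightarrow> ('v, 'e) pre_digraph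
      \<Rightarrow> 'a \<Rightarrow> real" where
  "fluctuation M A N T \<omega> = sqrt (real N) * (tau_e A N T \<omega> - (\<integral>\<omega>'. tau_e A N T \<omega>' \<partial>M N))"


section \<open>Gaussian processes and convergence of finite-dimensional distributions\<close>

text \<open>Degenerate normal laws are allowed.\<close>

definition normal_law :: "real \<Rightarrow> real \<Rightarrow> real measure" where
  "normal_law \<mu> s =
     (if s = 0 then return borel \<mu> else density lborel (\<lambda>x. ennreal (normal_density \<mu> s x)))"

definition gaussian_process :: "'b measure \<Rightarrow> 'i set \<Rightarrow> ('i \<Rightarrow> 'b \<Rightarrow> real) \<Rightarrow> bool" where
  "gaussian_process P I z \<longleftrightarrow>
     prob_space P \<and> (\<forall>i\<in>I. z i \<in> borel_measurable P) \<and>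
     (\<forall>F c. finite F \<and> F \<subseteq> I \<longrightarrow>
        (\<exists>\<mu> s. s \<ge> 0 \<and> distr P borel (\<lambda>\<omega>. \<Sum>i\<in>F. c i * z i \<omega>) = normal_law \<mu> s))"

definition centered_gaussian_process :: "'b measure \<Rightarrow> 'i set \<Rightarrow> ('i \<Rightarrow> 'b \<Rightarrow> real) \<Rightarrow> bool" where
  "centered_gaussian_process P I z \<longleftrightarrow>
     gaussian_process P I z \<and> (\<forall>i\<in>I. (\<integral>\<omega>. z i \<omega> \<partial>P) = 0)"

definition covariance :: "'b measure \<Rightarrow> ('b \<Rightarrow> real) \<Rightarrow> ('b \<Rightarrow> real) \<Rightarrow> real" where
  "covariance P Y Z = (\<integral>\<omega>. (Y \<omega> - (\<integral>x. Y x \<partial>P)) * (Z \<omega> - (\<integral>x. Z x \<partial>P)) \<partial>P)"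

text \<open>
  For every finite \<open>F \<subseteq> I\<close> the random vectors \<open>(Y\<^sub>N\<^sub>,\<^sub>i)\<^sub>i\<^sub>\<in>\<^sub>F\<close> converge in distribution to \<open>(z\<^sub>i)\<^sub>i\<^sub>\<in>\<^sub>F\<close>:
  expectations of bounded continuous functions converge. Here \<open>F \<rightarrow>\<^sub>E UNIV\<close>, with the topology of
  pointwise convergence, is a copy of the Euclidean space \<open>\<real>\<^sup>F\<close>.
\<close>

definition fdd_convergence ::
    "(nat \<Rightarrow> 'a measure) \<Rightarrow> (nat \<Rightarrow> 'i \<Rightarrow> 'a \<Rightarrow> real) \<Rightarrow>
     'b measure \<Rightarrow> ('i \<Rightarrow> 'b \<Rightarrow> real) \<Rightarrow> 'i set \<Rightarrow> bool" where
  "fdd_convergence M Y P z I \<longleftrightarrow>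
     (\<forall>F (f :: ('i \<Rightarrow> real) \<Rightarrow> real).
        finite F \<and> F \<subseteq> I \<and> continuous_on (F \<rightarrow>\<^sub>E UNIV) f \<and> bounded (f ` (F \<rightarrow>\<^sub>E UNIV)) \<longrightarrow>
        (\<lambda>N. \<integral>\<omega>. f (\<lambda>i\<in>F. Y N i \<omega>) \<partial>M N) \<longlonglongrightarrow> (\<integral>\<omega>. f (\<lambda>i\<in>F. z i \<omega>) \<partial>P))"

end

theory Submission
  imports Defs
begin

text \<open>
  Labelling the vertices of \<open>T\<^sub>\<pi>\<close> turns its arcs into a closed walk, and a closed walk on \<open>v\<close> vertices
  uses at least \<open>v - 1\<close> edges; if it uses exactly \<open>v - 1\<close>, it traverses each of them at least twice. As
  \<open>E[a\<^sub>i\<^sub>j\<^sup>k a\<^sub>j\<^sub>i\<^sup>l]\<close> vanishes for \<open>k + l = 1\<close> and is \<open>C\<^sub>k\<^sub>,\<^sub>l/N\<close> to first order otherwise, every edge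
  costs a factor \<open>N\<close> and every vertex gains one. Hence in the covariance of two traces, expanded over
  the coincidence patterns of the two labellings, exactly the gluings that are thick trees survive.
  In particular the trace of a graph that is not a tree has vanishing fluctuations.

  For trees the fluctuation is a sum of summands \<open>W\<^sub>i\<close>, one per labelling, where \<open>W\<^sub>i\<close> is independent of the
  \<open>W\<^sub>j\<close> that share no edge with it. By Stein's argument the characteristic function of a
  linear combination satisfies \<open>\<phi>'(t) = - t v \<phi>(t) + o(1)\<close>: the error is bounded by the sums of
  \<open>E|W\<^sub>i W\<^sub>j W\<^sub>k|\<close> and of \<open>Cov(W\<^sub>i W\<^sub>j, W\<^sub>k W\<^sub>l)\<close> over connected configurations, and the count of vertices
  against edges makes them \<open>O(N\<^sup>-\<^sup>1\<^sup>/\<^sup>2)\<close> and \<open>O(N\<^sup>-\<^sup>1)\<close>. The limiting covariance is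
  positive semidefinite, so an infinite Cholesky factorization builds the Gaussian process out of
  independent standard normal variables.
\<close>


section \<open>Closed walks\<close>

text \<open>The moments do not decay with their order: off the diagonal \<open>E|a_ij|^m\<close> is
  O(1/N) for every m \<ge> 2, so a product of entries is small only through the number of its
  distinct edges. An edge traversed once makes an expectation vanish, but it spoils absolute
  moments, because \<open>E|a_ij|\<close> may be as large as N^(-1/2). Stein's argument requires
  absolute moments. This is why the traces are separated before the limit theorem is applied. In a
  tree walk every edge occurs at least twice, so absolute moments obey the same count as
  expectations; all other traces are removed in \<open>L^2\<close>, where only expectations enter.

  Characteristic functions are followed instead of moments because they ask only for bounds on
  products of at most four summands. Symmetry and positivity of the limiting covariance are never
  read off the sum over gluings: they are inherited from second moments at finite N.

  Graphs are handled as lists of steps of closed walks, so that multiplicities are counts in a list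
  and undirected edges are \<open>keys\<close>.\<close>

definition key :: "'v \<times> 'v \<Rightarrow> 'v set" where
  "key e = {fst e, snd e}"

abbreviation keys :: "('v \<times> 'v) list \<Rightarrow> 'v set set" where
  "keys L \<equiv> key ` set L"

text \<open>A loop reaches no new vertex, so the balance of vertices against edges already holds
  with loops left out. This sharper form later excludes loops from walks that attain
  equality.\<close>

definition proper_keys :: "('v \<times> 'v) list \<Rightarrow> 'v set set" where
  "proper_keys L = key ` {e \<in> set L. fst e \<noteq> snd e}"

text \<open>A list rather than a set, because moments depend on the multiplicity and the direction
  of the steps. A word of length one yields a loop.\<close>

definition cyc :: "'v list \<Rightarrow> ('v \<times> 'v) list" where
  "cyc xs = zip xs (rotate1 xs)"

lemma proper_keys_Cons:
  "proper_keys (e # L) = (if fst e \<noteq> snd e then {key e} else {}) \<union> proper_keys L"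
  by (auto simp: proper_keys_def)

lemma proper_keys_subset: "proper_keys L \<subseteq> keys L"
  by (auto simp: proper_keys_def)

lemma finite_proper_keys [simp]: "finite (proper_keys L)"
  by (simp add: proper_keys_def)

lemma length_cyc [simp]: "length (cyc xs) = length xs"
  by (simp add: cyc_def)

text \<open>A step of a path that reaches a new vertex uses a new edge.\<close>

lemma path_card_le:
  assumes "finite U" "finite F" "y \<in> U" "\<Union>F \<subseteq> U"
  shows "card (U \<union> set ys) + card F \<le> card U + card (F \<union> proper_keys (zip (y # ys) ys))"
  using assms
proof (induction ys arbitrary: y U F)
  case Nil
  then show ?case by (simp add: proper_keys_def)
next
  case (Cons z zs)
  define F' where "F' = F \<union> (if y \<noteq> z then {{y, z}} else {})"
  define U' where "U' = insert z U"
  have IH: "card (U' \<union> set zs) + card F' \<le> card U' + card (F' \<union> proper_keys (zip (z # zs) zs))"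
    using Cons.prems by (intro Cons.IH) (auto simp: U'_def F'_def)
  have e1: "F' \<union> proper_keys (zip (z # zs) zs) = F \<union> proper_keys (zip (y # z # zs) (z # zs))"
    by (auto simp: F'_def proper_keys_Cons key_def)
  have e2: "U' \<union> set zs = U \<union> set (z # zs)"
    by (auto simp: U'_def)
  have "card U' + card F \<le> card U + card F'"
  proof (cases "z \<in> U")
    case True
    then have "U' = U" by (auto simp: U'_def)
    moreover have "card F \<le> card F'"
      using Cons.prems by (intro card_mono) (auto simp: F'_def)
    ultimately show ?thesis by simp
  next
    case False
    \<comment> \<open>All edges in \<open>F\<close> lie inside \<open>U\<close>, so an edge to a
      vertex outside \<open>U\<close> cannot be among them.\<close>
    then have "{y, z} \<notin> F" "y \<noteq> z" using Cons.prems by auto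
    then show ?thesis using False Cons.prems by (simp add: U'_def F'_def)
  qed
  then show ?case using IH unfolding e1 e2 by linarith
qed

lemma cyc_rotate1: "cyc (rotate1 xs) = rotate1 (cyc xs)"
  by (rule nth_equalityI)
     (auto simp: cyc_def nth_rotate1 intro!: nth_zip[symmetric] mod_less_divisor)

lemma cyc_rotate: "cyc (rotate n xs) = rotate n (cyc xs)"
  by (induction n) (simp_all add: rotate_def cyc_rotate1)

lemma cyc_Cons: "cyc (u # zs) = zip (u # (zs @ [u])) (zs @ [u])"
  by (simp add: cyc_def zip_append1 flip: append_Cons)

lemma rotate_to_hd:
  assumes "u \<in> set xs"
  obtains n zs where "rotate n xs = u # zs"
proof -
  obtain as bs where "xs = as @ u # bs" using assms by (meson split_list)
  then have "rotate (length as) xs = u # (bs @ as)" by (simp add: rotate_append)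
  then show ?thesis using that by blast
qed

text \<open>Rotation makes the walk start at a vertex that it shares with \<open>U\<close>; from
  there it is a path, followed back to its start. In effect a closed walk attached to a graph adds
  at least as many edges as vertices. All later counting rests on this.\<close>

lemma closed_walk_card_le:
  assumes "finite U" "finite F" "set xs \<inter> U \<noteq> {}" "\<Union>F \<subseteq> U"
  shows "card (U \<union> set xs) + card F \<le> card U + card (F \<union> proper_keys (cyc xs))"
proof -
  obtain u where u: "u \<in> set xs" "u \<in> U" using assms by auto
  then obtain n zs where n: "rotate n xs = u # zs" using rotate_to_hd by metis
  have "set xs = set (u # zs)" using n by (metis set_rotate)
  moreover have "set (cyc xs) = set (cyc (u # zs))" using n by (metis cyc_rotate set_rotate)
  then have "proper_keys (cyc xs) = proper_keys (zip (u # (zs @ [u])) (zs @ [u]))"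
    by (simp add: proper_keys_def cyc_Cons)
  moreover have "U \<union> set (u # zs) = U \<union> set (zs @ [u])" by auto
  ultimately show ?thesis
    using path_card_le[OF assms(1,2) u(2) assms(4), of "zs @ [u]"] by simp
qed

lemma closed_walk_card_le_keys:
  assumes "finite U" "finite F" "set xs \<inter> U \<noteq> {}" "\<Union>F \<subseteq> U"
  shows "card (U \<union> set xs) + card F \<le> card U + card (F \<union> keys (cyc xs))"
proof -
  have "card (F \<union> proper_keys (cyc xs)) \<le> card (F \<union> keys (cyc xs))"
    using assms proper_keys_subset[of "cyc xs"] by (intro card_mono) auto
  with closed_walk_card_le[OF assms] show ?thesis by linarith
qed

lemma card_walk_le:
  assumes "xs \<noteq> []"
  shows "card (set xs) \<le> card (keys (cyc xs)) + 1"
  using closed_walk_card_le_keys[of "{hd xs}" "{}" xs] assms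
  by (simp add: insert_absorb)

lemma Union_keys_cyc: "\<Union>(keys (cyc xs)) \<subseteq> set xs"
  by (auto simp: cyc_def key_def dest: set_zip_leftD set_zip_rightD)

text \<open>Equality in \<open>card_walk_le\<close>: the walk has as many vertices as its edges
  allow, so these edges form a tree.\<close>

definition tree_walk :: "'v list \<Rightarrow> bool" where
  "tree_walk xs \<longleftrightarrow> xs \<noteq> [] \<and> card (set xs) = card (keys (cyc xs)) + 1"

text \<open>The vertices are already bounded through \<open>proper_keys\<close>; a loop is an extra
  key outside this set and destroys equality.\<close>

lemma tree_walk_loopfree:
  assumes "tree_walk xs" "e \<in> set (cyc xs)"
  shows "fst e \<noteq> snd e"
proof
  assume "fst e = snd e"
  then have "key e \<notin> proper_keys (cyc xs)"
    by (auto simp: proper_keys_def key_def doubleton_eq_iff)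
  then have "proper_keys (cyc xs) \<subset> keys (cyc xs)"
    using assms(2) proper_keys_subset[of "cyc xs"] by auto
  then have "card (proper_keys (cyc xs)) < card (keys (cyc xs))"
    by (intro psubset_card_mono) auto
  moreover have "card (set xs) \<le> 1 + card (proper_keys (cyc xs))"
    using closed_walk_card_le[of "{hd xs}" "{}" xs] assms(1)
    by (simp add: insert_absorb tree_walk_def)
  ultimately show False using assms(1) by (simp add: tree_walk_def)
qed

text \<open>If an edge were traversed only once, cutting the walk there would leave a walk through all
  vertices with one edge less than a tree has.\<close>

lemma tree_walk_thick:
  assumes "tree_walk xs" "p \<in> keys (cyc xs)"
  shows "length (filter (\<lambda>e. key e = p) (cyc xs)) \<ge> 2"
proof (rule ccontr)
  assume *: "\<not> ?thesis"
  obtain m where m: "m < length (cyc xs)" "key (cyc xs ! m) = p"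
    using assms(2) by (metis imageE in_set_conv_nth)
  define L where "L = drop (Suc m) (cyc xs) @ take m (cyc xs)"
  have split: "cyc xs = take m (cyc xs) @ cyc xs ! m # drop (Suc m) (cyc xs)"
    using m by (simp add: id_take_nth_drop)
  have "length (filter (\<lambda>e. key e = p) (cyc xs)) = Suc (length (filter (\<lambda>e. key e = p) L))"
    by (subst split) (simp add: L_def m(2))
  with * have "length (filter (\<lambda>e. key e = p) L) = 0" by linarith
  then have "filter (\<lambda>e. key e = p) L = []" by (simp only: length_0_conv)
  then have pL: "p \<notin> keys L" by (auto simp: filter_empty_conv)
  \<comment> \<open>Rotation moves the single traversal to the end of the walk.\<close>
  have rot: "rotate (Suc m) (cyc xs) = L @ [cyc xs ! m]"
  proof -
    have "length (take (Suc m) (cyc xs)) = Suc m" using m(1) by simp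
    then have "rotate (Suc m) (cyc xs) = drop (Suc m) (cyc xs) @ take (Suc m) (cyc xs)"
      by (metis append_take_drop_id rotate_append)
    then show ?thesis using m(1) by (simp add: L_def take_Suc_conv_app_nth del: rotate_Suc)
  qed
  define ys where "ys = rotate (Suc m) xs"
  have "ys \<noteq> []" using assms(1) by (simp add: ys_def tree_walk_def)
  then obtain u zs where uz: "ys = u # zs" by (cases ys) auto
  have "cyc ys = L @ [cyc xs ! m]" using rot unfolding ys_def cyc_rotate .
  \<comment> \<open>The last step of a closed walk is the one that returns to its start. Removing it
    leaves an open path through the same vertices, to which \<open>path_card_le\<close>
    applies.\<close>
  moreover have "cyc ys = zip (u # zs) zs @ [(last (u # zs), u)]"
  proof (cases zs rule: rev_cases)
    case (snoc zs' x)
    have "cyc ys = zip ((u # zs') @ [x]) ((zs' @ [x]) @ [u])" by (simp add: uz snoc cyc_def)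
    also have "\<dots> = zip (u # zs') (zs' @ [x]) @ [(x, u)]" by (subst zip_append) auto
    also have "zip (u # zs') (zs' @ [x]) = zip ((u # zs') @ [x]) (zs' @ [x])"
      by (subst zip_append1) simp
    finally show ?thesis by (simp add: snoc)
  qed (simp add: uz cyc_def)
  ultimately have L: "L = zip (u # zs) zs" by simp
  have "card (set xs) = card ({u} \<union> set zs)"
    by (metis uz ys_def set_rotate insert_is_Un list.simps(15))
  also have "\<dots> \<le> 1 + card (proper_keys L)"
    using path_card_le[of "{u}" "{}" u zs] by (simp add: L)
  also have "card (proper_keys L) \<le> card (keys (cyc xs) - {p})"
  proof (intro card_mono)
    have "set L \<subseteq> set (cyc xs)" by (auto simp: L_def dest: in_set_takeD in_set_dropD)
    then have "keys L \<subseteq> keys (cyc xs)" by (rule image_mono)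
    with proper_keys_subset[of L] have "proper_keys L \<subseteq> keys (cyc xs)" by (rule order_trans)
    moreover have "p \<notin> proper_keys L" using pL proper_keys_subset[of L] by (meson subsetD)
    ultimately show "proper_keys L \<subseteq> keys (cyc xs) - {p}" by (simp add: subset_Diff_insert)
  qed simp
  also have "card (keys (cyc xs) - {p}) < card (keys (cyc xs))"
    using assms(2) by (intro psubset_card_mono) auto
  finally show False using assms(1) by (simp add: tree_walk_def)
qed

text \<open>Attaching the second closed walk never improves the balance of vertices over edges, so
  if the union attains the maximal value, the first walk attained it already.\<close>

lemma tree_walk_of_union:
  assumes "xs \<noteq> []" "ys \<noteq> []" "set xs \<inter> set ys \<noteq> {}"
    and "card (set xs \<union> set ys) \<ge> card (keys (cyc xs) \<union> keys (cyc ys)) + 1"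
  shows "tree_walk xs"
proof -
  have "card (set xs \<union> set ys) + card (keys (cyc xs)) \<le> card (set xs) + card (keys (cyc xs) \<union> keys (cyc ys))"
    using assms Union_keys_cyc[of xs] by (intro closed_walk_card_le_keys) auto
  then show ?thesis using card_walk_le[OF assms(1)] assms unfolding tree_walk_def by linarith
qed


section \<open>Weak convergence from characteristic functions\<close>

lemma continuous_on_proj: "continuous_on A (\<lambda>x::'i \<Rightarrow> real. x i)"
  by (rule continuous_on_subset[OF continuous_on_product_coordinates]) simp

lemma compact_PiE_UNIV:
  fixes S :: "'i \<Rightarrow> real set"
  assumes "\<And>i. compact (S i)"
  shows "compact (PiE UNIV S)"
  using assms unfolding compactin_euclidean_iff[symmetric] euclidean_product_topology[symmetric]
  by (simp add: compactin_PiE)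

text \<open>Weak convergence is tested on a trigonometric polynomial close to a periodic version of the test
  function. To get the latter, put \<open>s = sin (x / L)\<close>, \<open>c = cos (x / L)\<close> coordinatewise and consider
  \<open>f (L * arcsin s) * (\<Prod> max 0 c)\<close>, which is continuous on the whole cube of all \<open>(s, c)\<close>.\<close>

definition trig_point :: "'i set \<Rightarrow> real \<Rightarrow> ('i \<Rightarrow> real) \<Rightarrow> 'i \<times> bool \<Rightarrow> real" where
  "trig_point F L y = (\<lambda>(i, b). if i \<in> F then (if b then sin (y i / L) else cos (y i / L)) else 0)"

text \<open>Expectations of such functions are finite combinations of values of the characteristic
  function, so their convergence is immediate from that of characteristic functions.\<close>

definition trig_poly :: "'i set \<Rightarrow> (('i \<Rightarrow> real) \<Rightarrow> complex) \<Rightarrow> bool" where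
  "trig_poly F p \<longleftrightarrow> (\<exists>n (a :: nat \<Rightarrow> complex) t. p = (\<lambda>y. \<Sum>k<n. a k * iexp (\<Sum>i\<in>F. t k i * y i)))"

lemma trig_poly_monom: "trig_poly F (\<lambda>y. a * iexp (\<Sum>i\<in>F. t i * y i))"
  unfolding trig_poly_def
  by (rule exI[of _ 1], rule exI[of _ "\<lambda>_. a"], rule exI[of _ "\<lambda>_. t"]) simp

lemma trig_poly_const: "trig_poly F (\<lambda>y. a)"
  using trig_poly_monom[of F a "\<lambda>_. 0"] by simp

lemma trig_poly_add:
  assumes "trig_poly F p" "trig_poly F q"
  shows "trig_poly F (\<lambda>y. p y + q y)"
proof -
  obtain n :: nat and a t where p: "p = (\<lambda>y. \<Sum>k<n. a k * iexp (\<Sum>i\<in>F. t k i * y i))"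
    using assms(1) by (auto simp: trig_poly_def)
  obtain m :: nat and b u where q: "q = (\<lambda>y. \<Sum>k<m. b k * iexp (\<Sum>i\<in>F. u k i * y i))"
    using assms(2) by (auto simp: trig_poly_def)
  let ?g = "\<lambda>y k. (if k < n then a k else b (k - n)) *
     iexp (\<Sum>i\<in>F. (if k < n then t k else u (k - n)) i * y i)"
  have "p y + q y = (\<Sum>k<n+m. ?g y k)" for y
  proof -
    have "(\<Sum>k<n+m. ?g y k) = (\<Sum>k<n. ?g y k) + (\<Sum>k\<in>{n..<n+m}. ?g y k)"
      by (subst sum.union_disjoint[symmetric]) (auto intro!: sum.cong)
    also have "(\<Sum>k\<in>{n..<n+m}. ?g y k) = (\<Sum>k<m. ?g y (k + n))"
      using sum.shift_bounds_nat_ivl[of "?g y" 0 n m] by (simp add: atLeast0LessThan add.commute)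
    finally show ?thesis by (simp add: p q)
  qed
  then show ?thesis unfolding trig_poly_def
    by (intro exI[of _ "n+m"] exI[of _ "\<lambda>k. if k < n then a k else b (k - n)"]
        exI[of _ "\<lambda>k. if k < n then t k else u (k - n)"]) auto
qed

lemma trig_poly_sum:
  "(\<And>k. k \<in> S \<Longrightarrow> trig_poly F (p k)) \<Longrightarrow> trig_poly F (\<lambda>y. \<Sum>k\<in>S. p k y)"
  by (induction S rule: infinite_finite_induct) (auto intro: trig_poly_add trig_poly_const)

lemma trig_poly_mult:
  assumes "trig_poly F p" "trig_poly F q"
  shows "trig_poly F (\<lambda>y. p y * q y)"
proof -
  obtain n :: nat and a t where p: "p = (\<lambda>y. \<Sum>k<n. a k * iexp (\<Sum>i\<in>F. t k i * y i))"
    using assms(1) by (auto simp: trig_poly_def)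
  obtain m :: nat and b u where q: "q = (\<lambda>y. \<Sum>k<m. b k * iexp (\<Sum>i\<in>F. u k i * y i))"
    using assms(2) by (auto simp: trig_poly_def)
  have "p y * q y = (\<Sum>k<n. \<Sum>l<m. (a k * b l) * iexp (\<Sum>i\<in>F. (t k i + u l i) * y i))" for y
    unfolding p q sum_product
    by (intro sum.cong refl) (simp add: sum.distrib ring_distribs exp_add mult_ac)
  then show ?thesis
    by (simp only:) (intro trig_poly_sum trig_poly_monom)
qed

text \<open>Euler's formulas, with frequency \<open>1 / L\<close> in the single coordinate
  \<open>fst j\<close>.\<close>

lemma trig_poly_coord:
  assumes "finite F"
  shows "trig_poly F (\<lambda>y. complex_of_real (trig_point F L y j))"
proof (cases "fst j \<in> F")
  case True
  define i where "i = fst j"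
  have iF: "i \<in> F" using True by (simp add: i_def)
  have sum: "(\<Sum>k\<in>F. (if k = i then c else 0) * y k) = c * y i" for c :: real and y
    using iF assms by (simp add: if_distrib[of "\<lambda>c. c * _"] cong: if_cong)
  let ?e = "\<lambda>c y. iexp (\<Sum>k\<in>F. (if k = i then c else 0) * y k)"
  have e: "iexp x = Complex (cos x) (sin x)" for x :: real
    by (simp add: cis_conv_exp[symmetric] complex_eq_iff)
  show ?thesis
  proof (cases "snd j")
    case True
    have "complex_of_real (trig_point F L y j) = (-\<i>/2) * ?e (1/L) y + (\<i>/2) * ?e (-1/L) y" for y
      unfolding sum e using True iF
      by (cases j) (simp add: trig_point_def i_def complex_eq_iff)
    then show ?thesis by (simp only:) (intro trig_poly_add trig_poly_monom)
  next
    case False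
    have "complex_of_real (trig_point F L y j) = (1/2) * ?e (1/L) y + (1/2) * ?e (-1/L) y" for y
      unfolding sum e using False iF
      by (cases j) (simp add: trig_point_def i_def complex_eq_iff)
    then show ?thesis by (simp only:) (intro trig_poly_add trig_poly_monom)
  qed
next
  case False
  then show ?thesis using trig_poly_const[of F 0] by (cases j) (simp add: trig_point_def)
qed

lemma continuous_on_arcsin_proj:
  "continuous_on A (\<lambda>x::'i\<Rightarrow>real. arcsin (max (-1) (min 1 (x i))))"
  by (intro continuous_on_arcsin continuous_intros continuous_on_proj) auto

lemma divide_le_self: "0 \<le> x \<Longrightarrow> x / 2 \<le> (x :: real)"
  by simp

text \<open>The approximant is good only where every \<open>\<bar>y i\<bar>\<close> is at most
  \<open>pi * L / 2\<close>. Outside this cube some \<open>(y i)\<^sup>2 / L\<^sup>2\<close> is at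
  least 1, so the trivial bound \<open>2 * B\<close> is absorbed by the error term. With an error of
  this quadratic form, bounded second moments later do the work of tightness.\<close>

lemma trig_approx:
  fixes f :: "('i :: countable \<Rightarrow> real) \<Rightarrow> real"
  assumes F: "finite F" and L: "L > 0" and e: "e > 0"
    and f: "continuous_on (F \<rightarrow>\<^sub>E UNIV) f" and B: "\<And>y. y \<in> F \<rightarrow>\<^sub>E UNIV \<Longrightarrow> \<bar>f y\<bar> \<le> B"
  shows "\<exists>p. trig_poly F p \<and> (\<forall>y. \<bar>f (restrict y F) - Re (p y)\<bar> \<le> e + 2 * B * (\<Sum>i\<in>F. (y i)\<^sup>2 / L\<^sup>2))"
proof -
  \<comment> \<open>The coordinates outside \<open>F\<close> are frozen at 0: this keeps
    \<open>S\<close> compact, and every \<open>trig_point F L y\<close> lies in it.\<close>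
  define S :: "('i \<times> bool \<Rightarrow> real) set" where
    "S = PiE UNIV (\<lambda>(i, b). if i \<in> F then {-1..1} else {0})"
  define h where "h x = (\<lambda>i\<in>F. L * arcsin (max (-1) (min 1 (x (i, True)))))" for x :: "'i \<times> bool \<Rightarrow> real"
  define g where "g x = f (h x) * (\<Prod>i\<in>F. max 0 (x (i, False)))" for x :: "'i \<times> bool \<Rightarrow> real"
  \<comment> \<open>The functions on the cube that become trigonometric polynomials along
    \<open>trig_point\<close>. They form an algebra containing the coordinate functions, so the
    Stone-Weierstrass theorem applies to \<open>g\<close>.\<close>
  define P where "P q \<longleftrightarrow> continuous_on S q \<and> (\<exists>p. trig_poly F p \<and> (\<forall>y. complex_of_real (q (trig_point F L y)) = p y))"
    for q :: "('i \<times> bool \<Rightarrow> real) \<Rightarrow> real"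
  have B0: "B \<ge> 0" using B[of "\<lambda>i\<in>F. 0"] by simp
  have PP: "P (\<lambda>x. x j)" for j
    unfolding P_def using trig_poly_coord[OF F, of L j]
    by (intro conjI continuous_on_proj exI[of _ "\<lambda>y. complex_of_real (trig_point F L y j)"]) auto
  have "continuous_on S h"
  proof (rule continuous_on_coordinatewise_then_product)
    fix i show "continuous_on S (\<lambda>x. h x i)"
      unfolding h_def restrict_def
      by (cases "i \<in> F") (auto intro!: continuous_on_mult_left continuous_on_arcsin_proj)
  qed
  then have "continuous_on S (\<lambda>x. f (h x))"
    by (rule continuous_on_compose2[OF f]) (auto simp: h_def)
  then have gc: "continuous_on S g"
    unfolding g_def by (intro continuous_intros continuous_on_proj)
  have "\<exists>q. P q \<and> (\<forall>x\<in>S. \<bar>g x - q x\<bar> < e)"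
  proof (rule Stone_Weierstrass_HOL[where P = P, OF _ _ _ _ _ _ gc e])
    show "compact S" unfolding S_def
      by (intro compact_PiE_UNIV) auto
    show "P (\<lambda>x. c)" for c
      unfolding P_def using trig_poly_const[of F "complex_of_real c"] by auto
    show "P q \<Longrightarrow> continuous_on S q" for q by (simp add: P_def)
    show "P (\<lambda>x. q x + r x)" if "P q \<and> P r" for q r
      using that unfolding P_def by (auto intro!: continuous_intros trig_poly_add)
    show "P (\<lambda>x. q x * r x)" if "P q \<and> P r" for q r
      using that unfolding P_def by (auto intro!: continuous_intros trig_poly_mult)
    show "\<exists>q. P q \<and> q x \<noteq> q y" if "x \<in> S \<and> y \<in> S \<and> x \<noteq> y" for x y
    proof -
      from that obtain j where "x j \<noteq> y j" by (metis ext)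
      then show ?thesis using PP[of j] by blast
    qed
  qed
  then obtain q p where q: "\<And>x. x \<in> S \<Longrightarrow> \<bar>g x - q x\<bar> < e"
    and p: "trig_poly F p" "\<And>y. complex_of_real (q (trig_point F L y)) = p y"
    by (auto simp: P_def)
  have "\<bar>f (restrict y F) - Re (p y)\<bar> \<le> e + 2 * B * (\<Sum>i\<in>F. (y i)\<^sup>2 / L\<^sup>2)" for y
  proof -
    let ?x = "trig_point F L y"
    let ?s = "\<Sum>i\<in>F. (y i)\<^sup>2 / L\<^sup>2"
    have s0: "?s \<ge> 0" by (intro sum_nonneg) auto
    have "?x \<in> S" by (auto simp: S_def trig_point_def)
    then have 1: "\<bar>g ?x - Re (p y)\<bar> < e"
      using q p(2)[of y] by (metis Re_complex_of_real)
    have prod: "(\<Prod>i\<in>F. max 0 (?x (i, False))) = (\<Prod>i\<in>F. max 0 (cos (y i / L)))"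
      by (intro prod.cong) (auto simp: trig_point_def)
    have pr01: "(\<Prod>i\<in>F. max 0 (cos (y i / L))) \<in> {0..1}"
      by (auto intro!: prod_nonneg prod_le_1)
    have "\<bar>f (restrict y F) - g ?x\<bar> \<le> 2 * B * ?s"
    proof (cases "\<forall>i\<in>F. \<bar>y i / L\<bar> \<le> pi / 2")
      case True
      \<comment> \<open>On this cube \<open>arcsin\<close> inverts the sine, so \<open>g ?x\<close>
        differs from \<open>f (restrict y F)\<close> only by the product of cosines.\<close>
      have "h ?x = restrict y F"
      proof (intro ext)
        fix i show "h ?x i = restrict y F i"
        proof (cases "i \<in> F")
          case iF: True
          have "arcsin (sin (y i / L)) = y i / L"
            using bspec[OF True iF] by (intro arcsin_sin) linarith+
          moreover have "max (- 1) (min 1 (sin (y i / L))) = sin (y i / L)"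
            using sin_le_one sin_ge_minus_one by (simp add: max_absorb2 min_absorb2)
          ultimately show ?thesis using iF L by (simp add: h_def trig_point_def)
        qed (simp add: h_def)
      qed
      then have "f (restrict y F) - g ?x = f (restrict y F) * (1 - (\<Prod>i\<in>F. max 0 (cos (y i / L))))"
        by (simp add: g_def prod algebra_simps)
      moreover have "1 - (\<Prod>i\<in>F. max 0 (cos (y i / L))) \<le> ?s"
      proof -
        have "1 - (\<Prod>i\<in>F. max 0 (cos (y i / L))) \<le> (\<Sum>i\<in>F. 1 - max 0 (cos (y i / L)))"
          using F
        proof (induction F)
          case (insert j F)
          let ?c = "\<lambda>i. max 0 (cos (y i / L))"
          have c01: "0 \<le> ?c i" "?c i \<le> 1" for i by auto
          have P01: "0 \<le> prod ?c F" "prod ?c F \<le> 1" using c01 by (auto intro!: prod_nonneg prod_le_1)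
          have "0 \<le> (1 - ?c j) * (1 - prod ?c F)" using c01 P01 by simp
          then have "1 - ?c j * prod ?c F \<le> (1 - ?c j) + (1 - prod ?c F)"
            by (simp add: algebra_simps)
          then show ?case using insert by simp
        qed simp
        also have "\<dots> \<le> ?s"
        proof (intro sum_mono)
          fix i
          have "1 - max 0 (cos (y i / L)) \<le> 1 - cos (y i / L)" by simp
          also have "\<dots> = 2 * (sin (y i / L / 2))\<^sup>2" using cos_double_sin[of "y i / L / 2"] by simp
          also have "(sin (y i / L / 2))\<^sup>2 \<le> (y i / L / 2)\<^sup>2"
            using abs_sin_x_le_abs_x[of "y i / L / 2"] abs_le_square_iff by blast
          also have "2 * (y i / L / 2)\<^sup>2 = ((y i)\<^sup>2 / L\<^sup>2) / 2"
            by (simp add: power_divide)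
          also have "\<dots> \<le> (y i)\<^sup>2 / L\<^sup>2"
            using zero_le_divide_iff[of "(y i)\<^sup>2" "L\<^sup>2"] by (intro divide_le_self) auto
          finally show "1 - max 0 (cos (y i / L)) \<le> (y i)\<^sup>2 / L\<^sup>2" by simp
        qed
        finally show ?thesis .
      qed
      ultimately have "\<bar>f (restrict y F) - g ?x\<bar> \<le> B * ?s"
        using B[of "restrict y F"] pr01 B0 by (simp add: abs_mult mult_mono)
      moreover have "0 \<le> B * ?s" using B0 s0 by simp
      ultimately show ?thesis by linarith
    next
      case False
      then obtain i where i: "i \<in> F" "\<bar>y i / L\<bar> > pi / 2" by fastforce
      have "1 \<le> \<bar>y i / L\<bar>" using i(2) pi_gt3 by linarith
      then have "1 \<le> (y i / L)\<^sup>2" by (metis abs_1 abs_le_square_iff one_power2)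
      also have "\<dots> = (y i)\<^sup>2 / L\<^sup>2" by (simp add: power_divide)
      also have "\<dots> \<le> ?s" using i F by (intro member_le_sum) auto
      finally have s1: "1 \<le> ?s" .
      have "\<bar>f (restrict y F)\<bar> \<le> B" using B by auto
      moreover have "\<bar>g ?x\<bar> \<le> B"
      proof -
        have "\<bar>f (h ?x)\<bar> \<le> B" by (intro B) (auto simp: h_def)
        then have "\<bar>f (h ?x)\<bar> * \<bar>\<Prod>i\<in>F. max 0 (cos (y i / L))\<bar> \<le> B * 1"
          using pr01 B0 by (intro mult_mono) auto
        then show ?thesis by (simp add: g_def abs_mult prod)
      qed
      ultimately have "\<bar>f (restrict y F) - g ?x\<bar> \<le> 2 * B * 1" by linarith
      also have "\<dots> \<le> 2 * B * ?s" using s1 B0 by (intro mult_left_mono) auto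
      finally show ?thesis .
    qed
    with 1 show ?thesis by linarith
  qed
  with p(1) show ?thesis by blast
qed


text \<open>\<open>f\<close> is controlled only on \<open>F \<rightarrow>\<^sub>E UNIV\<close>;
  composed with \<open>restrict\<close> it is continuous on the whole function space. Countability
  of the index type makes coordinatewise measurability sufficient for Borel measurability.\<close>

lemma measurable_continuous_restrict:
  fixes f :: "('i :: countable \<Rightarrow> real) \<Rightarrow> real"
  assumes f: "continuous_on (F \<rightarrow>\<^sub>E UNIV) f" and Y: "\<And>i. i \<in> F \<Longrightarrow> Y i \<in> borel_measurable M"
  shows "(\<lambda>\<omega>. f (\<lambda>i\<in>F. Y i \<omega>)) \<in> borel_measurable M"
proof -
  have "continuous_on UNIV (\<lambda>y::'i \<Rightarrow> real. restrict y F)"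
  proof (rule continuous_on_coordinatewise_then_product)
    fix i show "continuous_on UNIV (\<lambda>y::'i \<Rightarrow> real. restrict y F i)"
      by (cases "i \<in> F") auto
  qed
  then have "continuous_on UNIV (\<lambda>y. f (restrict y F))"
    by (rule continuous_on_compose2[OF f]) auto
  then have 1: "(\<lambda>y. f (restrict y F)) \<in> borel_measurable borel"
    by (rule borel_measurable_continuous_onI)
  have 2: "(\<lambda>\<omega> i. if i \<in> F then Y i \<omega> else 0) \<in> borel_measurable M"
  proof (rule measurable_coordinatewise_then_product)
    fix i show "(\<lambda>\<omega>. if i \<in> F then Y i \<omega> else 0) \<in> borel_measurable M"
      using Y by (cases "i \<in> F") auto
  qed
  have "(\<lambda>\<omega>. f (\<lambda>i\<in>F. Y i \<omega>)) = (\<lambda>\<omega>. f (restrict (\<lambda>i. if i \<in> F then Y i \<omega> else 0) F))"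
    by (intro ext arg_cong[of _ _ f]) auto
  then show ?thesis using measurable_compose[OF 2 1] by simp
qed

lemma (in prob_space) trig_poly_expectation:
  assumes "\<And>i. i \<in> F \<Longrightarrow> Y i \<in> borel_measurable M"
  shows "integrable M (\<lambda>\<omega>. \<Sum>k<n. a k * iexp (\<Sum>i\<in>F. t k i * Y i \<omega>))"
    and "(\<integral>\<omega>. Re (\<Sum>k<n. a k * iexp (\<Sum>i\<in>F. t k i * Y i \<omega>)) \<partial>M) =
      Re (\<Sum>k<n. a k * (\<integral>\<omega>. iexp (\<Sum>i\<in>F. t k i * Y i \<omega>) \<partial>M))"
proof -
  have i: "integrable M (\<lambda>\<omega>. iexp (\<Sum>i\<in>F. t k i * Y i \<omega>))" for k
    using assms by (intro integrable_iexp borel_measurable_sum borel_measurable_times) auto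
  then show 1: "integrable M (\<lambda>\<omega>. \<Sum>k<n. a k * iexp (\<Sum>i\<in>F. t k i * Y i \<omega>))"
    by (intro Bochner_Integration.integrable_sum integrable_mult_right) auto
  show "(\<integral>\<omega>. Re (\<Sum>k<n. a k * iexp (\<Sum>i\<in>F. t k i * Y i \<omega>)) \<partial>M) =
      Re (\<Sum>k<n. a k * (\<integral>\<omega>. iexp (\<Sum>i\<in>F. t k i * Y i \<omega>) \<partial>M))"
    using i by (subst integral_Re[OF 1], subst Bochner_Integration.integral_sum) auto
qed

text \<open>Integrating the pointwise error of \<open>trig_approx\<close> leaves a bound that
  depends on the law only through \<open>K\<close>, so one trigonometric polynomial serves all
  \<open>N\<close> and the limit.\<close>

lemma (in prob_space) test_function_error:
  fixes f :: "('i :: countable \<Rightarrow> real) \<Rightarrow> real"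
  assumes F: "finite F" and Y: "\<And>i. i \<in> F \<Longrightarrow> Y i \<in> borel_measurable M"
    and Y2: "\<And>i. i \<in> F \<Longrightarrow> integrable M (\<lambda>\<omega>. (Y i \<omega>)\<^sup>2)"
    and K: "\<And>i. i \<in> F \<Longrightarrow> (\<integral>\<omega>. (Y i \<omega>)\<^sup>2 \<partial>M) \<le> K"
    and f: "continuous_on (F \<rightarrow>\<^sub>E UNIV) f" and B: "\<And>y. y \<in> F \<rightarrow>\<^sub>E UNIV \<Longrightarrow> \<bar>f y\<bar> \<le> B"
    and L: "L > 0"
    and p: "\<And>y. \<bar>f (restrict y F) - Re (\<Sum>k<n. a k * iexp (\<Sum>i\<in>F. t k i * y i))\<bar>
              \<le> e + 2 * B * (\<Sum>i\<in>F. (y i)\<^sup>2 / L\<^sup>2)"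
  shows "\<bar>(\<integral>\<omega>. f (\<lambda>i\<in>F. Y i \<omega>) \<partial>M) - Re (\<Sum>k<n. a k * (\<integral>\<omega>. iexp (\<Sum>i\<in>F. t k i * Y i \<omega>) \<partial>M))\<bar>
    \<le> e + 2 * B * (real (card F) * K / L\<^sup>2)"
proof -
  have B0: "B \<ge> 0" using B[of "\<lambda>i\<in>F. 0"] by simp
  let ?p = "\<lambda>\<omega>. Re (\<Sum>k<n. a k * iexp (\<Sum>i\<in>F. t k i * Y i \<omega>))"
  have fi: "integrable M (\<lambda>\<omega>. f (\<lambda>i\<in>F. Y i \<omega>))"
    using B by (intro integrable_const_bound[of _ B] measurable_continuous_restrict f Y) auto
  have pi: "integrable M ?p"
    using trig_poly_expectation(1)[OF Y] by (rule integrable_Re)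
  have si: "integrable M (\<lambda>\<omega>. e + 2 * B * (\<Sum>i\<in>F. (Y i \<omega>)\<^sup>2 / L\<^sup>2))"
    using Y2 by auto
  have "\<bar>(\<integral>\<omega>. f (\<lambda>i\<in>F. Y i \<omega>) \<partial>M) - (\<integral>\<omega>. ?p \<omega> \<partial>M)\<bar> = \<bar>\<integral>\<omega>. f (\<lambda>i\<in>F. Y i \<omega>) - ?p \<omega> \<partial>M\<bar>"
    using fi pi by simp
  also have "\<dots> \<le> (\<integral>\<omega>. \<bar>f (\<lambda>i\<in>F. Y i \<omega>) - ?p \<omega>\<bar> \<partial>M)"
    by (rule integral_abs_bound)
  also have "\<dots> \<le> (\<integral>\<omega>. e + 2 * B * (\<Sum>i\<in>F. (Y i \<omega>)\<^sup>2 / L\<^sup>2) \<partial>M)"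
  proof (intro integral_mono si integrable_abs Bochner_Integration.integrable_diff fi pi)
    fix \<omega> show "\<bar>f (\<lambda>i\<in>F. Y i \<omega>) - ?p \<omega>\<bar> \<le> e + 2 * B * (\<Sum>i\<in>F. (Y i \<omega>)\<^sup>2 / L\<^sup>2)"
      using p[of "\<lambda>i. Y i \<omega>"] by simp
  qed
  also have "\<dots> = e + 2 * B * (\<Sum>i\<in>F. (\<integral>\<omega>. (Y i \<omega>)\<^sup>2 \<partial>M) / L\<^sup>2)"
    using Y2 by (simp add: prob_space)
  also have "\<dots> \<le> e + 2 * B * (\<Sum>i\<in>F. K / L\<^sup>2)"
    using K B0 by (intro add_left_mono mult_left_mono sum_mono divide_right_mono) auto
  also have "(\<Sum>i\<in>F. K / L\<^sup>2) = real (card F) * K / L\<^sup>2" by simp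
  finally show ?thesis
    by (simp only: trig_poly_expectation(2)[where Y = Y and F = F, OF Y])
qed

lemma convergence_of_char_countable:
  fixes f :: "('i :: countable \<Rightarrow> real) \<Rightarrow> real"
  assumes M: "\<And>N. N \<ge> 1 \<Longrightarrow> prob_space (M N)" and P: "prob_space P" and F: "finite F"
    and Y: "\<And>N i. N \<ge> 1 \<Longrightarrow> i \<in> F \<Longrightarrow> Y N i \<in> borel_measurable (M N)"
      "\<And>N i. N \<ge> 1 \<Longrightarrow> i \<in> F \<Longrightarrow> integrable (M N) (\<lambda>\<omega>. (Y N i \<omega>)\<^sup>2)"
      "\<And>N i. N \<ge> 1 \<Longrightarrow> i \<in> F \<Longrightarrow> (\<integral>\<omega>. (Y N i \<omega>)\<^sup>2 \<partial>M N) \<le> K"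
    and z: "\<And>i. i \<in> F \<Longrightarrow> z i \<in> borel_measurable P"
      "\<And>i. i \<in> F \<Longrightarrow> integrable P (\<lambda>\<omega>. (z i \<omega>)\<^sup>2)"
      "\<And>i. i \<in> F \<Longrightarrow> (\<integral>\<omega>. (z i \<omega>)\<^sup>2 \<partial>P) \<le> K"
    and char: "\<And>t. (\<lambda>N. \<integral>\<omega>. iexp (\<Sum>i\<in>F. t i * Y N i \<omega>) \<partial>M N) \<longlonglongrightarrow> (\<integral>\<omega>. iexp (\<Sum>i\<in>F. t i * z i \<omega>) \<partial>P)"
    and f: "continuous_on (F \<rightarrow>\<^sub>E UNIV) f" and B: "\<And>y. y \<in> F \<rightarrow>\<^sub>E UNIV \<Longrightarrow> \<bar>f y\<bar> \<le> B"
  shows "(\<lambda>N. \<integral>\<omega>. f (\<lambda>i\<in>F. Y N i \<omega>) \<partial>M N) \<longlonglongrightarrow> (\<integral>\<omega>. f (\<lambda>i\<in>F. z i \<omega>) \<partial>P)"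
proof (rule LIMSEQ_I)
  fix r :: real assume r: "r > 0"
  \<comment> \<open>\<open>L\<close> is chosen so that \<open>8 * D / L\<^sup>2 = r\<close>, which
    makes the moment error at most \<open>r / 8\<close>. The added 1 keeps \<open>D\<close>
    positive. In total the errors on both sides and the distance of the characteristic functions add
    up to less than \<open>r\<close>.\<close>
  define D where "D = \<bar>2 * B * (real (card F) * K)\<bar> + 1"
  define L where "L = sqrt (8 * D / r)"
  have D: "D > 0" by (simp add: D_def)
  have L: "L > 0" using D r by (simp add: L_def)
  have L2: "2 * B * (real (card F) * K / L\<^sup>2) \<le> r / 8"
  proof -
    have "2 * B * (real (card F) * K / L\<^sup>2) = 2 * B * (real (card F) * K) / (8 * D / r)"
      using D r by (simp add: L_def)
    also have "\<dots> \<le> D / (8 * D / r)"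
      using D r by (intro divide_right_mono) (auto simp: D_def)
    also have "\<dots> = r / 8" using D by simp
    finally show ?thesis .
  qed
  obtain p where p: "trig_poly F p" "\<And>y. \<bar>f (restrict y F) - Re (p y)\<bar> \<le> r / 8 + 2 * B * (\<Sum>i\<in>F. (y i)\<^sup>2 / L\<^sup>2)"
    using trig_approx[OF F L _ f B, of "r / 8"] r by auto
  obtain n :: nat and a t where pe: "p = (\<lambda>y. \<Sum>k<n. a k * iexp (\<Sum>i\<in>F. t k i * y i))"
    using p(1) by (auto simp: trig_poly_def)
  let ?T = "\<lambda>N. Re (\<Sum>k<n. a k * (\<integral>\<omega>. iexp (\<Sum>i\<in>F. t k i * Y N i \<omega>) \<partial>M N))"
  let ?R = "Re (\<Sum>k<n. a k * (\<integral>\<omega>. iexp (\<Sum>i\<in>F. t k i * z i \<omega>) \<partial>P))"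
  have "?T \<longlonglongrightarrow> ?R"
    by (intro tendsto_intros char)
  then have "\<forall>\<^sub>F N in sequentially. \<bar>?T N - ?R\<bar> < r / 4"
    using tendstoD[of ?T ?R sequentially "r / 4"] r by (simp only: dist_real_def)
  then obtain N0 where N0: "\<And>N. N \<ge> N0 \<Longrightarrow> \<bar>?T N - ?R\<bar> < r / 4"
    by (auto simp: eventually_sequentially)
  have 0: "\<bar>(\<integral>\<omega>. f (\<lambda>i\<in>F. z i \<omega>) \<partial>P) - ?R\<bar> \<le> r / 8 + r / 8"
  proof -
    have "\<bar>(\<integral>\<omega>. f (\<lambda>i\<in>F. z i \<omega>) \<partial>P) - ?R\<bar> \<le> r / 8 + 2 * B * (real (card F) * K / L\<^sup>2)"
      by (rule prob_space.test_function_error[OF P F _ _ _ f _ L p(2)[unfolded pe]])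
         (rule z B | assumption)+
    then show ?thesis using L2 by linarith
  qed
  have "norm ((\<integral>\<omega>. f (\<lambda>i\<in>F. Y N i \<omega>) \<partial>M N) - (\<integral>\<omega>. f (\<lambda>i\<in>F. z i \<omega>) \<partial>P)) < r" if N: "N \<ge> max N0 1" for N
  proof -
    have N1: "N \<ge> 1" using N by simp
    have "\<bar>(\<integral>\<omega>. f (\<lambda>i\<in>F. Y N i \<omega>) \<partial>M N) - ?T N\<bar> \<le> r / 8 + r / 8"
    proof -
      have "\<bar>(\<integral>\<omega>. f (\<lambda>i\<in>F. Y N i \<omega>) \<partial>M N) - ?T N\<bar> \<le> r / 8 + 2 * B * (real (card F) * K / L\<^sup>2)"
        by (rule prob_space.test_function_error[OF M[OF N1] F _ _ _ f _ L p(2)[unfolded pe]])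
           (rule Y[OF N1] B | assumption)+
      then show ?thesis using L2 by linarith
    qed
    then show ?thesis using 0 N0[of N] N r unfolding real_norm_def by linarith
  qed
  then show "\<exists>n0. \<forall>N\<ge>n0. norm ((\<integral>\<omega>. f (\<lambda>i\<in>F. Y N i \<omega>) \<partial>M N) - (\<integral>\<omega>. f (\<lambda>i\<in>F. z i \<omega>) \<partial>P)) < r"
    by blast
qed

text \<open>The product topology is only metrizable over a countable index type, so the finite index set
  is first replaced by a set of naturals.\<close>

lemma fdd_convergence_of_char:
  fixes Y :: "nat \<Rightarrow> 'i \<Rightarrow> 'a \<Rightarrow> real"
  assumes M: "\<And>N. N \<ge> 1 \<Longrightarrow> prob_space (M N)" and P: "prob_space P"
    and Y: "\<And>N i. N \<ge> 1 \<Longrightarrow> i \<in> I \<Longrightarrow> Y N i \<in> borel_measurable (M N)"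
      "\<And>N i. N \<ge> 1 \<Longrightarrow> i \<in> I \<Longrightarrow> integrable (M N) (\<lambda>\<omega>. (Y N i \<omega>)\<^sup>2)"
    and Yb: "\<And>i. i \<in> I \<Longrightarrow> \<exists>K. \<forall>N\<ge>1. (\<integral>\<omega>. (Y N i \<omega>)\<^sup>2 \<partial>M N) \<le> K"
    and z: "\<And>i. i \<in> I \<Longrightarrow> z i \<in> borel_measurable P"
      "\<And>i. i \<in> I \<Longrightarrow> integrable P (\<lambda>\<omega>. (z i \<omega>)\<^sup>2)"
    and char: "\<And>F t. finite F \<Longrightarrow> F \<subseteq> I \<Longrightarrow>
      (\<lambda>N. \<integral>\<omega>. iexp (\<Sum>i\<in>F. t i * Y N i \<omega>) \<partial>M N) \<longlonglongrightarrow> (\<integral>\<omega>. iexp (\<Sum>i\<in>F. t i * z i \<omega>) \<partial>P)"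
  shows "fdd_convergence M Y P z I"
  unfolding fdd_convergence_def
proof (intro allI impI, elim conjE)
  fix F and f :: "('i \<Rightarrow> real) \<Rightarrow> real"
  assume F: "finite F" "F \<subseteq> I" and f: "continuous_on (F \<rightarrow>\<^sub>E UNIV) f" "bounded (f ` (F \<rightarrow>\<^sub>E UNIV))"
  obtain K where K: "\<And>i N. i \<in> I \<Longrightarrow> N \<ge> 1 \<Longrightarrow> (\<integral>\<omega>. (Y N i \<omega>)\<^sup>2 \<partial>M N) \<le> K i"
    using Yb by metis
  define K' where "K' = (\<Sum>i\<in>F. \<bar>K i\<bar> + (\<integral>\<omega>. (z i \<omega>)\<^sup>2 \<partial>P))"
  have K': "\<bar>K i\<bar> + (\<integral>\<omega>. (z i \<omega>)\<^sup>2 \<partial>P) \<le> K'" if "i \<in> F" for i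
    unfolding K'_def using that F by (intro member_le_sum) auto
  have Kz: "(\<integral>\<omega>. (z i \<omega>)\<^sup>2 \<partial>P) \<le> K'" if "i \<in> F" for i
    using K'[OF that] by linarith
  have KY: "(\<integral>\<omega>. (Y N i \<omega>)\<^sup>2 \<partial>M N) \<le> K'" if "i \<in> F" "N \<ge> 1" for i N
  proof -
    have "0 \<le> (\<integral>\<omega>. (z i \<omega>)\<^sup>2 \<partial>P)" by simp
    moreover have "(\<integral>\<omega>. (Y N i \<omega>)\<^sup>2 \<partial>M N) \<le> K i" using K that F by blast
    ultimately show ?thesis using K'[OF that(1)] by linarith
  qed
  obtain e where e: "bij_betw e {0..<card F} F" using ex_bij_betw_nat_finite[OF F(1)] by blast
  define D where "D = {0..<card F}"
  define e' where "e' = inv_into D e"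
  have eD: "bij_betw e D F" using e by (simp add: D_def)
  have eF: "e k \<in> F" "e k \<in> I" if "k \<in> D" for k
    using eD that F by (auto simp: bij_betw_def)
  have e'D: "e' i \<in> D" "e (e' i) = i" if "i \<in> F" for i
    using bij_betwE[OF bij_betw_inv_into[OF eD]] bij_betw_inv_into_right[OF eD] that
    by (auto simp: e'_def)
  have ee': "e' (e k) = k" if "k \<in> D" for k
    using bij_betw_inv_into_left[OF eD that] by (simp add: e'_def)
  define g where "g y = f (\<lambda>i\<in>F. y (e' i))" for y :: "nat \<Rightarrow> real"
  have "continuous_on (D \<rightarrow>\<^sub>E UNIV) (\<lambda>y::nat \<Rightarrow> real. \<lambda>i\<in>F. y (e' i))"
  proof (rule continuous_on_coordinatewise_then_product)
    fix i show "continuous_on (D \<rightarrow>\<^sub>E UNIV) (\<lambda>y::nat \<Rightarrow> real. (\<lambda>i\<in>F. y (e' i)) i)"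
      by (cases "i \<in> F") (auto intro: continuous_on_proj)
  qed
  then have gc: "continuous_on (D \<rightarrow>\<^sub>E UNIV) g"
    unfolding g_def by (rule continuous_on_compose2[OF f(1)]) auto
  obtain B where B: "\<And>y. y \<in> F \<rightarrow>\<^sub>E UNIV \<Longrightarrow> \<bar>f y\<bar> \<le> B"
    using f(2) by (auto simp: bounded_iff)
  have gB: "\<bar>g y\<bar> \<le> B" for y unfolding g_def by (intro B) auto
  have sums: "(\<Sum>k\<in>D. t k * w (e k)) = (\<Sum>i\<in>F. t (e' i) * w i)" for t and w :: "'i \<Rightarrow> real"
    using sum.reindex_bij_betw[OF e, of "\<lambda>i. t (e' i) * w i"] ee' by (simp add: D_def)
  have ch: "(\<lambda>N. \<integral>\<omega>. iexp (\<Sum>k\<in>D. t k * Y N (e k) \<omega>) \<partial>M N) \<longlonglongrightarrow>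
      (\<integral>\<omega>. iexp (\<Sum>k\<in>D. t k * z (e k) \<omega>) \<partial>P)" for t
  proof -
    have "(\<Sum>k\<in>D. t k * Y N (e k) \<omega>) = (\<Sum>i\<in>F. t (e' i) * Y N i \<omega>)" for N \<omega>
      by (rule sums[of t "\<lambda>i. Y N i \<omega>"])
    moreover have "(\<Sum>k\<in>D. t k * z (e k) \<omega>) = (\<Sum>i\<in>F. t (e' i) * z i \<omega>)" for \<omega>
      by (rule sums[of t "\<lambda>i. z i \<omega>"])
    ultimately show ?thesis using char[OF F, of "\<lambda>i. t (e' i)"] by (simp only:)
  qed
  have fD: "finite D" by (simp add: D_def)
  have "(\<lambda>N. \<integral>\<omega>. g (\<lambda>k\<in>D. Y N (e k) \<omega>) \<partial>M N) \<longlonglongrightarrow> (\<integral>\<omega>. g (\<lambda>k\<in>D. z (e k) \<omega>) \<partial>P)"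
    by (rule convergence_of_char_countable[where K = K' and B = B, OF M P fD _ _ _ _ _ _ ch gc gB])
       (use Y z eF KY Kz in auto)
  moreover have gf: "g (\<lambda>k\<in>D. w (e k)) = f (\<lambda>i\<in>F. w i)" for w
    unfolding g_def using e'D by (intro arg_cong[of _ _ f] ext) auto
  have "g (\<lambda>k\<in>D. Y N (e k) \<omega>) = f (\<lambda>i\<in>F. Y N i \<omega>)" for N \<omega> by (rule gf)
  moreover have "g (\<lambda>k\<in>D. z (e k) \<omega>) = f (\<lambda>i\<in>F. z i \<omega>)" for \<omega> by (rule gf)
  ultimately show "(\<lambda>N. \<integral>\<omega>. f (\<lambda>i\<in>F. Y N i \<omega>) \<partial>M N) \<longlonglongrightarrow> (\<integral>\<omega>. f (\<lambda>i\<in>F. z i \<omega>) \<partial>P)"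
    by (simp only:)
qed


section \<open>Gaussian families with a given covariance\<close>

definition psd :: "(nat \<Rightarrow> nat \<Rightarrow> real) \<Rightarrow> bool" where
  "psd K \<longleftrightarrow> (\<forall>i j. K i j = K j i) \<and> (\<forall>n c. 0 \<le> (\<Sum>i<n. \<Sum>j<n. c i * c j * K i j))"

text \<open>The division by zero convention gives the right value for a vanishing pivot.\<close>

definition schur :: "(nat \<Rightarrow> nat \<Rightarrow> real) \<Rightarrow> nat \<Rightarrow> nat \<Rightarrow> nat \<Rightarrow> real" where
  "schur K n i j = K i j - K i n * K j n / K n n"

text \<open>The quadratic form at \<open>c + t e_n\<close>. Since \<open>n\<close> may lie on either
  side of \<open>m\<close>, both vectors are padded with zeros to a common length. Read as a
  polynomial in \<open>t\<close>, the inequality gives both facts about pivots that the elimination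
  requires.\<close>

lemma psd_shift:
  assumes "psd K"
  shows "0 \<le> (\<Sum>i<m. \<Sum>j<m. c i * c j * K i j) + 2 * t * (\<Sum>i<m. c i * K i n) + t\<^sup>2 * K n n"
proof -
  define N where "N = Suc (max m n)"
  define d where "d i = (if i < m then c i else 0)" for i
  define u where "u i = (if i = n then t else 0)" for i
  have mN: "{..<m} \<subseteq> {..<N}" by (auto simp: N_def)
  have sd: "(\<Sum>i<N. d i * f i) = (\<Sum>i<m. c i * f i)" for f :: "nat \<Rightarrow> real"
    using mN by (intro sum.mono_neutral_cong_right) (auto simp: d_def)
  have su: "(\<Sum>i<N. u i * f i) = t * f n" for f :: "nat \<Rightarrow> real"
  proof -
    have "(\<Sum>i<N. u i * f i) = (\<Sum>i\<in>{n}. t * f i)"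
      by (intro sum.mono_neutral_cong_right) (auto simp: u_def N_def)
    then show ?thesis by simp
  qed
  have "0 \<le> (\<Sum>i<N. \<Sum>j<N. (d i + u i) * (d j + u j) * K i j)"
    by (rule assms[unfolded psd_def, THEN conjunct2, rule_format, of "\<lambda>i. d i + u i" N])
  also have "\<dots> = (\<Sum>i<N. (d i + u i) * (\<Sum>j<N. d j * K i j + u j * K i j))"
    by (simp add: sum_distrib_left algebra_simps)
  also have "\<dots> = (\<Sum>i<N. (d i + u i) * ((\<Sum>j<m. c j * K i j) + t * K i n))"
    by (simp only: sum.distrib sd su)
  also have "\<dots> = (\<Sum>i<N. d i * ((\<Sum>j<m. c j * K i j) + t * K i n)) + (\<Sum>i<N. u i * ((\<Sum>j<m. c j * K i j) + t * K i n))"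
    by (simp add: ring_distribs sum.distrib)
  also have "\<dots> = (\<Sum>i<m. c i * ((\<Sum>j<m. c j * K i j) + t * K i n)) + t * ((\<Sum>j<m. c j * K n j) + t * K n n)"
    by (simp only: sd su)
  also have "(\<Sum>j<m. c j * K n j) = (\<Sum>i<m. c i * K i n)"
    using assms unfolding psd_def by (intro sum.cong refl) simp
  finally show ?thesis
    by (simp add: ring_distribs sum.distrib sum_distrib_left sum_distrib_right power2_eq_square mult_ac)
qed

lemma psd_diag: "psd K \<Longrightarrow> 0 \<le> K n n"
  using psd_shift[of K "\<lambda>_. 0" 0 1 n] by simp

lemma psd_zero_pivot:
  assumes "psd K" "K n n = 0"
  shows "K i n = 0"
proof (rule ccontr)
  assume ne: "K i n \<noteq> 0"
  \<comment> \<open>With a vanishing pivot the form is affine in \<open>t\<close>; this value of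
    \<open>t\<close> makes it equal to -1.\<close>
  define t where "t = - (K i i + 1) / (2 * K i n)"
  have "0 \<le> (\<Sum>a<Suc i. \<Sum>b<Suc i. (if a = i then 1 else 0) * (if b = i then 1 else 0) * K a b)
      + 2 * t * (\<Sum>a<Suc i. (if a = i then 1 else 0) * K a n) + t\<^sup>2 * K n n"
    by (rule psd_shift[OF assms(1)])
  also have "\<dots> = K i i + 2 * t * K i n"
    using assms(2) by (simp add: sum.lessThan_Suc)
  also have "\<dots> = - 1" using ne by (simp add: t_def field_simps)
  finally show False by simp
qed

lemma psd_schur:
  assumes "psd K"
  shows "psd (schur K n)"
  unfolding psd_def
proof (intro conjI allI)
  fix i j show "schur K n i j = schur K n j i"
    using assms by (simp add: schur_def psd_def mult.commute)
next
  fix m and c :: "nat \<Rightarrow> real"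
  let ?Q = "\<Sum>i<m. \<Sum>j<m. c i * c j * K i j" and ?b = "\<Sum>i<m. c i * K i n"
  have "(\<Sum>i<m. \<Sum>j<m. c i * c j * schur K n i j) =
      ?Q - (\<Sum>i<m. \<Sum>j<m. (c i * K i n) * (c j * K j n)) / K n n"
    by (simp add: schur_def sum_subtractf sum_divide_distrib algebra_simps)
  also have "(\<Sum>i<m. \<Sum>j<m. (c i * K i n) * (c j * K j n)) = ?b\<^sup>2"
    by (simp add: sum_product power2_eq_square)
  finally have e: "(\<Sum>i<m. \<Sum>j<m. c i * c j * schur K n i j) = ?Q - ?b\<^sup>2 / K n n" .
  \<comment> \<open>The minimizer in \<open>t\<close>. For \<open>K n n = 0\<close> the quotient is
    0 and the inequality reduces to \<open>0 \<le> ?Q\<close>.\<close>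
  have "0 \<le> ?Q + 2 * (- ?b / K n n) * ?b + (- ?b / K n n)\<^sup>2 * K n n"
    by (rule psd_shift[OF assms])
  also have "\<dots> = ?Q - ?b\<^sup>2 / K n n"
    by (cases "K n n = 0") (auto simp: field_simps power2_eq_square)
  finally show "0 \<le> (\<Sum>i<m. \<Sum>j<m. c i * c j * schur K n i j)" using e by simp
qed

text \<open>Elimination of one index at a time: step \<open>n\<close> subtracts the rank-one part
  belonging to pivot \<open>n\<close> and leaves row and column \<open>n\<close> zero for good. For
  fixed \<open>i\<close> and \<open>j\<close> finitely many steps exhaust the entry, so an infinite
  or degenerate \<open>K\<close> causes no difficulty.\<close>

lemma psd_cholesky:
  assumes "psd K"
  obtains L :: "nat \<Rightarrow> nat \<Rightarrow> real"
  where "\<And>i m. i < m \<Longrightarrow> L i m = 0" "\<And>i j n. j < n \<Longrightarrow> K i j = (\<Sum>m<n. L i m * L j m)"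
proof -
  define S where "S = rec_nat K (\<lambda>n k. schur k n)"
  have S0: "S 0 = K" and SS: "S (Suc n) = schur (S n) n" for n by (simp_all add: S_def)
  have P: "psd (S n)" for n by (induction n) (simp_all add: S0 SS assms psd_schur)
  then have sym: "S n i j = S n j i" for n i j by (simp add: psd_def)
  have Z: "S n i j = 0" if "j < n" for n i j
    using that
  proof (induction n arbitrary: i)
    case (Suc n)
    have pz: "S n n n = 0 \<Longrightarrow> S n i n = 0" by (rule psd_zero_pivot[OF P])
    show ?case
    proof (cases "j = n")
      case True then show ?thesis using pz by (auto simp: SS schur_def)
    next
      case False
      then have "S n i j = 0" "S n n j = 0" using Suc.IH[of i] Suc.IH[of n] Suc.prems by simp_all
      moreover have "S n j n = S n n j" by (rule sym)
      ultimately show ?thesis by (simp add: SS schur_def)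
    qed
  qed simp
  define L where "L i m = S m i m / sqrt (S m m m)" for i m
  have LL: "L i m * L j m = S m i m * S m j m / S m m m" for i j m
    using psd_diag[OF P[of m], of m] by (simp add: L_def)
  have E: "K i j = S n i j + (\<Sum>m<n. L i m * L j m)" for n i j
    by (induction n) (simp_all add: S0 SS schur_def LL)
  show ?thesis
  proof
    show "L i m = 0" if "i < m" for i m using Z[OF that, of m] by (simp add: L_def sym[of m i m])
    show "K i j = (\<Sum>m<n. L i m * L j m)" if "j < n" for i j n using E[of i j n] Z[OF that] by simp
  qed
qed

lemma indep_vars_PiM_coords:
  assumes "\<And>i. i \<in> I \<Longrightarrow> prob_space (D i)" "I \<noteq> {}"
  shows "prob_space.indep_vars (PiM I D) D (\<lambda>i \<omega>. \<omega> i) I"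
proof -
  interpret prob_space "PiM I D" by (intro prob_space_PiM assms)
  have "distr (PiM I D) (PiM I D) (\<lambda>\<omega>. \<lambda>i\<in>I. \<omega> i) = distr (PiM I D) (PiM I D) (\<lambda>\<omega>. \<omega>)"
    by (intro distr_cong) (auto simp: space_PiM)
  also have "\<dots> = PiM I D" by (simp add: distr_id)
  also have "\<dots> = (\<Pi>\<^sub>M i\<in>I. distr (PiM I D) (D i) (\<lambda>\<omega>. \<omega> i))"
    using assms by (intro PiM_cong) (auto simp: distr_PiM_component)
  finally show ?thesis using assms(2) by (subst indep_vars_iff_distr_eq_PiM') auto
qed

lemma (in prob_space) indep_vars_reindex:
  assumes "indep_vars M' X (f ` J)" "inj_on f J"
  shows "indep_vars (\<lambda>j. M' (f j)) (\<lambda>j. X (f j)) J"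
proof -
  have "indep_vars (\<lambda>j. PiM {f j} M') (\<lambda>j \<omega>. restrict (\<lambda>i. X i \<omega>) {f j}) J"
    using assms by (intro indep_vars_restrict[OF assms(1)])
      (auto simp: disjoint_family_on_def inj_on_def)
  from indep_vars_compose2[OF this, of "\<lambda>j y. y (f j)" "\<lambda>j. M' (f j)"]
  show ?thesis by simp
qed

text \<open>\<open>emb\<close> places a sequence of independent standard normals among the
  coordinates of the sample space \<open>'j \<Rightarrow> real\<close>, whose type is prescribed in
  the end. Positivity is asked for sequences \<open>e\<close> with repetitions, because
  \<open>from_nat_into\<close> enumerates a finite \<open>I\<close> with repetitions.\<close>

lemma gaussian_family_exists:
  fixes K :: "'i \<Rightarrow> 'i \<Rightarrow> real" and emb :: "nat \<Rightarrow> 'j"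
  assumes I: "countable I" and ne: "I \<noteq> {}" and sym: "\<And>i j. i \<in> I \<Longrightarrow> j \<in> I \<Longrightarrow> K i j = K j i"
    and psdK: "\<And>(n :: nat) c (e :: nat \<Rightarrow> 'i). (\<And>a. a < n \<Longrightarrow> e a \<in> I) \<Longrightarrow> 0 \<le> (\<Sum>a<n. \<Sum>b<n. c a * c b * K (e a) (e b))"
    and emb: "inj emb"
  shows "\<exists>(P :: ('j \<Rightarrow> real) measure) z. prob_space P \<and>
    (\<forall>i\<in>I. z i \<in> borel_measurable P \<and> integrable P (\<lambda>\<omega>. (z i \<omega>)\<^sup>2) \<and> (\<integral>\<omega>. z i \<omega> \<partial>P) = 0) \<and>
    (\<forall>i\<in>I. \<forall>j\<in>I. (\<integral>\<omega>. z i \<omega> * z j \<omega> \<partial>P) = K i j) \<and>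
    (\<forall>F t. finite F \<longrightarrow> F \<subseteq> I \<longrightarrow> (\<integral>\<omega>. iexp (\<Sum>i\<in>F. t i * z i \<omega>) \<partial>P) =
       complex_of_real (exp (- (\<Sum>i\<in>F. \<Sum>j\<in>F. t i * t j * K i j) / 2)))"
proof -
  define e where "e = from_nat_into I"
  have eI: "e n \<in> I" for n using ne by (simp add: e_def from_nat_into)
  have "psd (\<lambda>m n. K (e m) (e n))"
    unfolding psd_def using sym eI psdK[of _ e] by blast
  then obtain L :: "nat \<Rightarrow> nat \<Rightarrow> real" where L0: "\<And>i m. i < m \<Longrightarrow> L i m = 0"
    and LK: "\<And>i j n. j < n \<Longrightarrow> K (e i) (e j) = (\<Sum>m<n. L i m * L j m)"
    by (rule psd_cholesky) blast
  define d where "d = to_nat_on I"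
  have ed: "e (d i) = i" if "i \<in> I" for i using that I by (simp add: e_def d_def)
  define P where "P = (\<Pi>\<^sub>M j\<in>(UNIV :: 'j set). std_normal_distribution)"
  interpret SN: real_distribution std_normal_distribution by (rule real_dist_normal_dist)
  interpret prob_space P unfolding P_def by (intro prob_space_PiM SN.prob_space_axioms)
  define g where "g m \<omega> = \<omega> (emb m)" for m and \<omega> :: "'j \<Rightarrow> real"
  have "indep_vars (\<lambda>_. std_normal_distribution) (\<lambda>j \<omega>. \<omega> j) (UNIV :: 'j set)"
    unfolding P_def by (intro indep_vars_PiM_coords SN.prob_space_axioms) simp
  then have "indep_vars (\<lambda>_. std_normal_distribution) (\<lambda>j \<omega>. \<omega> j) (range emb)"
    by (rule indep_vars_subset) simp
  then have "indep_vars (\<lambda>_. std_normal_distribution) (\<lambda>m \<omega>. \<omega> (emb m)) UNIV"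
    using emb by (rule indep_vars_reindex)
  then have ind0: "indep_vars (\<lambda>_. std_normal_distribution) g UNIV"
    by (simp add: g_def[abs_def])
  have ind: "indep_vars (\<lambda>_. borel) g UNIV"
    using indep_vars_compose2[OF ind0, of "\<lambda>_ x. x" "\<lambda>_. borel"] by simp
  have gm [measurable]: "g m \<in> borel_measurable P" for m
    using ind unfolding indep_vars_def by simp
  have gd: "distr P borel (g m) = std_normal_distribution" for m
  proof -
    have "distr P std_normal_distribution (\<lambda>\<omega>. \<omega> (emb m)) = std_normal_distribution"
      unfolding P_def by (rule distr_PiM_component) (auto intro: SN.prob_space_axioms)
    moreover have "distr P borel (g m) = distr P std_normal_distribution (g m)"
      by (intro distr_cong) auto
    ultimately show ?thesis by (simp add: g_def[abs_def])
  qed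
  have gi: "integrable P (\<lambda>\<omega>. (g m \<omega>) ^ k)" for m k
  proof -
    have "integrable (distr P borel (g m)) (\<lambda>x. x ^ k)"
      unfolding gd by (rule integrable_std_normal_distribution_moment)
    then show ?thesis by (simp add: integrable_distr_eq)
  qed
  have ge: "(\<integral>\<omega>. (g m \<omega>) ^ k \<partial>P) = (\<integral>x. x ^ k \<partial>std_normal_distribution)" for m k
    unfolding gd[of m, symmetric] by (simp add: integral_distr)
  have g1: "integrable P (g m)" "(\<integral>\<omega>. g m \<omega> \<partial>P) = 0" for m
    using gi[of m 1] ge[of m 1] integral_std_normal_distribution_moment_odd[of 1] by simp_all
  have g2: "(\<integral>\<omega>. (g m \<omega>)\<^sup>2 \<partial>P) = 1" for m
    using ge[of m 2] std_normal_distribution_even_moments(1)[of 1] by simp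
  have gg: "integrable P (\<lambda>\<omega>. g m \<omega> * g n \<omega>)" "(\<integral>\<omega>. g m \<omega> * g n \<omega> \<partial>P) = (if m = n then 1 else 0)" for m n
  proof -
    have "integrable P (\<lambda>\<omega>. g m \<omega> * g n \<omega>) \<and> (\<integral>\<omega>. g m \<omega> * g n \<omega> \<partial>P) = (if m = n then 1 else 0)"
    proof (cases "m = n")
      case True
      then show ?thesis using gi[of n 2] g2[of n] by (simp add: power2_eq_square)
    next
      case False
      have i2: "indep_vars (\<lambda>_. borel) g {m, n}" by (rule indep_vars_subset[OF ind]) simp
      from indep_vars_lebesgue_integral[OF _ i2] indep_vars_integrable[OF _ i2]
      show ?thesis using False g1 by simp
    qed
    then show "integrable P (\<lambda>\<omega>. g m \<omega> * g n \<omega>)" "(\<integral>\<omega>. g m \<omega> * g n \<omega> \<partial>P) = (if m = n then 1 else 0)" by auto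
  qed
  define z where "z i \<omega> = (\<Sum>m<Suc (d i). L (d i) m * g m \<omega>)" for i \<omega>
  \<comment> \<open>Since \<open>L\<close> is triangular, finitely many \<open>z i\<close> can be
    expanded over one common range of normals.\<close>
  have zn: "z i \<omega> = (\<Sum>m<n. L (d i) m * g m \<omega>)" if "d i < n" for i \<omega> n
    unfolding z_def using that by (intro sum.mono_neutral_left) (auto simp: L0)
  have zm: "z i \<in> borel_measurable P" for i
    unfolding z_def[abs_def] by measurable
  have zz: "integrable P (\<lambda>\<omega>. z i \<omega> * z j \<omega>)"
    "i \<in> I \<Longrightarrow> j \<in> I \<Longrightarrow> (\<integral>\<omega>. z i \<omega> * z j \<omega> \<partial>P) = K i j" for i j
  proof -
    define n where "n = Suc (max (d i) (d j))"
    have n: "d i < n" "d j < n" by (auto simp: n_def)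
    have e: "(\<lambda>\<omega>. z i \<omega> * z j \<omega>) = (\<lambda>\<omega>. \<Sum>m<n. \<Sum>k<n. L (d i) m * L (d j) k * (g m \<omega> * g k \<omega>))"
      by (simp add: zn[OF n(1)] zn[OF n(2)] sum_product mult_ac)
    show "integrable P (\<lambda>\<omega>. z i \<omega> * z j \<omega>)" unfolding e using gg(1) by auto
    assume ij: "i \<in> I" "j \<in> I"
    have "(\<integral>\<omega>. z i \<omega> * z j \<omega> \<partial>P) = (\<Sum>m<n. \<Sum>k<n. L (d i) m * L (d j) k * (if m = k then 1 else 0))"
      unfolding e using gg by simp
    also have "\<dots> = (\<Sum>m<n. L (d i) m * L (d j) m)"
      by (simp add: if_distrib[of "\<lambda>x. _ * x"] cong: if_cong)
    also have "\<dots> = K (e (d i)) (e (d j))" by (rule LK[symmetric]) (simp add: n_def)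
    finally show "(\<integral>\<omega>. z i \<omega> * z j \<omega> \<partial>P) = K i j" using ij ed by simp
  qed
  have z0: "(\<integral>\<omega>. z i \<omega> \<partial>P) = 0" for i
    unfolding z_def using g1 by simp
  have zc: "(\<integral>\<omega>. iexp (\<Sum>i\<in>F. t i * z i \<omega>) \<partial>P) =
       complex_of_real (exp (- (\<Sum>i\<in>F. \<Sum>j\<in>F. t i * t j * K i j) / 2))" if F: "finite F" "F \<subseteq> I" for F t
  proof -
    obtain n where n: "\<And>i. i \<in> F \<Longrightarrow> d i < n"
      using F(1) finite_nat_set_iff_bounded[of "d ` F"] by auto
    define b where "b m = (\<Sum>i\<in>F. t i * L (d i) m)" for m
    have s: "(\<Sum>i\<in>F. t i * z i \<omega>) = (\<Sum>m<n. b m * g m \<omega>)" for \<omega>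
    proof -
      have "(\<Sum>i\<in>F. t i * z i \<omega>) = (\<Sum>i\<in>F. \<Sum>m<n. t i * L (d i) m * g m \<omega>)"
      proof (intro sum.cong refl)
        fix i assume "i \<in> F"
        then show "t i * z i \<omega> = (\<Sum>m<n. t i * L (d i) m * g m \<omega>)"
          by (simp add: zn[OF n] sum_distrib_left mult.assoc)
      qed
      then show ?thesis by (subst (asm) sum.swap) (simp add: b_def sum_distrib_right)
    qed
    have "indep_vars (\<lambda>_. borel) (\<lambda>m \<omega>. b m * g m \<omega>) {..<n}"
      by (rule indep_vars_compose2[OF indep_vars_subset[OF ind]]) auto
    then have "char (distr P borel (\<lambda>\<omega>. \<Sum>m<n. b m * g m \<omega>)) 1 = (\<Prod>m<n. char (distr P borel (\<lambda>\<omega>. b m * g m \<omega>)) 1)"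
      by (rule char_distr_sum)
    also have "\<dots> = (\<Prod>m<n. complex_of_real (exp (- (b m)\<^sup>2 / 2)))"
    proof (intro prod.cong refl)
      fix m
      have "char (distr P borel (\<lambda>\<omega>. b m * g m \<omega>)) 1 = char (distr P borel (g m)) (b m)"
        by (simp add: char_def integral_distr)
      then show "char (distr P borel (\<lambda>\<omega>. b m * g m \<omega>)) 1 = complex_of_real (exp (- (b m)\<^sup>2 / 2))"
        by (simp add: gd char_std_normal_distribution)
    qed
    also have "\<dots> = complex_of_real (exp (- (\<Sum>m<n. (b m)\<^sup>2) / 2))"
      by (simp add: sum_negf sum_divide_distrib flip: of_real_prod exp_sum)
    also have "(\<Sum>m<n. (b m)\<^sup>2) = (\<Sum>i\<in>F. \<Sum>j\<in>F. t i * t j * K i j)"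
    proof -
      have "(\<Sum>m<n. (b m)\<^sup>2) = (\<Sum>m<n. \<Sum>i\<in>F. \<Sum>j\<in>F. t i * t j * (L (d i) m * L (d j) m))"
        by (simp add: b_def power2_eq_square sum_product mult_ac)
      also have "\<dots> = (\<Sum>i\<in>F. \<Sum>j\<in>F. \<Sum>m<n. t i * t j * (L (d i) m * L (d j) m))"
        by (subst sum.swap) (intro sum.cong refl sum.swap)
      also have "\<dots> = (\<Sum>i\<in>F. \<Sum>j\<in>F. t i * t j * K i j)"
      proof (intro sum.cong refl)
        fix i j assume ij: "i \<in> F" "j \<in> F"
        have "K (e (d i)) (e (d j)) = (\<Sum>m<n. L (d i) m * L (d j) m)" by (rule LK) (rule n[OF ij(2)])
        then show "(\<Sum>m<n. t i * t j * (L (d i) m * L (d j) m)) = t i * t j * K i j"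
          using ij F ed by (simp add: sum_distrib_left subset_iff)
      qed
      finally show ?thesis .
    qed
    finally show ?thesis by (simp add: s char_def integral_distr)
  qed
  show ?thesis
    by (rule exI[of _ P], rule exI[of _ z])
       (use zm zz z0 zc prob_space_axioms in \<open>auto simp: power2_eq_square\<close>)
qed


section \<open>A central limit theorem for dissociated sums\<close>

text \<open>The integrability class of the limit theorem: it is closed under sums, and products of
  four members are integrable, as the variance of a quadratic form in the summands requires.\<close>

definition L4 :: "'a measure \<Rightarrow> ('a \<Rightarrow> real) \<Rightarrow> bool" where
  "L4 M f \<longleftrightarrow> f \<in> borel_measurable M \<and> integrable M (\<lambda>x. f x ^ 4)"

lemma abs_prod4_le: "\<bar>a * b * c * d\<bar> \<le> a ^ 4 + b ^ 4 + c ^ 4 + d ^ 4" for a b c d :: real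
proof -
  have sq: "\<bar>x * y\<bar> \<le> (x\<^sup>2 + y\<^sup>2) / 2" for x y :: real
    using sum_squares_bound[of "\<bar>x\<bar>" "\<bar>y\<bar>"] by (simp add: abs_mult)
  have "\<bar>a * b * c * d\<bar> = \<bar>(a * b) * (c * d)\<bar>" by (simp add: mult.assoc)
  also have "\<dots> \<le> ((a * b)\<^sup>2 + (c * d)\<^sup>2) / 2" by (rule sq)
  also have "(a * b)\<^sup>2 \<le> (a ^ 4 + b ^ 4) / 2"
    using sq[of "a\<^sup>2" "b\<^sup>2"] by (simp add: power_mult_distrib flip: power_mult)
  also have "(c * d)\<^sup>2 \<le> (c ^ 4 + d ^ 4) / 2"
    using sq[of "c\<^sup>2" "d\<^sup>2"] by (simp add: power_mult_distrib flip: power_mult)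
  also have "((a ^ 4 + b ^ 4) / 2 + (c ^ 4 + d ^ 4) / 2) / 2 \<le> a ^ 4 + b ^ 4 + c ^ 4 + d ^ 4"
  proof -
    have "0 \<le> a ^ 4" "0 \<le> b ^ 4" "0 \<le> c ^ 4" "0 \<le> d ^ 4" by simp_all
    then show ?thesis by (simp add: field_simps)
  qed
  finally show ?thesis by simp
qed

lemma L4_measurable: "L4 M f \<Longrightarrow> f \<in> borel_measurable M"
  by (simp add: L4_def)

lemma L4_integrable_mult4:
  assumes "L4 M f" "L4 M g" "L4 M h" "L4 M k"
  shows "integrable M (\<lambda>x. f x * g x * h x * k x)"
proof (rule Bochner_Integration.integrable_bound)
  show "integrable M (\<lambda>x. f x ^ 4 + g x ^ 4 + h x ^ 4 + k x ^ 4)"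
    using assms by (auto simp: L4_def)
  show "(\<lambda>x. f x * g x * h x * k x) \<in> borel_measurable M"
    using assms by (auto simp: L4_def)
  show "AE x in M. norm (f x * g x * h x * k x) \<le> norm (f x ^ 4 + g x ^ 4 + h x ^ 4 + k x ^ 4)"
    using abs_prod4_le by (intro AE_I2) (metis abs_ge_self order_trans real_norm_def)
qed

lemma L4_add:
  assumes "L4 M f" "L4 M g"
  shows "L4 M (\<lambda>x. f x + g x)"
proof -
  have "integrable M (\<lambda>x. f x * f x * f x * f x)" "integrable M (\<lambda>x. f x * f x * f x * g x)"
    "integrable M (\<lambda>x. f x * f x * g x * g x)" "integrable M (\<lambda>x. f x * g x * g x * g x)"
    "integrable M (\<lambda>x. g x * g x * g x * g x)"
    by (intro L4_integrable_mult4 assms)+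
  then have "integrable M (\<lambda>x. f x * f x * f x * f x + 4 * (f x * f x * f x * g x)
      + 6 * (f x * f x * g x * g x) + 4 * (f x * g x * g x * g x) + g x * g x * g x * g x)"
    by auto
  also have "(\<lambda>x. f x * f x * f x * f x + 4 * (f x * f x * f x * g x)
      + 6 * (f x * f x * g x * g x) + 4 * (f x * g x * g x * g x) + g x * g x * g x * g x) =
      (\<lambda>x. (f x + g x) ^ 4)"
    by (simp add: fun_eq_iff power4_eq_xxxx algebra_simps)
  finally show ?thesis using assms by (auto simp: L4_def)
qed

lemma L4_cmult: "L4 M f \<Longrightarrow> L4 M (\<lambda>x. c * f x)"
  by (auto simp: L4_def power_mult_distrib)

context prob_space
begin

lemma L4_const: "L4 M (\<lambda>_. c)"
  by (simp add: L4_def)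

lemma L4_sum: "(\<And>i. i \<in> A \<Longrightarrow> L4 M (f i)) \<Longrightarrow> L4 M (\<lambda>x. \<Sum>i\<in>A. f i x)"
  by (induction A rule: infinite_finite_induct) (auto intro: L4_add L4_const)

lemma L4_integrable:
  assumes "L4 M f" "L4 M g" "L4 M h"
  shows "integrable M f" "integrable M (\<lambda>x. f x * g x)" "integrable M (\<lambda>x. f x * g x * h x)"
    "integrable M (\<lambda>x. (f x)\<^sup>2)"
  using L4_integrable_mult4[OF assms(1) L4_const[of 1] L4_const[of 1] L4_const[of 1]]
    L4_integrable_mult4[OF assms(1,2) L4_const[of 1] L4_const[of 1]]
    L4_integrable_mult4[OF assms(1,1) L4_const[of 1] L4_const[of 1]]
    L4_integrable_mult4[OF assms L4_const[of 1]]
  by (simp_all add: power2_eq_square)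

lemma integrable_mult_iexp:
  assumes "integrable M f" "g \<in> borel_measurable M"
  shows "integrable M (\<lambda>\<omega>. complex_of_real (f \<omega>) * iexp (g \<omega>))"
    and "norm (\<integral>\<omega>. complex_of_real (f \<omega>) * iexp (g \<omega>) \<partial>M) \<le> (\<integral>\<omega>. \<bar>f \<omega>\<bar> \<partial>M)"
proof -
  have [measurable]: "f \<in> borel_measurable M" "g \<in> borel_measurable M" using assms by auto
  show i: "integrable M (\<lambda>\<omega>. complex_of_real (f \<omega>) * iexp (g \<omega>))"
    by (rule Bochner_Integration.integrable_bound[OF assms(1)]) (auto simp: norm_mult)
  show "norm (\<integral>\<omega>. complex_of_real (f \<omega>) * iexp (g \<omega>) \<partial>M) \<le> (\<integral>\<omega>. \<bar>f \<omega>\<bar> \<partial>M)"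
    by (rule order_trans[OF integral_norm_bound]) (simp add: norm_mult)
qed

lemma iexp_approx_1: "cmod (iexp x - 1 - \<i> * x) \<le> x\<^sup>2 / 2"
  using iexp_approx1[of x 1] by (simp add: numeral_2_eq_2 algebra_simps power2_eq_square)

text \<open>Differentiation under the integral with an explicit remainder: the second-order error of
  the exponential is at most \<open>(u - t)\<^sup>2 / 2 * (S \<omega>)\<^sup>2\<close>, whose
  expectation is finite.\<close>

lemma char_has_derivative:
  assumes "L4 M S"
  shows "((\<lambda>t. \<integral>\<omega>. iexp (t * S \<omega>) \<partial>M) has_vector_derivative
    (\<i> * (\<integral>\<omega>. S \<omega> * iexp (t * S \<omega>) \<partial>M))) (at t)"
proof -
  have [measurable]: "S \<in> borel_measurable M" using assms by (rule L4_measurable)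
  note iS = L4_integrable[OF assms assms assms]
  let ?f = "\<lambda>t. \<integral>\<omega>. iexp (t * S \<omega>) \<partial>M" and ?d = "\<i> * (\<integral>\<omega>. S \<omega> * iexp (t * S \<omega>) \<partial>M)"
  have bound: "norm (?f u - ?f t - (u - t) *\<^sub>R ?d) \<le> (u - t)\<^sup>2 / 2 * (\<integral>\<omega>. (S \<omega>)\<^sup>2 \<partial>M)" for u
  proof -
    have i1: "integrable M (\<lambda>\<omega>. iexp (s * S \<omega>))" for s by (intro integrable_iexp) auto
    have i2: "integrable M (\<lambda>\<omega>. S \<omega> * iexp (t * S \<omega>))"
      by (rule integrable_mult_iexp) (use iS in auto)
    let ?g = "\<lambda>\<omega>. iexp (u * S \<omega>) - iexp (t * S \<omega>) - (complex_of_real (u - t) * \<i>) * (S \<omega> * iexp (t * S \<omega>))"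
    have eq: "?f u - ?f t - (u - t) *\<^sub>R ?d = (\<integral>\<omega>. ?g \<omega> \<partial>M)"
      using i1 i2 by (simp add: scaleR_conv_of_real)
    have g: "norm (?g \<omega>) \<le> (u - t)\<^sup>2 / 2 * (S \<omega>)\<^sup>2" for \<omega>
    proof -
      have "u * S \<omega> = t * S \<omega> + (u - t) * S \<omega>" by (simp add: algebra_simps)
      then have h: "iexp (u * S \<omega>) = iexp (t * S \<omega>) * iexp ((u - t) * S \<omega>)"
        by (simp only: of_real_add distrib_left exp_add)
      have alg: "e1 * e2 - e1 - (w * \<i>) * (s * e1) = e1 * (e2 - 1 - \<i> * (w * s))" for e1 e2 w s :: complex
        by (simp add: algebra_simps)
      have "?g \<omega> = iexp (t * S \<omega>) * (iexp ((u - t) * S \<omega>) - 1 - \<i> * complex_of_real ((u - t) * S \<omega>))"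
        unfolding h using alg[of "iexp (t * S \<omega>)" "iexp ((u - t) * S \<omega>)" "complex_of_real (u - t)" "S \<omega>"]
        by (simp only: of_real_mult)
      then have "norm (?g \<omega>) = norm (iexp ((u - t) * S \<omega>) - 1 - \<i> * complex_of_real ((u - t) * S \<omega>))"
        by (simp only: norm_mult norm_exp_i_times mult_1)
      also have "\<dots> \<le> ((u - t) * S \<omega>)\<^sup>2 / 2" by (rule iexp_approx_1)
      finally show ?thesis by (simp add: power_mult_distrib)
    qed
    have "norm (\<integral>\<omega>. ?g \<omega> \<partial>M) \<le> (\<integral>\<omega>. norm (?g \<omega>) \<partial>M)"
      by (rule integral_norm_bound)
    also have "\<dots> \<le> (\<integral>\<omega>. (u - t)\<^sup>2 / 2 * (S \<omega>)\<^sup>2 \<partial>M)"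
      using i1 i2 iS
      by (intro integral_mono g integrable_norm Bochner_Integration.integrable_diff integrable_mult_right)
    finally show ?thesis unfolding eq by simp
  qed
  show ?thesis unfolding has_vector_derivative_def
  proof (rule has_derivativeI_sandwich[of 1])
    show "bounded_linear (\<lambda>x. x *\<^sub>R ?d)" by (rule bounded_linear_scaleR_left)
    fix u assume "u \<noteq> t"
    then show "norm (?f u - ?f t - (u - t) *\<^sub>R ?d) / norm (u - t) \<le> \<bar>u - t\<bar> / 2 * (\<integral>\<omega>. (S \<omega>)\<^sup>2 \<partial>M)"
      using bound[of u] by (simp add: divide_le_eq power2_eq_square mult_ac flip: abs_mult)
  next
    have "((\<lambda>u. \<bar>u - t\<bar> / 2 * (\<integral>\<omega>. (S \<omega>)\<^sup>2 \<partial>M)) \<longlongrightarrow> \<bar>t - t\<bar> / 2 * (\<integral>\<omega>. (S \<omega>)\<^sup>2 \<partial>M)) (at t)"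
      by (intro tendsto_intros) auto
    then show "((\<lambda>u. \<bar>u - t\<bar> / 2 * (\<integral>\<omega>. (S \<omega>)\<^sup>2 \<partial>M)) \<longlongrightarrow> 0) (at t)" by simp
  qed simp
qed

lemma abs_expectation_le_sqrt:
  assumes "integrable M f" "integrable M (\<lambda>x. (f x)\<^sup>2)"
  shows "(\<integral>\<omega>. \<bar>f \<omega>\<bar> \<partial>M) \<le> sqrt (\<integral>\<omega>. (f \<omega>)\<^sup>2 \<partial>M)"
proof -
  have "(\<integral>\<omega>. \<bar>f \<omega>\<bar> \<partial>M)\<^sup>2 \<le> (\<integral>\<omega>. \<bar>f \<omega>\<bar>\<^sup>2 \<partial>M)"
  proof -
    have "0 \<le> variance (\<lambda>\<omega>. \<bar>f \<omega>\<bar>)" by (rule variance_positive)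
    also have "\<dots> = (\<integral>\<omega>. \<bar>f \<omega>\<bar>\<^sup>2 \<partial>M) - (\<integral>\<omega>. \<bar>f \<omega>\<bar> \<partial>M)\<^sup>2"
      using assms by (intro variance_eq) auto
    finally show ?thesis by simp
  qed
  then show ?thesis by (intro real_le_rsqrt) simp
qed

text \<open>With \<open>D\<^sub>i\<close> the sum of the \<open>W\<^sub>j\<close> dependent on \<open>W\<^sub>i\<close>, independence gives
  \<open>E[W\<^sub>i exp(itS)] = E[W\<^sub>i exp(itS) (1 - exp(-itD\<^sub>i))]\<close>, and the bracket is \<open>itD\<^sub>i + O(t\<^sup>2D\<^sub>i\<^sup>2)\<close>.\<close>

lemma dissociated_stein_bound:
  fixes t v :: real and W :: "'i \<Rightarrow> 'a \<Rightarrow> real" and R :: "'i \<Rightarrow> 'i \<Rightarrow> bool"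
  assumes I: "finite I" and W: "\<And>i. i \<in> I \<Longrightarrow> L4 M (W i)"
    and ind: "\<And>i. i \<in> I \<Longrightarrow> (\<integral>\<omega>. W i \<omega> * iexp (t * (\<Sum>j\<in>{j\<in>I. \<not> R i j}. W j \<omega>)) \<partial>M) = 0"
    and unc: "\<And>i j. i \<in> I \<Longrightarrow> j \<in> I \<Longrightarrow> \<not> R i j \<Longrightarrow> (\<integral>\<omega>. W i \<omega> * W j \<omega> \<partial>M) = 0"
  defines "S \<equiv> \<lambda>\<omega>. \<Sum>i\<in>I. W i \<omega>"
    and "e3 \<equiv> \<Sum>i\<in>I. \<Sum>j\<in>{j\<in>I. R i j}. \<Sum>k\<in>{k\<in>I. R i k}. (\<integral>\<omega>. \<bar>W i \<omega> * W j \<omega> * W k \<omega>\<bar> \<partial>M)"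
    and "e4 \<equiv> \<Sum>i\<in>I. \<Sum>j\<in>{j\<in>I. R i j}. \<Sum>k\<in>I. \<Sum>l\<in>{l\<in>I. R k l}.
        \<bar>(\<integral>\<omega>. W i \<omega> * W j \<omega> * W k \<omega> * W l \<omega> \<partial>M) - (\<integral>\<omega>. W i \<omega> * W j \<omega> \<partial>M) * (\<integral>\<omega>. W k \<omega> * W l \<omega> \<partial>M)\<bar>"
  shows "norm (\<i> * (\<integral>\<omega>. S \<omega> * iexp (t * S \<omega>) \<partial>M) + t * v * (\<integral>\<omega>. iexp (t * S \<omega>) \<partial>M))
    \<le> t\<^sup>2 / 2 * e3 + \<bar>t\<bar> * (sqrt e4 + \<bar>(\<integral>\<omega>. (S \<omega>)\<^sup>2 \<partial>M) - v\<bar>)"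
proof -
  define J where "J i = {j\<in>I. R i j}" for i
  define D where "D i \<omega> = (\<Sum>j\<in>J i. W j \<omega>)" for i \<omega>
  define S' where "S' i \<omega> = (\<Sum>j\<in>{j\<in>I. \<not> R i j}. W j \<omega>)" for i \<omega>
  \<comment> \<open>The sum over dependent pairs. Its mean is \<open>E S^2\<close>, because the
    remaining pairs are uncorrelated. Replacing \<open>Q\<close> by a constant is what closes the
    equation for the characteristic function.\<close>
  define Q where "Q \<omega> = (\<Sum>i\<in>I. W i \<omega> * D i \<omega>)" for \<omega>
  have JI: "J i \<subseteq> I" "finite (J i)" for i using I by (auto simp: J_def)
  have LS: "L4 M S" unfolding S_def by (intro L4_sum W)
  have LD: "L4 M (D i)" for i unfolding D_def[abs_def] using JI by (intro L4_sum W) auto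
  have LS': "L4 M (S' i)" for i unfolding S'_def[abs_def] by (intro L4_sum W) auto
  note [measurable] = L4_measurable[OF LS] L4_measurable[OF LD] L4_measurable[OF LS']
  have SD: "S \<omega> = S' i \<omega> + D i \<omega>" for i \<omega>
    unfolding S_def S'_def D_def J_def using I
    by (subst sum.union_disjoint[symmetric]) (auto intro!: sum.cong)
  have iW2: "integrable M (\<lambda>\<omega>. W i \<omega> * W j \<omega>)" if "i \<in> I" "j \<in> I" for i j
    using L4_integrable(2)[OF W W W] that by blast
  have iW3: "integrable M (\<lambda>\<omega>. W i \<omega> * W j \<omega> * W k \<omega>)" if "i \<in> I" "j \<in> I" "k \<in> I" for i j k
    using L4_integrable(3)[OF W W W] that by blast
  have iW4: "integrable M (\<lambda>\<omega>. W i \<omega> * W j \<omega> * W k \<omega> * W l \<omega>)" if "i \<in> I" "j \<in> I" "k \<in> I" "l \<in> I" for i j k l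
    using L4_integrable_mult4[OF W W W W] that by blast
  have iWD: "integrable M (\<lambda>\<omega>. W i \<omega> * D i \<omega>)" if "i \<in> I" for i
    using L4_integrable(2)[OF W LD LD] that by blast
  have iWDD: "integrable M (\<lambda>\<omega>. W i \<omega> * D i \<omega> * D i \<omega>)" if "i \<in> I" for i
    using L4_integrable(3)[OF W LD LD] that by blast
  have iQ: "integrable M Q" unfolding Q_def[abs_def] using iWD by auto
  have Qe: "Q = (\<lambda>\<omega>. \<Sum>i\<in>I. \<Sum>j\<in>J i. W i \<omega> * W j \<omega>)"
    by (simp add: Q_def[abs_def] D_def sum_distrib_left)
  have EQ: "(\<integral>\<omega>. Q \<omega> \<partial>M) = (\<Sum>i\<in>I. \<Sum>j\<in>J i. (\<integral>\<omega>. W i \<omega> * W j \<omega> \<partial>M))"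
    unfolding Qe using iW2 JI by (simp add: subset_iff)
  have ES: "(\<integral>\<omega>. (S \<omega>)\<^sup>2 \<partial>M) = (\<integral>\<omega>. Q \<omega> \<partial>M)"
  proof -
    have "(\<integral>\<omega>. (S \<omega>)\<^sup>2 \<partial>M) = (\<Sum>i\<in>I. \<Sum>j\<in>I. (\<integral>\<omega>. W i \<omega> * W j \<omega> \<partial>M))"
      unfolding S_def power2_eq_square sum_product using iW2 by simp
    also have "\<dots> = (\<Sum>i\<in>I. \<Sum>j\<in>J i. (\<integral>\<omega>. W i \<omega> * W j \<omega> \<partial>M))"
      using I unc by (intro sum.cong refl sum.mono_neutral_right) (auto simp: J_def)
    finally show ?thesis by (simp add: EQ)
  qed
  have QQ: "(\<lambda>\<omega>. Q \<omega> * Q \<omega>) = (\<lambda>\<omega>. \<Sum>i\<in>I. \<Sum>j\<in>J i. \<Sum>k\<in>I. \<Sum>l\<in>J k. W i \<omega> * W j \<omega> * W k \<omega> * W l \<omega>)"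
    unfolding Qe sum_distrib_right unfolding sum_distrib_left by (simp only: mult.assoc)
  have iQQ: "integrable M (\<lambda>\<omega>. (Q \<omega>)\<^sup>2)"
    unfolding power2_eq_square QQ using iW4 JI
    by (intro Bochner_Integration.integrable_sum) (auto simp: subset_iff)
  have VQ: "(\<integral>\<omega>. (Q \<omega> - (\<integral>x. Q x \<partial>M))\<^sup>2 \<partial>M) \<le> e4"
  proof -
    have "(\<integral>\<omega>. (Q \<omega> - (\<integral>x. Q x \<partial>M))\<^sup>2 \<partial>M) = (\<integral>\<omega>. Q \<omega> * Q \<omega> \<partial>M) - (\<integral>\<omega>. Q \<omega> \<partial>M) * (\<integral>\<omega>. Q \<omega> \<partial>M)"
      using variance_eq[OF iQ iQQ] by (simp add: power2_eq_square)
    also have "(\<integral>\<omega>. Q \<omega> * Q \<omega> \<partial>M) = (\<Sum>i\<in>I. \<Sum>j\<in>J i. \<Sum>k\<in>I. \<Sum>l\<in>J k. (\<integral>\<omega>. W i \<omega> * W j \<omega> * W k \<omega> * W l \<omega> \<partial>M))"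
      unfolding QQ using iW4 JI by (simp add: subset_iff)
    also have "(\<integral>\<omega>. Q \<omega> \<partial>M) * (\<integral>\<omega>. Q \<omega> \<partial>M) = (\<Sum>i\<in>I. \<Sum>j\<in>J i. \<Sum>k\<in>I. \<Sum>l\<in>J k. (\<integral>\<omega>. W i \<omega> * W j \<omega> \<partial>M) * (\<integral>\<omega>. W k \<omega> * W l \<omega> \<partial>M))"
      unfolding EQ sum_distrib_right unfolding sum_distrib_left ..
    finally have "(\<integral>\<omega>. (Q \<omega> - (\<integral>x. Q x \<partial>M))\<^sup>2 \<partial>M) = (\<Sum>i\<in>I. \<Sum>j\<in>J i. \<Sum>k\<in>I. \<Sum>l\<in>J k.
        (\<integral>\<omega>. W i \<omega> * W j \<omega> * W k \<omega> * W l \<omega> \<partial>M) - (\<integral>\<omega>. W i \<omega> * W j \<omega> \<partial>M) * (\<integral>\<omega>. W k \<omega> * W l \<omega> \<partial>M))"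
      by (simp add: sum_subtractf)
    also have "\<dots> \<le> e4" unfolding e4_def J_def[symmetric]
      by (intro sum_mono abs_ge_self)
    finally show ?thesis .
  qed
  have step1: "norm ((\<integral>\<omega>. W i \<omega> * iexp (t * S \<omega>) \<partial>M) - \<i> * t * (\<integral>\<omega>. (W i \<omega> * D i \<omega>) * iexp (t * S \<omega>) \<partial>M))
      \<le> t\<^sup>2 / 2 * (\<Sum>j\<in>J i. \<Sum>k\<in>J i. (\<integral>\<omega>. \<bar>W i \<omega> * W j \<omega> * W k \<omega>\<bar> \<partial>M))" if i: "i \<in> I" for i
  proof -
    note [measurable] = L4_measurable[OF W[OF i]]
    have iW: "integrable M (W i)" using L4_integrable(1)[OF W W W] i by blast
    have i1: "integrable M (\<lambda>\<omega>. W i \<omega> * iexp (t * S \<omega>))" "integrable M (\<lambda>\<omega>. W i \<omega> * iexp (t * S' i \<omega>))"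
      by (intro integrable_mult_iexp iW; measurable)+
    have i2: "integrable M (\<lambda>\<omega>. complex_of_real (W i \<omega> * D i \<omega>) * iexp (t * S \<omega>))"
      by (intro integrable_mult_iexp iWD i) measurable
    let ?g = "\<lambda>\<omega>. W i \<omega> * iexp (t * S \<omega>) - W i \<omega> * iexp (t * S' i \<omega>) - \<i> * t * (complex_of_real (W i \<omega> * D i \<omega>) * iexp (t * S \<omega>))"
    have ig: "integrable M ?g" using i1 i2 by (intro Bochner_Integration.integrable_diff integrable_mult_right)
    have "(\<integral>\<omega>. W i \<omega> * iexp (t * S \<omega>) \<partial>M) - \<i> * t * (\<integral>\<omega>. complex_of_real (W i \<omega> * D i \<omega>) * iexp (t * S \<omega>) \<partial>M)
      = (\<integral>\<omega>. W i \<omega> * iexp (t * S \<omega>) \<partial>M) - (\<integral>\<omega>. W i \<omega> * iexp (t * S' i \<omega>) \<partial>M) - (\<integral>\<omega>. \<i> * t * (complex_of_real (W i \<omega> * D i \<omega>) * iexp (t * S \<omega>)) \<partial>M)"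
      using ind[OF i] unfolding S'_def by simp
    also have "\<dots> = (\<integral>\<omega>. ?g \<omega> \<partial>M)"
      using i1 i2 by (simp del: of_real_mult)
    finally have eq: "norm ((\<integral>\<omega>. W i \<omega> * iexp (t * S \<omega>) \<partial>M) - \<i> * t * (\<integral>\<omega>. complex_of_real (W i \<omega> * D i \<omega>) * iexp (t * S \<omega>) \<partial>M))
      = norm (\<integral>\<omega>. ?g \<omega> \<partial>M)" by (rule arg_cong)
    have "norm (\<integral>\<omega>. ?g \<omega> \<partial>M) \<le> (\<integral>\<omega>. norm (?g \<omega>) \<partial>M)" by (rule integral_norm_bound)
    also have "\<dots> \<le> (\<integral>\<omega>. t\<^sup>2 / 2 * (\<Sum>j\<in>J i. \<Sum>k\<in>J i. \<bar>W i \<omega> * W j \<omega> * W k \<omega>\<bar>) \<partial>M)"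
    proof (rule integral_mono)
      show "integrable M (\<lambda>\<omega>. norm (?g \<omega>))" using ig by (rule integrable_norm)
      show "integrable M (\<lambda>\<omega>. t\<^sup>2 / 2 * (\<Sum>j\<in>J i. \<Sum>k\<in>J i. \<bar>W i \<omega> * W j \<omega> * W k \<omega>\<bar>))"
        by (intro integrable_mult_right Bochner_Integration.integrable_sum integrable_abs iW3 i)
           (auto simp: J_def)
      fix \<omega>
      have "t * S' i \<omega> = t * S \<omega> + - t * D i \<omega>"
        by (simp add: SD[of \<omega> i] algebra_simps)
      then have h: "iexp (t * S' i \<omega>) = iexp (t * S \<omega>) * iexp (- t * D i \<omega>)"
        by (simp only: of_real_add distrib_left exp_add)
      have alg: "w * e1 - w * (e1 * e2) - \<i> * u * ((w * D) * e1) = - (w * (e1 * (e2 - 1 - \<i> * (- u * D))))"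
        for w e1 e2 D u :: complex by (simp add: algebra_simps)
      have "?g \<omega> = - (W i \<omega> * (iexp (t * S \<omega>) * (iexp (- t * D i \<omega>) - 1 - \<i> * complex_of_real (- t * D i \<omega>))))"
        unfolding h using alg[of "W i \<omega>" "iexp (t * S \<omega>)" "iexp (- t * D i \<omega>)" t "D i \<omega>"]
        by (simp only: of_real_mult of_real_minus)
      then have "norm (?g \<omega>) = \<bar>W i \<omega>\<bar> * norm (iexp (- t * D i \<omega>) - 1 - \<i> * complex_of_real (- t * D i \<omega>))"
        by (simp only: norm_minus_cancel norm_mult norm_exp_i_times norm_of_real mult_1)
      also have "\<dots> \<le> \<bar>W i \<omega>\<bar> * ((- t * D i \<omega>)\<^sup>2 / 2)"
        by (intro mult_left_mono iexp_approx_1) simp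
      also have "\<dots> = t\<^sup>2 / 2 * \<bar>W i \<omega> * D i \<omega> * D i \<omega>\<bar>"
        by (simp add: abs_mult power2_eq_square)
      also have "\<bar>W i \<omega> * D i \<omega> * D i \<omega>\<bar> = \<bar>\<Sum>j\<in>J i. \<Sum>k\<in>J i. W i \<omega> * W j \<omega> * W k \<omega>\<bar>"
        unfolding D_def sum_distrib_left unfolding sum_distrib_right
        by (subst sum.swap) simp
      also have "\<dots> \<le> (\<Sum>j\<in>J i. \<Sum>k\<in>J i. \<bar>W i \<omega> * W j \<omega> * W k \<omega>\<bar>)"
        by (rule order_trans[OF sum_abs]) (intro sum_mono sum_abs)
      finally show "norm (?g \<omega>) \<le> t\<^sup>2 / 2 * (\<Sum>j\<in>J i. \<Sum>k\<in>J i. \<bar>W i \<omega> * W j \<omega> * W k \<omega>\<bar>)"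
        by (simp add: mult_left_mono)
    qed
    also have "\<dots> = t\<^sup>2 / 2 * (\<Sum>j\<in>J i. \<Sum>k\<in>J i. (\<integral>\<omega>. \<bar>W i \<omega> * W j \<omega> * W k \<omega>\<bar> \<partial>M))"
      using JI iW3 i by (simp add: subset_iff)
    finally show ?thesis unfolding eq .
  qed
  let ?\<phi> = "\<integral>\<omega>. iexp (t * S \<omega>) \<partial>M"
  let ?A = "\<integral>\<omega>. S \<omega> * iexp (t * S \<omega>) \<partial>M" and ?B = "\<integral>\<omega>. Q \<omega> * iexp (t * S \<omega>) \<partial>M"
  have A: "norm (?A - \<i> * t * ?B) \<le> t\<^sup>2 / 2 * e3"
  proof -
    have 1: "?A = (\<Sum>i\<in>I. \<integral>\<omega>. W i \<omega> * iexp (t * S \<omega>) \<partial>M)"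
    proof -
      have "?A = (\<integral>\<omega>. (\<Sum>i\<in>I. W i \<omega> * iexp (t * S \<omega>)) \<partial>M)"
        by (rule Bochner_Integration.integral_cong) (simp_all add: S_def sum_distrib_right)
      also have "\<dots> = (\<Sum>i\<in>I. \<integral>\<omega>. W i \<omega> * iexp (t * S \<omega>) \<partial>M)"
        using L4_integrable(1)[OF W W W] by (intro Bochner_Integration.integral_sum integrable_mult_iexp) auto
      finally show ?thesis .
    qed
    have 2: "?B = (\<Sum>i\<in>I. \<integral>\<omega>. (W i \<omega> * D i \<omega>) * iexp (t * S \<omega>) \<partial>M)"
    proof -
      have "?B = (\<integral>\<omega>. (\<Sum>i\<in>I. complex_of_real (W i \<omega> * D i \<omega>) * iexp (t * S \<omega>)) \<partial>M)"
        by (rule Bochner_Integration.integral_cong) (simp_all add: Q_def sum_distrib_right)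
      also have "\<dots> = (\<Sum>i\<in>I. \<integral>\<omega>. complex_of_real (W i \<omega> * D i \<omega>) * iexp (t * S \<omega>) \<partial>M)"
        using iWD by (intro Bochner_Integration.integral_sum integrable_mult_iexp) auto
      finally show ?thesis .
    qed
    have "?A - \<i> * t * ?B = (\<Sum>i\<in>I. (\<integral>\<omega>. W i \<omega> * iexp (t * S \<omega>) \<partial>M) - \<i> * t * (\<integral>\<omega>. (W i \<omega> * D i \<omega>) * iexp (t * S \<omega>) \<partial>M))"
      unfolding 1 2 by (simp add: sum_subtractf sum_distrib_left)
    also have "norm \<dots> \<le> (\<Sum>i\<in>I. t\<^sup>2 / 2 * (\<Sum>j\<in>J i. \<Sum>k\<in>J i. (\<integral>\<omega>. \<bar>W i \<omega> * W j \<omega> * W k \<omega>\<bar> \<partial>M)))"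
      by (rule order_trans[OF norm_sum]) (intro sum_mono step1)
    also have "\<dots> = t\<^sup>2 / 2 * e3" unfolding e3_def J_def[symmetric] by (simp add: sum_distrib_left)
    finally show ?thesis .
  qed
  \<comment> \<open>\<open>Q\<close> is replaced by its mean at the cost of its standard deviation,
    and the mean by \<open>v\<close>.\<close>
  have B: "norm (?B - v * ?\<phi>) \<le> sqrt e4 + \<bar>(\<integral>\<omega>. (S \<omega>)\<^sup>2 \<partial>M) - v\<bar>"
  proof -
    let ?m = "\<integral>x. Q x \<partial>M"
    have i1: "integrable M (\<lambda>\<omega>. Q \<omega> * iexp (t * S \<omega>))" by (intro integrable_mult_iexp iQ) measurable
    have i2: "integrable M (\<lambda>\<omega>. iexp (t * S \<omega>))" by (intro integrable_iexp) measurable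
    have iQm: "integrable M (\<lambda>\<omega>. Q \<omega> - ?m)" using iQ by simp
    have iQm2: "integrable M (\<lambda>\<omega>. (Q \<omega> - ?m)\<^sup>2)"
      using iQ iQQ by (simp add: power2_diff)
    have "?B - ?m * ?\<phi> = (\<integral>\<omega>. complex_of_real (Q \<omega> - ?m) * iexp (t * S \<omega>) \<partial>M)"
      using i1 i2 by (simp add: left_diff_distrib)
    also have "norm \<dots> \<le> (\<integral>\<omega>. \<bar>Q \<omega> - ?m\<bar> \<partial>M)"
      by (intro integrable_mult_iexp iQm) measurable
    also have "\<dots> \<le> sqrt (\<integral>\<omega>. (Q \<omega> - ?m)\<^sup>2 \<partial>M)" by (rule abs_expectation_le_sqrt[OF iQm iQm2])
    also have "\<dots> \<le> sqrt e4" using VQ by simp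
    finally have 1: "norm (?B - ?m * ?\<phi>) \<le> sqrt e4" .
    have "norm ?\<phi> \<le> 1"
      by (rule order_trans[OF integral_norm_bound]) (simp add: prob_space)
    then have 2: "norm ((?m - v) * ?\<phi>) \<le> \<bar>?m - v\<bar>"
      by (simp add: norm_mult mult_left_le flip: of_real_diff)
    have eq: "?B - v * ?\<phi> = (?B - ?m * ?\<phi>) + (?m - v) * ?\<phi>"
    proof -
      have "B - u * f = (B - m * f) + (m - u) * f" for B u f m :: complex by (simp add: algebra_simps)
      then show ?thesis unfolding of_real_diff .
    qed
    show ?thesis unfolding eq ES by (rule norm_triangle_mono[OF 1 2])
  qed
  have eq: "\<i> * ?A + t * v * ?\<phi> = \<i> * (?A - \<i> * t * ?B) - t * (?B - v * ?\<phi>)"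
  proof -
    have "\<i> * A + s * u * f = \<i> * (A - \<i> * s * B) - s * (B - u * f)" for A B s u f :: complex
      by (simp add: algebra_simps)
    then show ?thesis unfolding of_real_mult .
  qed
  have "norm (\<i> * (?A - \<i> * t * ?B) - t * (?B - v * ?\<phi>))
    \<le> norm (?A - \<i> * t * ?B) + \<bar>t\<bar> * norm (?B - v * ?\<phi>)"
    by (rule order_trans[OF norm_triangle_ineq4]) (simp only: norm_mult norm_ii norm_of_real mult_1 order_refl)
  also have "\<dots> \<le> t\<^sup>2 / 2 * e3 + \<bar>t\<bar> * (sqrt e4 + \<bar>(\<integral>\<omega>. (S \<omega>)\<^sup>2 \<partial>M) - v\<bar>)"
    by (intro add_mono A mult_left_mono B abs_ge_zero)
  finally show ?thesis unfolding eq .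
qed

text \<open>The integrating factor \<open>exp (v * t\<^sup>2 / 2)\<close> turns the approximate
  equation \<phi>' = - t v \<phi> into a bound on the derivative of the product, and the mean value
  inequality on the unit interval does the rest. The sign of \<open>v\<close> is left open, hence
  \<open>\<bar>v\<bar>\<close>.\<close>

lemma char_ode_bound:
  fixes v d :: real
  assumes S: "L4 M S"
    and b: "\<And>t::real. 0 \<le> t \<Longrightarrow> t \<le> 1 \<Longrightarrow>
      norm (\<i> * (\<integral>\<omega>. S \<omega> * iexp (t * S \<omega>) \<partial>M) + t * v * (\<integral>\<omega>. iexp (t * S \<omega>) \<partial>M)) \<le> d"
  shows "norm ((\<integral>\<omega>. iexp (S \<omega>) \<partial>M) * exp (v / 2) - 1) \<le> d * exp (\<bar>v\<bar> / 2)"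
proof -
  let ?f = "\<lambda>t. \<integral>\<omega>. iexp (t * S \<omega>) \<partial>M"
  let ?d = "\<lambda>t. \<i> * (\<integral>\<omega>. S \<omega> * iexp (t * S \<omega>) \<partial>M)"
  let ?E = "\<lambda>t. complex_of_real (exp (v * t\<^sup>2 / 2))"
  have E: "(?E has_vector_derivative complex_of_real (v * t * exp (v * t\<^sup>2 / 2))) (at t)" for t
    by (rule has_vector_derivative_of_real)
       (auto intro!: derivative_eq_intros simp flip: has_real_derivative_iff_has_vector_derivative)
  have der: "((\<lambda>t. ?f t * ?E t) has_vector_derivative (?d t + t * v * ?f t) * ?E t) (at t)" for t
    using has_vector_derivative_mult[OF char_has_derivative[OF S] E, of t]
    by (simp add: algebra_simps)
  have "continuous_on {0..1} (\<lambda>t. ?f t * ?E t)"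
    using der by (intro continuous_at_imp_continuous_on ballI has_vector_derivative_continuous)
  then obtain x :: real where x: "0 < x" "x < 1"
    "norm (?f 1 * ?E 1 - ?f 0 * ?E 0) \<le> norm ((1 - 0) *\<^sub>R ((?d x + x * v * ?f x) * ?E x))"
    using mvt_general[of 0 1 "\<lambda>t. ?f t * ?E t" "\<lambda>t h. h *\<^sub>R ((?d t + t * v * ?f t) * ?E t)"] der
    by (auto simp: has_vector_derivative_def)
  have "norm (?f 1 * ?E 1 - ?f 0 * ?E 0) \<le> norm (?d x + x * v * ?f x) * exp (v * x\<^sup>2 / 2)"
    using x(3) by (simp add: norm_mult)
  also have "\<dots> \<le> d * exp (\<bar>v\<bar> / 2)"
  proof (intro mult_mono b)
    have "v * x\<^sup>2 \<le> \<bar>v\<bar> * 1"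
      using x by (intro mult_mono) (auto simp: power_le_one)
    then show "exp (v * x\<^sup>2 / 2) \<le> exp (\<bar>v\<bar> / 2)" by simp
    show "0 \<le> d" by (rule order_trans[OF norm_ge_zero b[of 0]]) auto
  qed (use x in auto)
  finally show ?thesis by (simp add: prob_space)
qed

end

text \<open>The characteristic function is followed at the argument 1 only; the argument of interest
  is absorbed into the coefficients of \<open>W\<close>. Index set, dependency relation and
  probability space vary with \<open>N\<close>, as labellings by \<open>{1..N}\<close>
  demand.\<close>

theorem dissociated_clt:
  fixes M :: "nat \<Rightarrow> 'a measure" and W :: "nat \<Rightarrow> 'i \<Rightarrow> 'a \<Rightarrow> real" and R :: "nat \<Rightarrow> 'i \<Rightarrow> 'i \<Rightarrow> bool"
  assumes M: "\<And>N. N \<ge> 1 \<Longrightarrow> prob_space (M N)" and I: "\<And>N. finite (I N)"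
    and W: "\<And>N i. N \<ge> 1 \<Longrightarrow> i \<in> I N \<Longrightarrow> L4 (M N) (W N i)"
    and ind: "\<And>N t i. N \<ge> 1 \<Longrightarrow> i \<in> I N \<Longrightarrow>
      (\<integral>\<omega>. W N i \<omega> * iexp (t * (\<Sum>j\<in>{j\<in>I N. \<not> R N i j}. W N j \<omega>)) \<partial>M N) = 0"
    and unc: "\<And>N i j. N \<ge> 1 \<Longrightarrow> i \<in> I N \<Longrightarrow> j \<in> I N \<Longrightarrow> \<not> R N i j \<Longrightarrow> (\<integral>\<omega>. W N i \<omega> * W N j \<omega> \<partial>M N) = 0"
    and three: "(\<lambda>N. \<Sum>i\<in>I N. \<Sum>j\<in>{j\<in>I N. R N i j}. \<Sum>k\<in>{k\<in>I N. R N i k}.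
      (\<integral>\<omega>. \<bar>W N i \<omega> * W N j \<omega> * W N k \<omega>\<bar> \<partial>M N)) \<longlonglongrightarrow> 0"
    and four: "(\<lambda>N. \<Sum>i\<in>I N. \<Sum>j\<in>{j\<in>I N. R N i j}. \<Sum>k\<in>I N. \<Sum>l\<in>{l\<in>I N. R N k l}.
        \<bar>(\<integral>\<omega>. W N i \<omega> * W N j \<omega> * W N k \<omega> * W N l \<omega> \<partial>M N)
         - (\<integral>\<omega>. W N i \<omega> * W N j \<omega> \<partial>M N) * (\<integral>\<omega>. W N k \<omega> * W N l \<omega> \<partial>M N)\<bar>) \<longlonglongrightarrow> 0"
    and var: "(\<lambda>N. \<integral>\<omega>. (\<Sum>i\<in>I N. W N i \<omega>)\<^sup>2 \<partial>M N) \<longlonglongrightarrow> v"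
  shows "(\<lambda>N. \<integral>\<omega>. iexp (\<Sum>i\<in>I N. W N i \<omega>) \<partial>M N) \<longlonglongrightarrow> complex_of_real (exp (- v / 2))"
proof -
  let ?S = "\<lambda>N \<omega>. \<Sum>i\<in>I N. W N i \<omega>"
  define e3 where "e3 N = (\<Sum>i\<in>I N. \<Sum>j\<in>{j\<in>I N. R N i j}. \<Sum>k\<in>{k\<in>I N. R N i k}.
      (\<integral>\<omega>. \<bar>W N i \<omega> * W N j \<omega> * W N k \<omega>\<bar> \<partial>M N))" for N
  define e4 where "e4 N = (\<Sum>i\<in>I N. \<Sum>j\<in>{j\<in>I N. R N i j}. \<Sum>k\<in>I N. \<Sum>l\<in>{l\<in>I N. R N k l}.
        \<bar>(\<integral>\<omega>. W N i \<omega> * W N j \<omega> * W N k \<omega> * W N l \<omega> \<partial>M N)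
         - (\<integral>\<omega>. W N i \<omega> * W N j \<omega> \<partial>M N) * (\<integral>\<omega>. W N k \<omega> * W N l \<omega> \<partial>M N)\<bar>)" for N
  \<comment> \<open>A bound on the Stein error for all \<open>t\<close> between 0 and 1 at
    once.\<close>
  define d where "d N = e3 N + (sqrt (e4 N) + \<bar>(\<integral>\<omega>. (?S N \<omega>)\<^sup>2 \<partial>M N) - v\<bar>)" for N
  have bound: "norm ((\<integral>\<omega>. iexp (?S N \<omega>) \<partial>M N) * exp (v / 2) - 1) \<le> d N * exp (\<bar>v\<bar> / 2)" if N: "N \<ge> 1" for N
  proof -
    interpret prob_space "M N" by (rule M[OF N])
    show ?thesis
    proof (rule char_ode_bound)
      show "L4 (M N) (?S N)" by (intro L4_sum W N)
      fix t :: real assume t: "0 \<le> t" "t \<le> 1"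
      have "norm (\<i> * (\<integral>\<omega>. ?S N \<omega> * iexp (t * ?S N \<omega>) \<partial>M N) + t * v * (\<integral>\<omega>. iexp (t * ?S N \<omega>) \<partial>M N))
        \<le> t\<^sup>2 / 2 * e3 N + \<bar>t\<bar> * (sqrt (e4 N) + \<bar>(\<integral>\<omega>. (?S N \<omega>)\<^sup>2 \<partial>M N) - v\<bar>)"
        unfolding e3_def e4_def
        by (rule dissociated_stein_bound[of "I N" "W N" t "R N" v, OF I W[OF N] ind[OF N] unc[OF N]])
      also have "\<dots> \<le> 1 * e3 N + 1 * (sqrt (e4 N) + \<bar>(\<integral>\<omega>. (?S N \<omega>)\<^sup>2 \<partial>M N) - v\<bar>)"
      proof (intro add_mono mult_right_mono)
        have "t\<^sup>2 \<le> 1" using t by (simp add: power_le_one)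
        then show "t\<^sup>2 / 2 \<le> 1" by simp
        show "0 \<le> e3 N" unfolding e3_def by (intro sum_nonneg) simp
        have "0 \<le> e4 N" unfolding e4_def by (intro sum_nonneg) simp
        then show "0 \<le> sqrt (e4 N) + \<bar>(\<integral>\<omega>. (?S N \<omega>)\<^sup>2 \<partial>M N) - v\<bar>" by simp
      qed (use t in auto)
      finally show "norm (\<i> * (\<integral>\<omega>. ?S N \<omega> * iexp (t * ?S N \<omega>) \<partial>M N) + t * v * (\<integral>\<omega>. iexp (t * ?S N \<omega>) \<partial>M N)) \<le> d N"
        by (simp add: d_def)
    qed
  qed
  have "d \<longlonglongrightarrow> 0 + (sqrt 0 + \<bar>v - v\<bar>)"
    unfolding d_def using three four var unfolding e3_def[symmetric] e4_def[symmetric]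
    by (intro tendsto_intros)
  then have "(\<lambda>N. d N * exp (\<bar>v\<bar> / 2)) \<longlonglongrightarrow> 0 * exp (\<bar>v\<bar> / 2)" by (intro tendsto_intros) simp
  then have "(\<lambda>N. d N * exp (\<bar>v\<bar> / 2)) \<longlonglongrightarrow> 0" by (simp only: mult_zero_left)
  then have "(\<lambda>N. (\<integral>\<omega>. iexp (?S N \<omega>) \<partial>M N) * exp (v / 2) - 1) \<longlonglongrightarrow> 0"
  proof (rule Lim_null_comparison[rotated])
    show "\<forall>\<^sub>F N in sequentially. norm ((\<integral>\<omega>. iexp (?S N \<omega>) \<partial>M N) * exp (v / 2) - 1) \<le> d N * exp (\<bar>v\<bar> / 2)"
      using eventually_ge_at_top[of 1] by eventually_elim (rule bound)
  qed
  then have "(\<lambda>N. (\<integral>\<omega>. iexp (?S N \<omega>) \<partial>M N) * exp (v / 2)) \<longlonglongrightarrow> 1"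
    by (rule LIM_zero_cancel)
  then have "(\<lambda>N. (\<integral>\<omega>. iexp (?S N \<omega>) \<partial>M N) * exp (v / 2) * exp (- v / 2)) \<longlonglongrightarrow> 1 * complex_of_real (exp (- v / 2))"
    by (intro tendsto_intros)
  moreover have "(x :: complex) * exp (v / 2) * exp (- v / 2) = x" for x
  proof -
    have "complex_of_real (exp (v / 2)) * complex_of_real (exp (- v / 2)) = 1"
      unfolding of_real_mult[symmetric] mult_exp_exp by simp
    then show ?thesis by (simp only: mult.assoc mult_1_right)
  qed
  ultimately show ?thesis by (simp only: mult_1)
qed


section \<open>Moments of products of matrix entries\<close>

text \<open>The product is at most a power of its largest factor, with the number of factors as
  exponent. Mixed absolute moments are thereby reduced to moments of single entries.\<close>

lemma prod_list_le_sum_list_power: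
  fixes xs :: "real list"
  assumes "xs \<noteq> []" "\<And>x. x \<in> set xs \<Longrightarrow> 0 \<le> x"
  shows "prod_list xs \<le> (\<Sum>x\<leftarrow>xs. x ^ length xs)"
proof -
  define m where "m = Max (set xs)"
  have m: "m \<in> set xs" "\<And>x. x \<in> set xs \<Longrightarrow> x \<le> m"
    using assms(1) by (auto simp: m_def)
  have "prod_list ys \<le> m ^ length ys \<and> 0 \<le> prod_list ys" if "set ys \<subseteq> set xs" for ys
    using that
  proof (induction ys)
    case (Cons y ys)
    then have y: "0 \<le> y" "y \<le> m" using assms(2) m(2) by auto
    with Cons show ?case by (auto intro!: mult_mono)
  qed simp
  then have "prod_list xs \<le> m ^ length xs" by auto
  also have "\<dots> \<le> (\<Sum>x\<leftarrow>xs. x ^ length xs)"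
    using m(1) assms(2) by (intro member_le_sum_list) auto
  finally show ?thesis .
qed

locale exploding_elliptic_matrices_one = exploding_elliptic_matrices M X 1 C
  for M :: "nat \<Rightarrow> 'a measure" and X C
begin

definition entry :: "nat \<Rightarrow> nat \<times> nat \<Rightarrow> 'a \<Rightarrow> real" where
  "entry N e \<omega> = X N (fst e) (snd e) \<omega> / sqrt (real N)"

definition mon :: "nat \<Rightarrow> (nat \<times> nat) list \<Rightarrow> 'a \<Rightarrow> real" where
  "mon N L \<omega> = (\<Prod>e\<leftarrow>L. entry N e \<omega>)"

text \<open>The value attached to an undirected edge. On a singleton key \<open>Min\<close> and
  \<open>Max\<close> agree and both components are the diagonal entry, in accordance with the
  diagonal members of the family in \<open>independent\<close>.\<close>

definition pair_at :: "nat \<Rightarrow> nat set \<Rightarrow> 'a \<Rightarrow> real \<times> real" where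
  "pair_at N s \<omega> = (X N (Min s) (Max s) \<omega>, X N (Max s) (Min s) \<omega>)"

definition key_space :: "nat \<Rightarrow> nat set set" where
  "key_space N = key ` ({1..N} \<times> {1..N})"

abbreviation box :: "nat \<Rightarrow> (nat \<times> nat) set" where
  "box N \<equiv> {1..N} \<times> {1..N}"

text \<open>Measurability with respect to the variables at the edges in \<open>A\<close>, in
  factored form, so that independence of the edges passes to functions on disjoint edge sets. The
  target type is general because complex exponentials occur.\<close>

definition determined :: "nat \<Rightarrow> nat set set \<Rightarrow> ('a \<Rightarrow> 'c :: topological_space) \<Rightarrow> bool" where
  "determined N A f \<longleftrightarrow> A \<subseteq> key_space N \<and>
     (\<exists>F \<in> measurable (PiM A (\<lambda>_. borel \<Otimes>\<^sub>M borel)) borel. f = (\<lambda>\<omega>. F (\<lambda>s\<in>A. pair_at N s \<omega>)))"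

lemma mon_Nil [simp]: "mon N [] \<omega> = 1"
  and mon_Cons: "mon N (e # L) \<omega> = entry N e \<omega> * mon N L \<omega>"
  and mon_append: "mon N (L @ L') \<omega> = mon N L \<omega> * mon N L' \<omega>"
  by (simp_all add: mon_def)

lemma keys_in_key_space: "set L \<subseteq> box N \<Longrightarrow> keys L \<subseteq> key_space N"
  by (auto simp: key_space_def)

lemma entry_measurable: "N \<ge> 1 \<Longrightarrow> e \<in> box N \<Longrightarrow> entry N e \<in> borel_measurable (M N)"
  unfolding entry_def[abs_def] using measurable[of N "fst e" "snd e"] by auto

lemma mon_measurable: "N \<ge> 1 \<Longrightarrow> set L \<subseteq> box N \<Longrightarrow> mon N L \<in> borel_measurable (M N)"
proof (induction L)
  case (Cons e L)
  then have "entry N e \<in> borel_measurable (M N)" "mon N L \<in> borel_measurable (M N)"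
    using entry_measurable by auto
  then show ?case by (simp add: mon_Cons[abs_def])
qed (simp add: mon_def[abs_def])

section \<open>Independence over disjoint sets of edges\<close>

lemma pairs_independent:
  assumes N: "N \<ge> 1"
  shows "prob_space.indep_vars (M N) (\<lambda>_. borel \<Otimes>\<^sub>M borel) (pair_at N) (key_space N)"
proof -
  interpret prob_space "M N" by (rule prob_space[OF N])
  define f where "f s = (Min s, Max s)" for s :: "nat set"
  have f: "f (key (i, j)) = (min i j, max i j)" for i j by (simp add: f_def key_def)
  have "f ` key_space N \<subseteq> {(i, j). 1 \<le> i \<and> i \<le> j \<and> j \<le> N}"
    by (auto simp: key_space_def f min_def max_def)
  from indep_vars_subset[OF independent[OF N] this]
  have "indep_vars (\<lambda>_. borel \<Otimes>\<^sub>M borel) (\<lambda>(i, j) \<omega>. (X N i j \<omega>, X N j i \<omega>)) (f ` key_space N)" .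
  moreover have "inj_on f (key_space N)"
  proof (rule inj_onI)
    fix s t assume s: "s \<in> key_space N" and t: "t \<in> key_space N" and eq: "f s = f t"
    have "u = {fst (f u), snd (f u)}" if "u \<in> key_space N" for u
      using that by (auto simp: key_space_def f) (auto simp: key_def min_def max_def split: if_splits)
    then show "s = t" using s t eq by metis
  qed
  ultimately have "indep_vars (\<lambda>_. borel \<Otimes>\<^sub>M borel) (\<lambda>s. (\<lambda>(i, j) \<omega>. (X N i j \<omega>, X N j i \<omega>)) (f s)) (key_space N)"
    by (rule indep_vars_reindex)
  then show ?thesis by (simp add: f_def pair_at_def[abs_def])
qed

lemma determined_mono:
  assumes "determined N A f" "A \<subseteq> B" "B \<subseteq> key_space N"
  shows "determined N B f"
proof -
  obtain F where F: "F \<in> measurable (PiM A (\<lambda>_. borel \<Otimes>\<^sub>M borel)) borel" "f = (\<lambda>\<omega>. F (\<lambda>s\<in>A. pair_at N s \<omega>))"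
    using assms(1) by (auto simp: determined_def)
  have "(\<lambda>y. F (restrict y A)) \<in> measurable (PiM B (\<lambda>_. borel \<Otimes>\<^sub>M borel)) borel"
    using measurable_compose[OF measurable_restrict_subset[OF assms(2)] F(1)] .
  moreover have "f = (\<lambda>\<omega>. F (restrict (\<lambda>s\<in>B. pair_at N s \<omega>) A))"
    unfolding F(2) using assms(2) by (intro ext arg_cong[of _ _ F]) auto
  ultimately show ?thesis using assms(3) unfolding determined_def by (intro conjI bexI) auto
qed

lemma determined_const: "A \<subseteq> key_space N \<Longrightarrow> determined N A (\<lambda>_. c)"
  unfolding determined_def by (intro conjI bexI[of _ "\<lambda>_. c"]) auto

lemma determined_compose:
  assumes "determined N A f" "g \<in> borel_measurable borel"
  shows "determined N A (\<lambda>\<omega>. g (f \<omega>))"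
proof -
  obtain F where F: "F \<in> measurable (PiM A (\<lambda>_. borel \<Otimes>\<^sub>M borel)) borel" "f = (\<lambda>\<omega>. F (\<lambda>s\<in>A. pair_at N s \<omega>))"
    using assms(1) by (auto simp: determined_def)
  show ?thesis using assms(1) measurable_compose[OF F(1) assms(2)]
    unfolding determined_def by (intro conjI bexI[of _ "\<lambda>y. g (F y)"]) (auto simp: F(2))
qed

lemma determined_add:
  fixes f g :: "'a \<Rightarrow> real"
  assumes "determined N A f" "determined N A g"
  shows "determined N A (\<lambda>\<omega>. f \<omega> + g \<omega>)"
proof -
  obtain F where F: "F \<in> borel_measurable (PiM A (\<lambda>_. borel \<Otimes>\<^sub>M borel))" "f = (\<lambda>\<omega>. F (\<lambda>s\<in>A. pair_at N s \<omega>))"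
    using assms(1) by (auto simp: determined_def)
  obtain G where G: "G \<in> borel_measurable (PiM A (\<lambda>_. borel \<Otimes>\<^sub>M borel))" "g = (\<lambda>\<omega>. G (\<lambda>s\<in>A. pair_at N s \<omega>))"
    using assms(2) by (auto simp: determined_def)
  show ?thesis using assms(1) borel_measurable_add[OF F(1) G(1)]
    unfolding determined_def by (intro conjI bexI[of _ "\<lambda>y. F y + G y"]) (auto simp: F(2) G(2))
qed

lemma determined_mult:
  fixes f g :: "'a \<Rightarrow> real"
  assumes "determined N A f" "determined N A g"
  shows "determined N A (\<lambda>\<omega>. f \<omega> * g \<omega>)"
proof -
  obtain F where F: "F \<in> borel_measurable (PiM A (\<lambda>_. borel \<Otimes>\<^sub>M borel))" "f = (\<lambda>\<omega>. F (\<lambda>s\<in>A. pair_at N s \<omega>))"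
    using assms(1) by (auto simp: determined_def)
  obtain G where G: "G \<in> borel_measurable (PiM A (\<lambda>_. borel \<Otimes>\<^sub>M borel))" "g = (\<lambda>\<omega>. G (\<lambda>s\<in>A. pair_at N s \<omega>))"
    using assms(2) by (auto simp: determined_def)
  show ?thesis using assms(1) borel_measurable_times[OF F(1) G(1)]
    unfolding determined_def by (intro conjI bexI[of _ "\<lambda>y. F y * G y"]) (auto simp: F(2) G(2))
qed

lemma determined_sum:
  fixes f :: "'i \<Rightarrow> 'a \<Rightarrow> real"
  assumes "A \<subseteq> key_space N" "\<And>i. i \<in> S \<Longrightarrow> determined N A (f i)"
  shows "determined N A (\<lambda>\<omega>. \<Sum>i\<in>S. f i \<omega>)"
  using assms(2)
  by (induction S rule: infinite_finite_induct) (auto intro!: determined_add determined_const assms(1))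

lemma determined_entry:
  assumes "e \<in> box N" "key e \<in> A" "A \<subseteq> key_space N"
  shows "determined N A (entry N e)"
proof -
  obtain i j where e: "e = (i, j)" by (cases e)
  define F where "F y = (if i \<le> j then fst (y (key e)) else snd (y (key e))) / sqrt (real N)"
    for y :: "nat set \<Rightarrow> real \<times> real"
  have [measurable]: "(\<lambda>y. y (key e)) \<in> measurable (PiM A (\<lambda>_. borel \<Otimes>\<^sub>M borel)) (borel \<Otimes>\<^sub>M borel)"
    using assms(2) by (rule measurable_component_singleton)
  have "F \<in> borel_measurable (PiM A (\<lambda>_. borel \<Otimes>\<^sub>M borel))"
    unfolding F_def by (cases "i \<le> j") simp_all
  moreover have "entry N e = (\<lambda>\<omega>. F (\<lambda>s\<in>A. pair_at N s \<omega>))"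
    using assms(2) by (auto simp: fun_eq_iff F_def entry_def e pair_at_def) (auto simp: key_def min_def max_def)
  ultimately show ?thesis using assms(3) unfolding determined_def by blast
qed

lemma determined_mon:
  assumes "set L \<subseteq> box N" "keys L \<subseteq> A" "A \<subseteq> key_space N"
  shows "determined N A (mon N L)"
  using assms
proof (induction L)
  case Nil
  then show ?case using determined_const[of A N 1] by (simp add: mon_def[abs_def])
next
  case (Cons e L)
  then show ?case
    unfolding mon_Cons[abs_def] by (intro determined_mult determined_entry) auto
qed

lemma determined_indep:
  assumes "N \<ge> 1" "determined N A f" "determined N B g" "A \<inter> B = {}"
  shows "prob_space.indep_var (M N) borel f borel g"
proof -
  interpret prob_space "M N" by (rule prob_space[OF assms(1)])
  obtain F where F: "F \<in> measurable (PiM A (\<lambda>_. borel \<Otimes>\<^sub>M borel)) borel" "f = (\<lambda>\<omega>. F (\<lambda>s\<in>A. pair_at N s \<omega>))"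
    using assms(2) by (auto simp: determined_def)
  obtain G where G: "G \<in> measurable (PiM B (\<lambda>_. borel \<Otimes>\<^sub>M borel)) borel" "g = (\<lambda>\<omega>. G (\<lambda>s\<in>B. pair_at N s \<omega>))"
    using assms(3) by (auto simp: determined_def)
  have "indep_var (PiM A (\<lambda>_. borel \<Otimes>\<^sub>M borel)) (\<lambda>\<omega>. \<lambda>s\<in>A. pair_at N s \<omega>)
      (PiM B (\<lambda>_. borel \<Otimes>\<^sub>M borel)) (\<lambda>\<omega>. \<lambda>s\<in>B. pair_at N s \<omega>)"
    using assms by (intro indep_var_restrict[OF pairs_independent]) (auto simp: determined_def)
  from indep_var_compose[OF this F(1) G(1)] show ?thesis by (simp add: F(2) G(2) comp_def)
qed

section \<open>Exchangeability and moments of single entries\<close>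

lemma permuted_integral:
  fixes g :: "real \<times> real \<Rightarrow> real"
  assumes N: "N \<ge> 1" and p: "p permutes {1..N}" and ij: "i \<in> {1..N}" "j \<in> {1..N}"
    and g: "g \<in> borel_measurable (borel \<Otimes>\<^sub>M borel)"
  shows "(\<integral>\<omega>. g (X N (p i) (p j) \<omega>, X N (p j) (p i) \<omega>) \<partial>M N) = (\<integral>\<omega>. g (X N i j \<omega>, X N j i \<omega>) \<partial>M N)"
proof -
  let ?P = "PiM (box N) (\<lambda>_. borel :: real measure)"
  have [measurable]: "(\<lambda>y. y (i, j)) \<in> borel_measurable ?P" "(\<lambda>y. y (j, i)) \<in> borel_measurable ?P"
    using ij by (auto intro!: measurable_component_singleton)
  have G: "(\<lambda>y. g (y (i, j), y (j, i))) \<in> borel_measurable ?P"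
    by (rule measurable_compose[OF _ g], rule measurable_Pair) measurable
  have pin: "p k \<in> {1..N}" if "k \<in> {1..N}" for k using permutes_in_image[OF p] that by blast
  have m1: "(\<lambda>\<omega>. \<lambda>(i, j) \<in> box N. X N (p i) (p j) \<omega>) \<in> measurable (M N) ?P"
    using measurable[OF N] pin by (intro measurable_restrict) (auto simp del: atLeastAtMost_iff)
  have m2: "(\<lambda>\<omega>. \<lambda>(i, j) \<in> box N. X N i j \<omega>) \<in> measurable (M N) ?P"
    using measurable[OF N] by (intro measurable_restrict) auto
  have "(\<integral>\<omega>. g (X N (p i) (p j) \<omega>, X N (p j) (p i) \<omega>) \<partial>M N) =
      (\<integral>y. g (y (i, j), y (j, i)) \<partial>distr (M N) ?P (\<lambda>\<omega>. \<lambda>(i, j) \<in> box N. X N (p i) (p j) \<omega>))"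
    using ij by (subst integral_distr[OF m1 G]) simp
  also have "\<dots> = (\<integral>y. g (y (i, j), y (j, i)) \<partial>distr (M N) ?P (\<lambda>\<omega>. \<lambda>(i, j) \<in> box N. X N i j \<omega>))"
    by (simp only: permutation_invariant[OF N p])
  also have "\<dots> = (\<integral>\<omega>. g (X N i j \<omega>, X N j i \<omega>) \<partial>M N)"
    using ij by (subst integral_distr[OF m2 G]) simp
  finally show ?thesis .
qed

text \<open>The moment hypotheses are limits at fixed \<open>i\<close> and \<open>j\<close>, whereas
  labels range up to \<open>N\<close>. Uniformity comes from here: every off-diagonal pair, in
  either order, can be carried to the pair at \<open>(1, 2)\<close>.\<close>

lemma off_diagonal_exchangeable:
  fixes g :: "real \<times> real \<Rightarrow> real"
  assumes N: "N \<ge> 1" and ij: "i \<in> {1..N}" "j \<in> {1..N}" "i \<noteq> j"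
    and g: "g \<in> borel_measurable (borel \<Otimes>\<^sub>M borel)"
  shows "(\<integral>\<omega>. g (X N i j \<omega>, X N j i \<omega>) \<partial>M N) = (\<integral>\<omega>. g (X N 1 2 \<omega>, X N 2 1 \<omega>) \<partial>M N)"
proof -
  have N2: "1 \<in> {1..N}" "2 \<in> {1..N}" using ij by auto
  \<comment> \<open>\<open>q\<close> takes 1 to \<open>i\<close>. Then \<open>q 2\<close> is
    exchanged with \<open>j\<close>; neither of them equals \<open>i\<close>, so 1 keeps its
    image.\<close>
  define q where "q = Transposition.transpose 1 i"
  define p where "p = Transposition.transpose (q 2) j \<circ> q"
  have q: "q permutes {1..N}" unfolding q_def by (intro permutes_swap_id) (use N2 ij in auto)
  have q2: "q 2 \<in> {1..N}" using permutes_in_image[OF q] N2 by blast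
  have "p permutes {1..N}" unfolding p_def
    by (intro permutes_compose[OF q] permutes_swap_id q2 ij)
  moreover have "q 1 = i" by (simp add: q_def)
  moreover have "q 2 \<noteq> i" by (auto simp: q_def Transposition.transpose_def)
  ultimately show ?thesis
    using permuted_integral[OF N _ N2 g, of p] ij by (simp add: p_def)
qed

lemma diagonal_exchangeable:
  fixes g :: "real \<times> real \<Rightarrow> real"
  assumes N: "N \<ge> 1" and i: "i \<in> {1..N}" and g: "g \<in> borel_measurable (borel \<Otimes>\<^sub>M borel)"
  shows "(\<integral>\<omega>. g (X N i i \<omega>, X N i i \<omega>) \<partial>M N) = (\<integral>\<omega>. g (X N 1 1 \<omega>, X N 1 1 \<omega>) \<partial>M N)"
proof -
  have N1: "1 \<in> {1..N}" using N by simp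
  have "Transposition.transpose 1 i permutes {1..N}" by (intro permutes_swap_id i N1)
  from permuted_integral[OF N this N1 N1 g] show ?thesis by simp
qed

definition pair_moment :: "nat \<Rightarrow> nat \<Rightarrow> nat \<Rightarrow> real" where
  "pair_moment N k l = (\<integral>\<omega>. entry N (1, 2) \<omega> ^ k * entry N (2, 1) \<omega> ^ l \<partial>M N)"

lemma pair_moment_eq:
  assumes "N \<ge> 1" "i \<in> {1..N}" "j \<in> {1..N}" "i \<noteq> j"
  shows "(\<integral>\<omega>. entry N (i, j) \<omega> ^ k * entry N (j, i) \<omega> ^ l \<partial>M N) = pair_moment N k l"
proof -
  let ?g = "\<lambda>(x, y). (x / sqrt (real N)) ^ k * (y / sqrt (real N)) ^ l"
  have "?g \<in> borel_measurable (borel \<Otimes>\<^sub>M borel)" by measurable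
  from off_diagonal_exchangeable[OF assms this] show ?thesis
    by (simp add: pair_moment_def entry_def)
qed

text \<open>For \<alpha> = 1 the normalization \<open>sqrt (real N) ^ (k + l)\<close> exceeds the
  one in the hypothesis by exactly the factor N, whatever \<open>k\<close> and \<open>l\<close> are.
  So every mixed moment of order at least two is of order at most 1/N.\<close>

lemma pair_moment_limit:
  assumes "k + l \<ge> 2"
  shows "(\<lambda>N. real N * pair_moment N k l) \<longlonglongrightarrow> C k l"
proof (rule Lim_transform_eventually)
  show "(\<lambda>N. (\<integral>\<omega>. X N 1 2 \<omega> ^ k * X N 2 1 \<omega> ^ l \<partial>M N) / real N powr (real (k + l) / 2 - 1)) \<longlonglongrightarrow> C k l"
    by (rule off_diagonal_moments) (use assms in auto)
  show "\<forall>\<^sub>F N in sequentially. (\<integral>\<omega>. X N 1 2 \<omega> ^ k * X N 2 1 \<omega> ^ l \<partial>M N) / real N powr (real (k + l) / 2 - 1)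
      = real N * pair_moment N k l"
    using eventually_ge_at_top[of 1]
  proof eventually_elim
    case (elim N)
    then have N0: "real N > 0" by simp
    have "sqrt (real N) ^ (k + l) = real N powr (real (k + l) / 2)"
      using N0 by (simp add: powr_half_sqrt[symmetric] powr_powr flip: powr_realpow)
    also have "\<dots> = real N * real N powr (real (k + l) / 2 - 1)"
      using N0 by (simp add: powr_diff)
    finally have s: "sqrt (real N) ^ (k + l) = real N * real N powr (real (k + l) / 2 - 1)" .
    have "pair_moment N k l = (\<integral>\<omega>. X N 1 2 \<omega> ^ k * X N 2 1 \<omega> ^ l / sqrt (real N) ^ (k + l) \<partial>M N)"
      by (simp add: pair_moment_def entry_def power_divide power_add)
    also have "\<dots> = (\<integral>\<omega>. X N 1 2 \<omega> ^ k * X N 2 1 \<omega> ^ l \<partial>M N) / sqrt (real N) ^ (k + l)"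
      by simp
    finally show ?case unfolding s using N0 by simp
  qed
qed

lemma entry_power_integrable:
  assumes N: "N \<ge> 1" and e: "e \<in> box N"
  shows "integrable (M N) (\<lambda>\<omega>. \<bar>entry N e \<omega>\<bar> ^ n)"
proof -
  interpret prob_space "M N" by (rule prob_space[OF N])
  obtain i j where ij: "e = (i, j)" "i \<in> {1..N}" "j \<in> {1..N}" using e by auto
  \<comment> \<open>Off the diagonal the hypotheses concern signed products; those of even order in
    one entry are absolute moments, and they dominate all other orders.\<close>
  have ev: "integrable (M N) (\<lambda>\<omega>. \<bar>X N i j \<omega>\<bar> ^ (2 * m))" if "m \<ge> 1" for m
  proof -
    consider "i = j" | "i < j" | "j < i" by linarith
    then show ?thesis
    proof cases
      case 1 then show ?thesis using diagonal_integrable[of N i "2 * m"] N ij that by auto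
    next
      case 2 then show ?thesis
        using off_diagonal_integrable[of N i j "2 * m" 0] N ij that by (simp add: power_even_abs)
    next
      case 3 then show ?thesis
        using off_diagonal_integrable[of N j i 0 "2 * m"] N ij that by (simp add: power_even_abs)
    qed
  qed
  have "integrable (M N) (\<lambda>\<omega>. \<bar>X N i j \<omega>\<bar> ^ n)"
  proof (rule Bochner_Integration.integrable_bound)
    show "integrable (M N) (\<lambda>\<omega>. 1 + \<bar>X N i j \<omega>\<bar> ^ (2 * (n + 1)))" using ev[of "n+1"] by simp
    show "(\<lambda>\<omega>. \<bar>X N i j \<omega>\<bar> ^ n) \<in> borel_measurable (M N)" using measurable[OF N ij(2,3)] by simp
    have "x ^ n \<le> 1 + x ^ (2 * (n + 1))" if "0 \<le> x" for x :: real
    proof (cases "x \<le> 1")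
      case True
      have "x ^ n \<le> 1" using that True by (simp add: power_le_one)
      then show ?thesis using zero_le_power[OF that, of "2 * (n + 1)"] by linarith
    next
      case False
      have "x ^ n \<le> x ^ (2 * (n + 1))" using False by (intro power_increasing) auto
      then show ?thesis by linarith
    qed
    moreover have "0 \<le> p \<Longrightarrow> p \<le> q \<Longrightarrow> norm p \<le> norm q" for p q :: real by simp
    ultimately show "AE \<omega> in M N. norm (\<bar>X N i j \<omega>\<bar> ^ n) \<le> norm (1 + \<bar>X N i j \<omega>\<bar> ^ (2 * (n + 1)))"
      by (intro AE_I2) (meson abs_ge_zero zero_le_power)
  qed
  then have "integrable (M N) (\<lambda>\<omega>. \<bar>X N i j \<omega>\<bar> ^ n / sqrt (real N) ^ n)" by simp
  then show ?thesis by (simp add: entry_def ij power_divide)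
qed

lemma abs_mon_le:
  assumes "L \<noteq> []"
  shows "\<bar>mon N L \<omega>\<bar> \<le> (\<Sum>e\<leftarrow>L. \<bar>entry N e \<omega>\<bar> ^ length L)"
proof -
  have "\<bar>mon N L \<omega>\<bar> = prod_list (map (\<lambda>e. \<bar>entry N e \<omega>\<bar>) L)"
    by (induction L) (simp_all add: mon_Cons abs_mult)
  also have "\<dots> \<le> (\<Sum>x\<leftarrow>map (\<lambda>e. \<bar>entry N e \<omega>\<bar>) L. x ^ length (map (\<lambda>e. \<bar>entry N e \<omega>\<bar>) L))"
    using assms by (intro prod_list_le_sum_list_power) auto
  finally show ?thesis by (simp add: comp_def)
qed

lemma integrable_sum_list:
  "(\<And>e. e \<in> set L \<Longrightarrow> integrable M' (f e)) \<Longrightarrow> integrable M' (\<lambda>\<omega>. \<Sum>e\<leftarrow>L. (f e \<omega> :: real))"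
  by (induction L) auto

lemma integral_sum_list:
  "(\<And>e. e \<in> set L \<Longrightarrow> integrable M' (f e)) \<Longrightarrow>
    (\<integral>\<omega>. (\<Sum>e\<leftarrow>L. (f e \<omega> :: real)) \<partial>M') = (\<Sum>e\<leftarrow>L. \<integral>\<omega>. f e \<omega> \<partial>M')"
  by (induction L) (auto simp: integrable_sum_list)

lemma mon_integrable:
  assumes N: "N \<ge> 1" and L: "set L \<subseteq> box N"
  shows "integrable (M N) (mon N L)"
proof (cases "L = []")
  case True
  interpret prob_space "M N" by (rule prob_space[OF N])
  show ?thesis by (simp add: True mon_def[abs_def])
next
  case False
  show ?thesis
  proof (rule Bochner_Integration.integrable_bound)
    show "integrable (M N) (\<lambda>\<omega>. \<Sum>e\<leftarrow>L. \<bar>entry N e \<omega>\<bar> ^ length L)"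
      using L by (intro integrable_sum_list entry_power_integrable N) auto
    show "mon N L \<in> borel_measurable (M N)" by (rule mon_measurable[OF N L])
    show "AE \<omega> in M N. norm (mon N L \<omega>) \<le> norm (\<Sum>e\<leftarrow>L. \<bar>entry N e \<omega>\<bar> ^ length L)"
      using abs_mon_le[OF False] by (intro AE_I2) (metis abs_ge_self order_trans real_norm_def)
  qed
qed

text \<open>Off the diagonal the hypotheses yield the even orders, and an odd order is caught
  between its even neighbours. Order 1 must be left out there, since the second moment gives
  \<open>E|a_ij|\<close> only as O(N^(-1/2)); on the diagonal the hypothesis includes it.
  Exchangeability makes the constant independent of the position.\<close>

lemma entry_moment_bound:
  "\<exists>c\<ge>0. \<forall>N\<ge>1. \<forall>i\<in>{1..N}. \<forall>j\<in>{1..N}. n \<ge> 1 \<longrightarrow> (i = j \<or> n \<ge> 2) \<longrightarrow>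
     (\<integral>\<omega>. \<bar>entry N (i, j) \<omega>\<bar> ^ n \<partial>M N) \<le> c / real N"
proof -
  have ev: "\<exists>c\<ge>0. \<forall>N\<ge>1. \<forall>i\<in>{1..N}. \<forall>j\<in>{1..N}. i \<noteq> j \<longrightarrow>
      (\<integral>\<omega>. \<bar>entry N (i, j) \<omega>\<bar> ^ (2 * m) \<partial>M N) \<le> c / real N" if "m \<ge> 1" for m
  proof -
    have "Bseq (\<lambda>N. real N * pair_moment N (2 * m) 0)"
      using that by (intro convergent_imp_Bseq convergentI[OF pair_moment_limit]) auto
    then obtain c where c: "c > 0" "\<And>N. norm (real N * pair_moment N (2 * m) 0) \<le> c"
      by (auto simp: Bseq_def)
    have "(\<integral>\<omega>. \<bar>entry N (i, j) \<omega>\<bar> ^ (2 * m) \<partial>M N) \<le> c / real N"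
      if "N \<ge> 1" "i \<in> {1..N}" "j \<in> {1..N}" "i \<noteq> j" for N i j
    proof -
      have "(\<integral>\<omega>. \<bar>entry N (i, j) \<omega>\<bar> ^ (2 * m) \<partial>M N) = pair_moment N (2 * m) 0"
        using pair_moment_eq[OF that, of "2 * m" 0] by (simp add: power_even_abs)
      also have "\<dots> \<le> c / real N"
        using c(2)[of N] that by (simp add: field_simps)
      finally show ?thesis .
    qed
    then show ?thesis using c(1) by (intro exI[of _ c]) auto
  qed
  obtain c0 where c0: "c0 \<ge> 0" "\<forall>N\<ge>1. \<forall>i\<in>{1..N}. \<forall>j\<in>{1..N}. i \<noteq> j \<longrightarrow> n \<ge> 2 \<longrightarrow>
      (\<integral>\<omega>. \<bar>entry N (i, j) \<omega>\<bar> ^ n \<partial>M N) \<le> c0 / real N"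
  proof (cases "n \<ge> 2")
    case False then show ?thesis using that[of 0] by auto
  next
    case n2: True
    show ?thesis
    proof (cases "even n")
      case True
      then obtain m where "n = 2 * m" by blast
      then show ?thesis using ev[of m] n2 that by auto
    next
      case False
      then obtain m where m: "n = 2 * m + 1" by (metis oddE)
      then have m1: "m \<ge> 1" using n2 by auto
      obtain c1 where c1: "c1 \<ge> 0" "\<forall>N\<ge>1. \<forall>i\<in>{1..N}. \<forall>j\<in>{1..N}. i \<noteq> j \<longrightarrow>
        (\<integral>\<omega>. \<bar>entry N (i, j) \<omega>\<bar> ^ (2 * m) \<partial>M N) \<le> c1 / real N" using ev[OF m1] by blast
      obtain c2 where c2: "c2 \<ge> 0" "\<forall>N\<ge>1. \<forall>i\<in>{1..N}. \<forall>j\<in>{1..N}. i \<noteq> j \<longrightarrow>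
        (\<integral>\<omega>. \<bar>entry N (i, j) \<omega>\<bar> ^ (2 * (m + 1)) \<partial>M N) \<le> c2 / real N" using ev[of "m+1"] by auto
      have "(\<integral>\<omega>. \<bar>entry N (i, j) \<omega>\<bar> ^ n \<partial>M N) \<le> (c1 + c2) / real N"
        if h: "N \<ge> 1" "i \<in> {1..N}" "j \<in> {1..N}" "i \<noteq> j" for N i j
      proof -
        have e: "(i, j) \<in> box N" using h by auto
        have "x ^ n \<le> x ^ (2 * m) + x ^ (2 * (m + 1))" if x: "0 \<le> x" for x :: real
        proof (cases "x \<le> 1")
          case True
          have "x ^ n \<le> x ^ (2 * m)" using x True unfolding m by (intro power_decreasing) auto
          then show ?thesis using zero_le_power[OF x, of "2 * (m + 1)"] by linarith
        next
          case False
          have "x ^ n \<le> x ^ (2 * (m + 1))" using False unfolding m by (intro power_increasing) auto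
          then show ?thesis using zero_le_power[OF x, of "2 * m"] by linarith
        qed
        then have "(\<integral>\<omega>. \<bar>entry N (i, j) \<omega>\<bar> ^ n \<partial>M N) \<le> (\<integral>\<omega>. \<bar>entry N (i, j) \<omega>\<bar> ^ (2 * m) + \<bar>entry N (i, j) \<omega>\<bar> ^ (2 * (m + 1)) \<partial>M N)"
          by (intro integral_mono Bochner_Integration.integrable_add entry_power_integrable[OF h(1) e]) auto
        also have "\<dots> = (\<integral>\<omega>. \<bar>entry N (i, j) \<omega>\<bar> ^ (2 * m) \<partial>M N) + (\<integral>\<omega>. \<bar>entry N (i, j) \<omega>\<bar> ^ (2 * (m + 1)) \<partial>M N)"
          by (intro Bochner_Integration.integral_add entry_power_integrable[OF h(1) e])
        also have "\<dots> \<le> c1 / real N + c2 / real N" using c1(2) c2(2) h by (intro add_mono) blast+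
        finally show ?thesis by (simp add: add_divide_distrib)
      qed
      then show ?thesis using c1(1) c2(1) that[of "c1 + c2"] by auto
    qed
  qed
  obtain c1 where c1: "c1 \<ge> 0" "\<forall>N\<ge>1. \<forall>i\<in>{1..N}. n \<ge> 1 \<longrightarrow> (\<integral>\<omega>. \<bar>entry N (i, i) \<omega>\<bar> ^ n \<partial>M N) \<le> c1 / real N"
  proof (cases "n \<ge> 1")
    case False then show ?thesis using that[of 0] by auto
  next
    case True
    let ?r = "\<lambda>N. (\<integral>\<omega>. \<bar>X N 1 1 \<omega>\<bar> ^ n \<partial>M N) / real N powr (real n / 2 - 1)"
    have "?r \<in> O(\<lambda>_. 1)" using diagonal_moments[of 1 n] True by simp
    then obtain b where "\<forall>\<^sub>F N in sequentially. norm (?r N) \<le> b * norm (1::real)"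
      by (rule landau_o.bigE)
    then have "Bseq ?r" by (intro BfunI[where K = b]) simp
    then obtain c where c: "c > 0" "\<And>N. norm (?r N) \<le> c" by (auto simp: Bseq_def)
    have "(\<integral>\<omega>. \<bar>entry N (i, i) \<omega>\<bar> ^ n \<partial>M N) \<le> c / real N" if h: "N \<ge> 1" "i \<in> {1..N}" for N i
    proof -
      have N0: "real N > 0" using h by simp
      have "sqrt (real N) ^ n = real N powr (real n / 2)"
        using N0 by (simp add: powr_half_sqrt[symmetric] powr_powr flip: powr_realpow)
      also have "\<dots> = real N * real N powr (real n / 2 - 1)"
        using N0 by (simp add: powr_diff)
      finally have s: "sqrt (real N) ^ n = real N * real N powr (real n / 2 - 1)" .
      have "(\<lambda>(x :: real, y :: real). \<bar>x\<bar> ^ n) \<in> borel_measurable (borel \<Otimes>\<^sub>M (borel :: real measure))" by measurable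
      from diagonal_exchangeable[OF h this]
      have "(\<integral>\<omega>. \<bar>X N i i \<omega>\<bar> ^ n \<partial>M N) = (\<integral>\<omega>. \<bar>X N 1 1 \<omega>\<bar> ^ n \<partial>M N)" by simp
      then have "(\<integral>\<omega>. \<bar>entry N (i, i) \<omega>\<bar> ^ n \<partial>M N) = ?r N / real N"
        using N0 by (simp add: entry_def power_divide s)
      also have "\<dots> \<le> c / real N" using c(2)[of N] N0 by (intro divide_right_mono) auto
      finally show ?thesis .
    qed
    then show ?thesis using c(1) that[of c] by auto
  qed
  show ?thesis
  proof (intro exI[of _ "c0 + c1"] conjI allI ballI impI)
    show "0 \<le> c0 + c1" using c0 c1 by simp
    fix N i j :: nat
    assume h: "1 \<le> N" "i \<in> {1..N}" "j \<in> {1..N}" "1 \<le> n" "i = j \<or> 2 \<le> n"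
    have "(\<integral>\<omega>. \<bar>entry N (i, j) \<omega>\<bar> ^ n \<partial>M N) \<le> (if i = j then c1 else c0) / real N"
      using h c0(2) c1(2) by auto
    also have "\<dots> \<le> (c0 + c1) / real N" using c0(1) c1(1) by (intro divide_right_mono) auto
    finally show "(\<integral>\<omega>. \<bar>entry N (i, j) \<omega>\<bar> ^ n \<partial>M N) \<le> (c0 + c1) / real N" .
  qed
qed


section \<open>Monomials bounded by their number of distinct edges\<close>

lemma mon_split: "mon N L \<omega> = mon N (filter P L) \<omega> * mon N (filter (\<lambda>e. \<not> P e) L) \<omega>"
  by (induction L) (auto simp: mon_Cons)

text \<open>\<open>h\<close> stands for the identity or the absolute value: one induction over the
  edges gives both factorizations.\<close>

lemma expectation_factor:
  assumes N: "N \<ge> 1" and L: "set L \<subseteq> box N" and S: "finite S"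
    and h: "h \<in> borel_measurable borel" "\<And>x y. h (x * y) = h x * h y" "h 1 = 1" "\<And>x. \<bar>h x\<bar> \<le> \<bar>x\<bar>"
  shows "(\<integral>\<omega>. h (mon N (filter (\<lambda>e. key e \<in> S) L) \<omega>) \<partial>M N) =
    (\<Prod>p\<in>S. (\<integral>\<omega>. (h :: real \<Rightarrow> real) (mon N (filter (\<lambda>e. key e = p) L) \<omega>) \<partial>M N))"
  using S
proof (induction S rule: finite_induct)
  case empty
  interpret prob_space "M N" by (rule prob_space[OF N])
  show ?case by (simp add: h prob_space)
next
  case (insert p S)
  interpret prob_space "M N" by (rule prob_space[OF N])
  let ?A = "filter (\<lambda>e. key e = p) L" and ?B = "filter (\<lambda>e. key e \<in> S) L"
  have AB: "set ?A \<subseteq> box N" "set ?B \<subseteq> box N" using L by auto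
  have "filter (\<lambda>e. key e = p) (filter (\<lambda>e. key e \<in> insert p S) L) = ?A"
    "filter (\<lambda>e. key e \<noteq> p) (filter (\<lambda>e. key e \<in> insert p S) L) = ?B"
    using insert.hyps by (auto simp: filter_filter intro!: filter_cong)
  then have e: "mon N (filter (\<lambda>e. key e \<in> insert p S) L) \<omega> = mon N ?A \<omega> * mon N ?B \<omega>" for \<omega>
    using mon_split[of N "filter (\<lambda>e. key e \<in> insert p S) L" \<omega> "\<lambda>e. key e = p"] by simp
  have int: "integrable (M N) (\<lambda>\<omega>. h (mon N F \<omega>))" if "set F \<subseteq> box N" for F
    by (rule Bochner_Integration.integrable_bound[OF mon_integrable[OF N that]
          measurable_compose[OF mon_measurable[OF N that] h(1)]]) (auto simp: h(4))
  have "indep_var borel (\<lambda>\<omega>. h (mon N ?A \<omega>)) borel (\<lambda>\<omega>. h (mon N ?B \<omega>))"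
  proof (rule determined_indep[OF N])
    show "determined N (keys ?A) (\<lambda>\<omega>. h (mon N ?A \<omega>))" "determined N (keys ?B) (\<lambda>\<omega>. h (mon N ?B \<omega>))"
      by (intro determined_compose[OF _ h(1)] determined_mon keys_in_key_space AB order_refl)+
    show "keys ?A \<inter> keys ?B = {}" using insert.hyps by auto
  qed
  from indep_var_lebesgue_integral[OF this int[OF AB(1)] int[OF AB(2)]]
  show ?case unfolding e h(2) using insert by simp
qed

text \<open>The condition under which absolute moments are as small as 1/N per edge. Loops are
  exempt because already \<open>E|a_ii|\<close> is O(1/N).\<close>

definition thick :: "(nat \<times> nat) list \<Rightarrow> bool" where
  "thick L \<longleftrightarrow> (\<forall>e\<in>set L. fst e = snd e \<or> length (filter (\<lambda>e'. key e' = key e) L) \<ge> 2)"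

lemma thick_append: "thick L \<Longrightarrow> thick L' \<Longrightarrow> thick (L @ L')"
  unfolding thick_def by fastforce

lemma filter_keys_self: "filter (\<lambda>e. key e \<in> keys L) L = L"
  by (simp add: filter_id_conv)

lemma single_key_bound:
  "\<exists>D\<ge>1. \<forall>N\<ge>1. \<forall>L p. set L \<subseteq> box N \<longrightarrow> length L \<le> n \<longrightarrow> p \<in> keys L \<longrightarrow> (\<forall>e\<in>set L. key e = p) \<longrightarrow>
     ((\<exists>a. p = {a}) \<or> length L \<ge> 2) \<longrightarrow> (\<integral>\<omega>. \<bar>mon N L \<omega>\<bar> \<partial>M N) \<le> D / real N"
proof -
  obtain c where c: "\<And>m. c m \<ge> 0" "\<And>m N i j. N \<ge> 1 \<Longrightarrow> i \<in> {1..N} \<Longrightarrow> j \<in> {1..N} \<Longrightarrow> m \<ge> 1 \<Longrightarrow> (i = j \<or> m \<ge> 2) \<Longrightarrow>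
     (\<integral>\<omega>. \<bar>entry N (i, j) \<omega>\<bar> ^ m \<partial>M N) \<le> c m / real N"
    using entry_moment_bound by metis
  \<comment> \<open>At most \<open>n\<close> factors, each with a constant \<open>c m\<close> for
    some \<open>m \<le> n\<close>. Adding 1 gives \<open>D \<ge> 1\<close>, so that powers of
    \<open>D\<close> can be enlarged to a common exponent.\<close>
  define D where "D = 1 + real n * (\<Sum>m\<le>n. c m)"
  have D1: "D \<ge> 1" using c(1) by (simp add: D_def sum_nonneg)
  have "(\<integral>\<omega>. \<bar>mon N L \<omega>\<bar> \<partial>M N) \<le> D / real N"
    if N: "N \<ge> 1" and L: "set L \<subseteq> box N" "length L \<le> n" "p \<in> keys L" "\<forall>e\<in>set L. key e = p"
      "(\<exists>a. p = {a}) \<or> length L \<ge> 2" for N L p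
  proof -
    have L0: "L \<noteq> []" using L(3) by auto
    let ?l = "length L"
    have int: "integrable (M N) (\<lambda>\<omega>. \<bar>entry N e \<omega>\<bar> ^ ?l)" if "e \<in> set L" for e
      using L(1) that by (intro entry_power_integrable N) auto
    have "(\<integral>\<omega>. \<bar>mon N L \<omega>\<bar> \<partial>M N) \<le> (\<integral>\<omega>. (\<Sum>e\<leftarrow>L. \<bar>entry N e \<omega>\<bar> ^ ?l) \<partial>M N)"
      by (intro integral_mono integrable_abs mon_integrable N L(1) integrable_sum_list int abs_mon_le[OF L0])
    also have "\<dots> = (\<Sum>e\<leftarrow>L. \<integral>\<omega>. \<bar>entry N e \<omega>\<bar> ^ ?l \<partial>M N)"
      by (intro integral_sum_list int)
    also have "\<dots> \<le> (\<Sum>e\<leftarrow>L. c ?l / real N)"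
    proof (rule sum_list_mono)
      fix e assume e: "e \<in> set L"
      obtain i j where ij: "e = (i, j)" "i \<in> {1..N}" "j \<in> {1..N}" using e L(1) by auto
      have "i = j \<or> ?l \<ge> 2"
      proof (cases "?l \<ge> 2")
        case False
        then obtain a where "p = {a}" using L(5) by auto
        moreover have "key e = p" using L(4) e by blast
        ultimately show ?thesis by (auto simp: key_def ij)
      qed simp
      moreover have "?l \<ge> 1" using L0 by (cases L) auto
      ultimately show "(\<integral>\<omega>. \<bar>entry N e \<omega>\<bar> ^ ?l \<partial>M N) \<le> c ?l / real N"
        using c(2)[OF N ij(2,3)] ij(1) by blast
    qed
    also have "\<dots> = real ?l * c ?l / real N" by (simp add: sum_list_triv)
    also have "\<dots> \<le> D / real N"
    proof (rule divide_right_mono)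
      have "c ?l \<le> (\<Sum>m\<le>n. c m)" using L(2) c(1) by (intro member_le_sum) auto
      then have "real ?l * c ?l \<le> real n * (\<Sum>m\<le>n. c m)"
        using L(2) c(1) by (intro mult_mono) auto
      then show "real ?l * c ?l \<le> D" by (simp add: D_def)
    qed simp
    finally show ?thesis .
  qed
  with D1 show ?thesis by blast
qed

lemma keys_factor_bound:
  assumes N: "N \<ge> 1" and D: "D \<ge> 1" and len: "length L \<le> n"
    and f: "\<And>p. p \<in> keys L \<Longrightarrow> 0 \<le> f p \<and> f p \<le> D / real N"
  shows "(\<Prod>p\<in>keys L. f p) \<le> D ^ n / real N ^ card (keys L)"
proof -
  have "(\<Prod>p\<in>keys L. f p) \<le> (\<Prod>p\<in>keys L. D / real N)"
    using f by (intro prod_mono) auto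
  also have "\<dots> = D ^ card (keys L) / real N ^ card (keys L)" by (simp add: power_divide)
  also have "\<dots> \<le> D ^ n / real N ^ card (keys L)"
  proof (intro divide_right_mono power_increasing D)
    show "card (keys L) \<le> n" using card_image_le[of "set L" key] card_length[of L] len by simp
  qed simp
  finally show ?thesis .
qed

lemma abs_mon_bound:
  "\<exists>c\<ge>1. \<forall>N\<ge>1. \<forall>L. set L \<subseteq> box N \<longrightarrow> length L \<le> n \<longrightarrow> thick L \<longrightarrow>
     (\<integral>\<omega>. \<bar>mon N L \<omega>\<bar> \<partial>M N) \<le> c / real N ^ card (keys L)"
proof -
  obtain D where D: "D \<ge> 1" "\<forall>N\<ge>1. \<forall>L p. set L \<subseteq> box N \<longrightarrow> length L \<le> n \<longrightarrow> p \<in> keys L \<longrightarrow> (\<forall>e\<in>set L. key e = p) \<longrightarrow>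
     ((\<exists>a. p = {a}) \<or> length L \<ge> 2) \<longrightarrow> (\<integral>\<omega>. \<bar>mon N L \<omega>\<bar> \<partial>M N) \<le> D / real N"
    using single_key_bound[of n] by blast
  have "(\<integral>\<omega>. \<bar>mon N L \<omega>\<bar> \<partial>M N) \<le> D ^ n / real N ^ card (keys L)"
    if h: "N \<ge> 1" "set L \<subseteq> box N" "length L \<le> n" "thick L" for N L
  proof -
    have "(\<integral>\<omega>. \<bar>mon N L \<omega>\<bar> \<partial>M N) = (\<Prod>p\<in>keys L. \<integral>\<omega>. \<bar>mon N (filter (\<lambda>e. key e = p) L) \<omega>\<bar> \<partial>M N)"
      using expectation_factor[OF h(1,2), of "keys L" "\<lambda>x. \<bar>x\<bar>"] by (simp add: filter_keys_self abs_mult)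
    also have "\<dots> \<le> D ^ n / real N ^ card (keys L)"
    proof (rule keys_factor_bound[OF h(1) D(1) h(3)], intro conjI)
      fix p assume p: "p \<in> keys L"
      let ?F = "filter (\<lambda>e. key e = p) L"
      obtain e where e: "e \<in> set L" "p = key e" using p by auto
      have "(\<exists>a. p = {a}) \<or> length ?F \<ge> 2"
        using h(4) e unfolding thick_def by (cases "fst e = snd e") (auto simp: key_def)
      moreover have "length ?F \<le> n" using h(3) length_filter_le order_trans by blast
      moreover have "p \<in> keys ?F" using e by auto
      moreover have "set ?F \<subseteq> box N" using h(2) by auto
      moreover have "\<forall>e\<in>set ?F. key e = p" by simp
      ultimately show "(\<integral>\<omega>. \<bar>mon N ?F \<omega>\<bar> \<partial>M N) \<le> D / real N"
        using D(2)[rule_format, OF h(1), of ?F p] by blast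
    qed simp
    finally show ?thesis .
  qed
  then show ?thesis using D(1) by (intro exI[of _ "D ^ n"]) (auto simp: one_le_power)
qed

text \<open>A proper edge of multiplicity one contributes the factor \<open>E[a\<^sub>i\<^sub>j] = 0\<close>.\<close>

lemma mon_expectation_eq_0:
  assumes N: "N \<ge> 1" and L: "set L \<subseteq> box N" and nt: "\<not> thick L"
  shows "(\<integral>\<omega>. mon N L \<omega> \<partial>M N) = 0"
proof -
  obtain e where e: "e \<in> set L" "fst e \<noteq> snd e" "length (filter (\<lambda>e'. key e' = key e) L) < 2"
    using nt by (auto simp: thick_def not_le)
  let ?F = "filter (\<lambda>e'. key e' = key e) L"
  have "e \<in> set ?F" using e by simp
  then have F: "?F = [e]" using e(3) by (cases ?F; cases "tl ?F") auto
  obtain i j where ij: "e = (i, j)" "i \<in> {1..N}" "j \<in> {1..N}" using e L by auto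
  have "(\<integral>\<omega>. mon N ?F \<omega> \<partial>M N) = 0"
    unfolding F using mean[OF N ij(2,3)] by (simp add: mon_Cons entry_def ij)
  then have "(\<Prod>p\<in>keys L. (\<integral>\<omega>. mon N (filter (\<lambda>e. key e = p) L) \<omega> \<partial>M N)) = 0"
    using e(1) by (intro prod_zero) auto
  then show ?thesis
    using expectation_factor[OF N L, of "keys L" "\<lambda>x. x"] by (simp add: filter_keys_self)
qed

lemma mon_bound:
  "\<exists>c\<ge>1. \<forall>N\<ge>1. \<forall>L. set L \<subseteq> box N \<longrightarrow> length L \<le> n \<longrightarrow>
     \<bar>\<integral>\<omega>. mon N L \<omega> \<partial>M N\<bar> \<le> c / real N ^ card (keys L)"
proof -
  obtain c where c: "c \<ge> 1" "\<forall>N\<ge>1. \<forall>L. set L \<subseteq> box N \<longrightarrow> length L \<le> n \<longrightarrow> thick L \<longrightarrow>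
     (\<integral>\<omega>. \<bar>mon N L \<omega>\<bar> \<partial>M N) \<le> c / real N ^ card (keys L)"
    using abs_mon_bound by blast
  have "\<bar>\<integral>\<omega>. mon N L \<omega> \<partial>M N\<bar> \<le> c / real N ^ card (keys L)"
    if h: "N \<ge> 1" "set L \<subseteq> box N" "length L \<le> n" for N L
  proof (cases "thick L")
    case True
    then show ?thesis using order_trans[OF integral_abs_bound] c(2) h by blast
  next
    case False
    then show ?thesis using mon_expectation_eq_0[OF h(1,2)] c(1) by simp
  qed
  then show ?thesis using c(1) by blast
qed

lemma mon_two_way:
  assumes N: "N \<ge> 1" and ij: "i \<in> {1..N}" "j \<in> {1..N}" "i \<noteq> j" and L: "\<forall>e\<in>set L. key e = {i, j}"
  shows "(\<integral>\<omega>. mon N L \<omega> \<partial>M N) = pair_moment N (count_list L (i, j)) (count_list L (j, i))"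
proof -
  have "mon N L \<omega> = entry N (i, j) \<omega> ^ count_list L (i, j) * entry N (j, i) \<omega> ^ count_list L (j, i)" for \<omega>
    using L
  proof (induction L)
    case (Cons e L)
    then have "e = (i, j) \<or> e = (j, i)" by (cases e) (auto simp: key_def doubleton_eq_iff)
    then show ?case using Cons ij(3) by (auto simp: mon_Cons)
  qed simp
  then show ?thesis using pair_moment_eq[OF N ij] by simp
qed

section \<open>Products of centered monomials\<close>

definition center :: "nat \<Rightarrow> (nat \<times> nat) list \<Rightarrow> 'a \<Rightarrow> real" where
  "center N L \<omega> = mon N L \<omega> - (\<integral>\<omega>'. mon N L \<omega>' \<partial>M N)"

text \<open>A majorant of the centered monomial that expands into terms with positive signs, so that
  products can be bounded factor by factor.\<close>

definition abs_center :: "nat \<Rightarrow> (nat \<times> nat) list \<Rightarrow> 'a \<Rightarrow> real" where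
  "abs_center N L \<omega> = \<bar>mon N L \<omega>\<bar> + (\<integral>\<omega>'. \<bar>mon N L \<omega>'\<bar> \<partial>M N)"

lemma abs_center_ge: "\<bar>center N L \<omega>\<bar> \<le> abs_center N L \<omega>"
  using integral_abs_bound[of "M N" "mon N L"] unfolding center_def abs_center_def by linarith

lemma abs_center_nonneg: "0 \<le> abs_center N L \<omega>"
  using abs_center_ge[of N L \<omega>] by linarith

lemma integrable_abs_center_prod:
  assumes N: "N \<ge> 1"
  shows "set L0 \<subseteq> box N \<Longrightarrow> (\<forall>L\<in>set Ls. set L \<subseteq> box N) \<Longrightarrow>
    integrable (M N) (\<lambda>\<omega>. \<bar>mon N L0 \<omega>\<bar> * (\<Prod>L\<leftarrow>Ls. abs_center N L \<omega>))"
proof (induction Ls arbitrary: L0)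
  case Nil
  then show ?case using mon_integrable[OF N] by simp
next
  case (Cons L Ls)
  have "integrable (M N) (\<lambda>\<omega>. \<bar>mon N (L0 @ L) \<omega>\<bar> * (\<Prod>L\<leftarrow>Ls. abs_center N L \<omega>)
      + (\<integral>\<omega>'. \<bar>mon N L \<omega>'\<bar> \<partial>M N) * (\<bar>mon N L0 \<omega>\<bar> * (\<Prod>L\<leftarrow>Ls. abs_center N L \<omega>)))"
    using Cons.prems by (intro Bochner_Integration.integrable_add integrable_mult_right Cons.IH) auto
  then show ?case
    by (simp add: abs_center_def mon_append abs_mult algebra_simps)
qed

text \<open>Expanding one factor either merges its monomial into \<open>L0\<close> or replaces it by
  its mean; \<open>L0\<close> carries the merged monomials through the induction. In the second case
  shared edges are counted twice, which only adds powers of 1/N. So each factor doubles the number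
  of terms and contributes at most one constant \<open>c\<close>.\<close>

lemma abs_center_prod_le:
  assumes N: "N \<ge> 1" and c: "c \<ge> 1"
    and b: "\<And>L. set L \<subseteq> box N \<Longrightarrow> length L \<le> n \<Longrightarrow> thick L \<Longrightarrow>
      (\<integral>\<omega>. \<bar>mon N L \<omega>\<bar> \<partial>M N) \<le> c / real N ^ card (keys L)"
  shows "set L0 \<subseteq> box N \<Longrightarrow> thick L0 \<Longrightarrow> (\<forall>L\<in>set Ls. set L \<subseteq> box N \<and> thick L) \<Longrightarrow>
    length L0 + sum_list (map length Ls) \<le> n \<Longrightarrow>
    (\<integral>\<omega>. \<bar>mon N L0 \<omega>\<bar> * (\<Prod>L\<leftarrow>Ls. abs_center N L \<omega>) \<partial>M N)
      \<le> 2 ^ length Ls * c ^ Suc (length Ls) / real N ^ card (keys L0 \<union> (\<Union>L\<in>set Ls. keys L))"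
proof (induction Ls arbitrary: L0)
  case Nil
  then show ?case using b[of L0] by simp
next
  case (Cons L Ls)
  let ?P = "\<lambda>\<omega>. \<Prod>L\<leftarrow>Ls. abs_center N L \<omega>"
  let ?m = "\<integral>\<omega>'. \<bar>mon N L \<omega>'\<bar> \<partial>M N"
  let ?K = "\<Union>L\<in>set Ls. keys L"
  let ?b = "2 ^ length Ls * c ^ Suc (length Ls)"
  let ?U = "card (keys L0 \<union> (\<Union>L\<in>set (L # Ls). keys L))"
  have N0: "real N \<ge> 1" using N by simp
  have b0: "0 \<le> ?b" using c by simp
  have i1: "integrable (M N) (\<lambda>\<omega>. \<bar>mon N (L0 @ L) \<omega>\<bar> * ?P \<omega>)"
    and i2: "integrable (M N) (\<lambda>\<omega>. \<bar>mon N L0 \<omega>\<bar> * ?P \<omega>)"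
    using Cons.prems by (intro integrable_abs_center_prod[OF N]; auto)+
  have "(\<integral>\<omega>. \<bar>mon N L0 \<omega>\<bar> * (\<Prod>L\<leftarrow>L # Ls. abs_center N L \<omega>) \<partial>M N) =
      (\<integral>\<omega>. \<bar>mon N (L0 @ L) \<omega>\<bar> * ?P \<omega> + ?m * (\<bar>mon N L0 \<omega>\<bar> * ?P \<omega>) \<partial>M N)"
    by (intro Bochner_Integration.integral_cong refl)
       (simp add: abs_center_def mon_append abs_mult algebra_simps)
  also have "\<dots> = (\<integral>\<omega>. \<bar>mon N (L0 @ L) \<omega>\<bar> * ?P \<omega> \<partial>M N) + ?m * (\<integral>\<omega>. \<bar>mon N L0 \<omega>\<bar> * ?P \<omega> \<partial>M N)"
    using i1 i2 by simp
  also have "\<dots> \<le> ?b * c / real N ^ ?U + ?b * c / real N ^ ?U"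
  proof (rule add_mono)
    have "(\<integral>\<omega>. \<bar>mon N (L0 @ L) \<omega>\<bar> * ?P \<omega> \<partial>M N) \<le> ?b / real N ^ card (keys (L0 @ L) \<union> ?K)"
      using Cons.prems by (intro Cons.IH) (auto simp: thick_append)
    also have "keys (L0 @ L) \<union> ?K = keys L0 \<union> (\<Union>L\<in>set (L # Ls). keys L)" by auto
    also have "?b / real N ^ ?U \<le> ?b * c / real N ^ ?U"
      using mult_left_mono[OF c b0] by (intro divide_right_mono) auto
    finally show "(\<integral>\<omega>. \<bar>mon N (L0 @ L) \<omega>\<bar> * ?P \<omega> \<partial>M N) \<le> ?b * c / real N ^ ?U" .
    have "?m * (\<integral>\<omega>. \<bar>mon N L0 \<omega>\<bar> * ?P \<omega> \<partial>M N) \<le> (c / real N ^ card (keys L)) * (?b / real N ^ card (keys L0 \<union> ?K))"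
    proof (rule mult_mono)
      show "?m \<le> c / real N ^ card (keys L)" using Cons.prems by (intro b) auto
      show "(\<integral>\<omega>. \<bar>mon N L0 \<omega>\<bar> * ?P \<omega> \<partial>M N) \<le> ?b / real N ^ card (keys L0 \<union> ?K)"
        using Cons.prems by (intro Cons.IH) auto
      show "0 \<le> c / real N ^ card (keys L)" using c by simp
      show "0 \<le> (\<integral>\<omega>. \<bar>mon N L0 \<omega>\<bar> * ?P \<omega> \<partial>M N)"
        by (intro Bochner_Integration.integral_nonneg mult_nonneg_nonneg prod_list_nonneg) (auto simp: abs_center_nonneg)
    qed
    also have "\<dots> = ?b * c / real N ^ (card (keys L) + card (keys L0 \<union> ?K))"
      by (simp add: power_add mult_ac)
    also have "\<dots> \<le> ?b * c / real N ^ ?U"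
    proof (intro divide_left_mono power_increasing N0)
      have "keys L0 \<union> (\<Union>L\<in>set (L # Ls). keys L) = keys L \<union> (keys L0 \<union> ?K)" by auto
      then show "?U \<le> card (keys L) + card (keys L0 \<union> ?K)" by (metis card_Un_le)
    qed (use c N in auto)
    finally show "?m * (\<integral>\<omega>. \<bar>mon N L0 \<omega>\<bar> * ?P \<omega> \<partial>M N) \<le> ?b * c / real N ^ ?U" .
  qed
  also have "\<dots> = 2 ^ length (L # Ls) * c ^ Suc (length (L # Ls)) / real N ^ ?U"
    by simp
  finally show ?case .
qed

lemma center_prod_bound:
  "\<exists>c\<ge>1. \<forall>N\<ge>1. \<forall>Ls. (\<forall>L\<in>set Ls. set L \<subseteq> box N \<and> thick L) \<longrightarrow> length Ls \<le> m \<longrightarrow> sum_list (map length Ls) \<le> n \<longrightarrow>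
    integrable (M N) (\<lambda>\<omega>. \<Prod>L\<leftarrow>Ls. center N L \<omega>) \<and>
    (\<integral>\<omega>. \<bar>\<Prod>L\<leftarrow>Ls. center N L \<omega>\<bar> \<partial>M N) \<le> c / real N ^ card (\<Union>L\<in>set Ls. keys L)"
proof -
  obtain c where c: "c \<ge> 1" "\<forall>N\<ge>1. \<forall>L. set L \<subseteq> box N \<longrightarrow> length L \<le> n \<longrightarrow> thick L \<longrightarrow>
     (\<integral>\<omega>. \<bar>mon N L \<omega>\<bar> \<partial>M N) \<le> c / real N ^ card (keys L)"
    using abs_mon_bound by blast
  have "integrable (M N) (\<lambda>\<omega>. \<Prod>L\<leftarrow>Ls. center N L \<omega>) \<and>
    (\<integral>\<omega>. \<bar>\<Prod>L\<leftarrow>Ls. center N L \<omega>\<bar> \<partial>M N) \<le> 2 ^ m * c ^ Suc m / real N ^ card (\<Union>L\<in>set Ls. keys L)"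
    if h: "N \<ge> 1" "\<forall>L\<in>set Ls. set L \<subseteq> box N \<and> thick L" "length Ls \<le> m" "sum_list (map length Ls) \<le> n" for N Ls
  proof
    have int: "integrable (M N) (\<lambda>\<omega>. \<Prod>L\<leftarrow>Ls. abs_center N L \<omega>)"
      using integrable_abs_center_prod[OF h(1), of "[]" Ls] h(2) by simp
    have le: "\<bar>\<Prod>L\<leftarrow>Ls'. center N L \<omega>\<bar> \<le> (\<Prod>L\<leftarrow>Ls'. abs_center N L \<omega>)" for Ls' \<omega>
    proof (induction Ls')
      case (Cons L Ls')
      have "0 \<le> (\<Prod>L\<leftarrow>Ls'. abs_center N L \<omega>)" by (intro prod_list_nonneg) (auto simp: abs_center_nonneg)
      then show ?case using Cons abs_center_ge[of N L \<omega>] abs_center_nonneg[of N L \<omega>]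
        by (auto simp: abs_mult intro!: mult_mono)
    qed simp
    have "(\<lambda>\<omega>. \<Prod>L\<leftarrow>Ls'. center N L \<omega>) \<in> borel_measurable (M N)" if "\<forall>L\<in>set Ls'. set L \<subseteq> box N" for Ls'
      using that
    proof (induction Ls')
      case (Cons L Ls')
      then have "mon N L \<in> borel_measurable (M N)" by (intro mon_measurable h) auto
      then have "center N L \<in> borel_measurable (M N)" unfolding center_def[abs_def] by simp
      then show ?case using Cons by simp
    qed simp
    then have meas: "(\<lambda>\<omega>. \<Prod>L\<leftarrow>Ls. center N L \<omega>) \<in> borel_measurable (M N)" using h(2) by blast
    show intc: "integrable (M N) (\<lambda>\<omega>. \<Prod>L\<leftarrow>Ls. center N L \<omega>)"
      by (rule Bochner_Integration.integrable_bound[OF int meas])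
         (intro AE_I2, metis le abs_ge_self order_trans real_norm_def)
    have "(\<integral>\<omega>. \<bar>\<Prod>L\<leftarrow>Ls. center N L \<omega>\<bar> \<partial>M N) \<le> (\<integral>\<omega>. (\<Prod>L\<leftarrow>Ls. abs_center N L \<omega>) \<partial>M N)"
      by (intro integral_mono integrable_abs intc int le)
    also have "\<dots> \<le> 2 ^ length Ls * c ^ Suc (length Ls) / real N ^ card (\<Union>L\<in>set Ls. keys L)"
      using abs_center_prod_le[OF h(1) c(1), of n "[]" Ls] c(2) h by (simp add: thick_def)
    also have "\<dots> \<le> 2 ^ m * c ^ Suc m / real N ^ card (\<Union>L\<in>set Ls. keys L)"
      using c(1) h(3) by (intro divide_right_mono mult_mono power_increasing) auto
    finally show "(\<integral>\<omega>. \<bar>\<Prod>L\<leftarrow>Ls. center N L \<omega>\<bar> \<partial>M N) \<le> 2 ^ m * c ^ Suc m / real N ^ card (\<Union>L\<in>set Ls. keys L)" .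
  qed
  moreover have "(2::real) ^ m * c ^ Suc m \<ge> 1"
  proof -
    have "1 * 1 \<le> (2::real) ^ m * c ^ Suc m" using c(1) by (intro mult_mono one_le_power) auto
    then show ?thesis by simp
  qed
  ultimately show ?thesis by blast
qed

end


section \<open>Sums over injective labellings\<close>

definition inj_maps :: "'v set \<Rightarrow> nat \<Rightarrow> ('v \<Rightarrow> nat) set" where
  "inj_maps V N = {\<phi> \<in> V \<rightarrow>\<^sub>E {1..N}. inj_on \<phi> V}"

lemma finite_inj_maps: "finite V \<Longrightarrow> finite (inj_maps V N)"
  unfolding inj_maps_def by (rule finite_subset[of _ "V \<rightarrow>\<^sub>E {1..N}"]) (auto intro: finite_PiE)

lemma inj_mapsD:
  assumes "\<phi> \<in> inj_maps V N"
  shows "inj_on \<phi> V" "x \<in> V \<Longrightarrow> \<phi> x \<in> {1..N}"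
  using assms by (auto simp: inj_maps_def simp del: atLeastAtMost_iff)

lemma card_inj_maps:
  assumes "finite V"
  shows "card (inj_maps V N) = (\<Prod>i<card V. N - i)"
  using card_inj_on_subset_funcset[of V "{1..N}" V] assms
  by (simp add: inj_maps_def atLeast0LessThan)

lemma card_inj_maps_le:
  assumes "finite V"
  shows "card (inj_maps V N) \<le> N ^ card V"
proof -
  have "(\<Prod>i<card V. N - i) \<le> (\<Prod>i<card V. N)" by (intro prod_mono) auto
  then show ?thesis by (simp add: card_inj_maps assms)
qed

lemma card_inj_maps_limit:
  assumes "finite V"
  shows "(\<lambda>N. real (card (inj_maps V N)) / real N ^ card V) \<longlonglongrightarrow> 1"
proof -
  have "(\<lambda>N. real (N - i) / real N) \<longlonglongrightarrow> 1" for i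
  proof (rule Lim_transform_eventually)
    have "(\<lambda>N. 1 - real i * inverse (real N)) \<longlonglongrightarrow> 1 - real i * 0"
      by (intro tendsto_intros lim_inverse_n)
    then show "(\<lambda>N. 1 - real i * inverse (real N)) \<longlonglongrightarrow> 1" by simp
    show "\<forall>\<^sub>F N in sequentially. 1 - real i * inverse (real N) = real (N - i) / real N"
      using eventually_ge_at_top[of "i + 1"]
      by eventually_elim (simp add: of_nat_diff field_simps)
  qed
  then have "(\<lambda>N. \<Prod>i<card V. real (N - i) / real N) \<longlonglongrightarrow> (\<Prod>i<card V. 1)"
    by (intro tendsto_prod)
  moreover have "(\<Prod>i<card V. real (N - i) / real N) = real (card (inj_maps V N)) / real N ^ card V" for N
    by (simp add: card_inj_maps assms prod_dividef)
  ultimately show ?thesis by simp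
qed

abbreviation amap :: "('v \<Rightarrow> 'w) \<Rightarrow> ('v \<times> 'v) list \<Rightarrow> ('w \<times> 'w) list" where
  "amap f L \<equiv> map (map_prod f f) L"

lemma key_map_prod: "key (map_prod f f e) = f ` key e"
  by (cases e) (simp add: key_def)

lemma keys_amap: "keys (amap f L) = image f ` keys L"
  by (auto simp: key_map_prod image_image)

lemma inj_on_image_keys:
  assumes "inj_on f V" "set L \<subseteq> V \<times> V"
  shows "inj_on (image f) (keys L)"
  by (rule inj_on_subset[OF inj_on_image_Pow[OF assms(1)]]) (use assms(2) in \<open>auto simp: key_def\<close>)

lemma card_keys_amap:
  assumes "inj_on f V" "set L \<subseteq> V \<times> V"
  shows "card (keys (amap f L)) = card (keys L)"
  unfolding keys_amap by (rule card_image[OF inj_on_image_keys[OF assms]])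

lemma keys_amap_disjoint:
  assumes "inj_on f V" "set L \<subseteq> V \<times> V" "set L' \<subseteq> V \<times> V"
  shows "keys (amap f L) \<inter> keys (amap f L') = {} \<longleftrightarrow> keys L \<inter> keys L' = {}"
proof -
  have "inj_on (image f) (keys (L @ L'))"
    using assms by (intro inj_on_image_keys) auto
  then have "image f ` (keys L \<inter> keys L') = image f ` keys L \<inter> image f ` keys L'"
    by (intro inj_on_image_Int) auto
  then show ?thesis unfolding keys_amap by (metis image_is_empty)
qed

lemma count_list_amap:
  assumes "inj_on f V" "set L \<subseteq> V \<times> V" "u \<in> V" "v \<in> V"
  shows "count_list (amap f L) (f u, f v) = count_list L (u, v)"
  using assms(2)
proof (induction L)
  case (Cons e L)
  then show ?case using assms by (cases e) (auto simp: inj_on_eq_iff)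
qed simp

lemma count_list_filter: "P x \<Longrightarrow> count_list (filter P L) x = count_list L x"
  by (induction L) auto

lemma length_filter_key:
  "u \<noteq> v \<Longrightarrow> length (filter (\<lambda>e. key e = {u, v}) L) = count_list L (u, v) + count_list L (v, u)"
proof (induction L)
  case (Cons e L)
  then show ?case by (cases e) (auto simp: key_def doubleton_eq_iff)
qed simp

text \<open>One orientation per edge, selected by the total order just as in
  \<open>pair_count\<close>.\<close>

definition oriented_edges :: "'v rel \<Rightarrow> 'v set \<Rightarrow> ('v \<times> 'v) list \<Rightarrow> ('v \<times> 'v) set" where
  "oriented_edges r V L = {(u, v). u \<in> V \<and> v \<in> V \<and> (u, v) \<in> r \<and> u \<noteq> v \<and> {u, v} \<in> keys L}"

lemma bij_oriented_edges:
  assumes r: "linear_order_on V r" and L: "set L \<subseteq> V \<times> V" "\<forall>e\<in>set L. fst e \<noteq> snd e"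
  shows "bij_betw (\<lambda>(u, v). {u, v}) (oriented_edges r V L) (keys L)"
  unfolding bij_betw_def
proof
  have anti: "antisym r" and tot: "total_on V r"
    using r by (auto simp: linear_order_on_def partial_order_on_def)
  show "inj_on (\<lambda>(u, v). {u, v}) (oriented_edges r V L)"
    using anti by (auto simp: inj_on_def oriented_edges_def doubleton_eq_iff antisym_def)
  show "(\<lambda>(u, v). {u, v}) ` oriented_edges r V L = keys L"
  proof (intro equalityI subsetI)
    fix p assume "p \<in> keys L"
    then obtain u v where e: "(u, v) \<in> set L" "p = {u, v}" by (auto simp: key_def)
    then have uv: "u \<in> V" "v \<in> V" "u \<noteq> v" using L by auto
    then have "(u, v) \<in> r \<or> (v, u) \<in> r" using tot by (auto simp: total_on_def)
    then have "(u, v) \<in> oriented_edges r V L \<or> (v, u) \<in> oriented_edges r V L"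
      using uv e \<open>p \<in> keys L\<close> by (auto simp: oriented_edges_def insert_commute)
    then show "p \<in> (\<lambda>(u, v). {u, v}) ` oriented_edges r V L"
      using e(2) by (auto simp: image_iff insert_commute)
  qed (auto simp: oriented_edges_def)
qed

context exploding_elliptic_matrices_one
begin

lemma amap_in_box:
  assumes "\<phi> \<in> inj_maps V N" "set L \<subseteq> V \<times> V"
  shows "set (amap \<phi> L) \<subseteq> box N"
  using assms inj_mapsD(2)[OF assms(1)] by (auto simp del: atLeastAtMost_iff)

text \<open>The value does not depend on \<open>\<psi>\<close>: by exchangeability only the
  multiplicities matter, so a sum over labellings is their number times one product.\<close>

lemma mon_expectation_oriented:
  assumes N: "N \<ge> 1" and V: "finite V" and r: "linear_order_on V r"
    and L: "set L \<subseteq> V \<times> V" "\<forall>e\<in>set L. fst e \<noteq> snd e" and \<psi>: "\<psi> \<in> inj_maps V N"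
  shows "(\<integral>\<omega>. mon N (amap \<psi> L) \<omega> \<partial>M N) =
    (\<Prod>(u, v)\<in>oriented_edges r V L. pair_moment N (count_list L (u, v)) (count_list L (v, u)))"
proof -
  let ?L = "amap \<psi> L"
  note inj = inj_mapsD(1)[OF \<psi>]
  have "(\<integral>\<omega>. mon N ?L \<omega> \<partial>M N) = (\<Prod>p\<in>keys ?L. (\<integral>\<omega>. mon N (filter (\<lambda>e. key e = p) ?L) \<omega> \<partial>M N))"
    using expectation_factor[OF N amap_in_box[OF \<psi> L(1)], of "keys ?L" "\<lambda>x. x"]
    by (simp only: filter_keys_self) simp
  also have "\<dots> = (\<Prod>p\<in>keys L. (\<integral>\<omega>. mon N (filter (\<lambda>e. key e = \<psi> ` p) ?L) \<omega> \<partial>M N))"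
    unfolding keys_amap by (rule prod.reindex_cong[OF inj_on_image_keys[OF inj L(1)]]) auto
  also have "\<dots> = (\<Prod>x\<in>oriented_edges r V L. (\<integral>\<omega>. mon N (filter (\<lambda>e. key e = \<psi> ` (case x of (u, v) \<Rightarrow> {u, v})) ?L) \<omega> \<partial>M N))"
    by (rule prod.reindex_bij_betw[OF bij_oriented_edges[OF r L], symmetric])
  also have "\<dots> = (\<Prod>(u, v)\<in>oriented_edges r V L. pair_moment N (count_list L (u, v)) (count_list L (v, u)))"
  proof (intro prod.cong refl, clarify)
    fix u v assume uv: "(u, v) \<in> oriented_edges r V L"
    then have uv': "u \<in> V" "v \<in> V" "u \<noteq> v" by (auto simp: oriented_edges_def)
    have ne: "\<psi> u \<noteq> \<psi> v" using inj uv' by (auto simp: inj_on_eq_iff)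
    let ?F = "filter (\<lambda>e. key e = {\<psi> u, \<psi> v}) ?L"
    have "(\<integral>\<omega>. mon N ?F \<omega> \<partial>M N) = pair_moment N (count_list ?F (\<psi> u, \<psi> v)) (count_list ?F (\<psi> v, \<psi> u))"
      using uv' inj_mapsD(2)[OF \<psi>] ne by (intro mon_two_way N) auto
    also have "count_list ?F (\<psi> u, \<psi> v) = count_list L (u, v)"
      using count_list_amap[OF inj L(1) uv'(1,2)] by (subst count_list_filter) (auto simp: key_def)
    also have "count_list ?F (\<psi> v, \<psi> u) = count_list L (v, u)"
      using count_list_amap[OF inj L(1) uv'(2,1)] by (subst count_list_filter) (auto simp: key_def insert_commute)
    finally show "(\<integral>\<omega>. mon N (filter (\<lambda>e. key e = \<psi> ` {u, v}) ?L) \<omega> \<partial>M N) =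
        pair_moment N (count_list L (u, v)) (count_list L (v, u))" by simp
  qed
  finally show ?thesis .
qed

section \<open>Covariances summed over the labellings of a glued graph\<close>

definition mon_cov :: "nat \<Rightarrow> (nat \<times> nat) list \<Rightarrow> (nat \<times> nat) list \<Rightarrow> real" where
  "mon_cov N L L' = (\<integral>\<omega>. center N L \<omega> * center N L' \<omega> \<partial>M N)"

lemma mon_cov_eq:
  assumes N: "N \<ge> 1" and L: "set L \<subseteq> box N" "set L' \<subseteq> box N"
  shows "mon_cov N L L' = (\<integral>\<omega>. mon N (L @ L') \<omega> \<partial>M N) - (\<integral>\<omega>. mon N L \<omega> \<partial>M N) * (\<integral>\<omega>. mon N L' \<omega> \<partial>M N)"
proof -
  interpret prob_space "M N" by (rule prob_space[OF N])
  have i: "integrable (M N) (mon N L)" "integrable (M N) (mon N L')" "integrable (M N) (\<lambda>\<omega>. mon N L \<omega> * mon N L' \<omega>)"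
    using mon_integrable[OF N L(1)] mon_integrable[OF N L(2)] mon_integrable[OF N, of "L @ L'"] L
    by (auto simp: mon_append[abs_def])
  show ?thesis
    unfolding mon_cov_def center_def mon_append using i
    by (simp add: algebra_simps prob_space)
qed

lemma mon_cov_disjoint:
  assumes N: "N \<ge> 1" and L: "set L \<subseteq> box N" "set L' \<subseteq> box N" and d: "keys L \<inter> keys L' = {}"
  shows "mon_cov N L L' = 0"
proof -
  interpret prob_space "M N" by (rule prob_space[OF N])
  have "indep_var borel (mon N L) borel (mon N L')"
    by (rule determined_indep[OF N _ _ d]) (intro determined_mon L keys_in_key_space order_refl)+
  from indep_var_lebesgue_integral[OF this mon_integrable[OF N L(1)] mon_integrable[OF N L(2)]]
  show ?thesis using mon_cov_eq[OF N L] by (simp add: mon_append)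
qed

lemma glued_cov_bound:
  fixes L1 L2 :: "('v \<times> 'v) list"
  assumes V: "finite V" and L: "set L1 \<subseteq> V \<times> V" "set L2 \<subseteq> V \<times> V"
  shows "\<exists>c. \<forall>N\<ge>1. \<forall>\<psi>\<in>inj_maps V N.
      \<bar>\<integral>\<omega>. mon N (amap \<psi> (L1 @ L2)) \<omega> \<partial>M N\<bar> \<le> c / real N ^ card (keys (L1 @ L2)) \<and>
      \<bar>(\<integral>\<omega>. mon N (amap \<psi> L1) \<omega> \<partial>M N) * (\<integral>\<omega>. mon N (amap \<psi> L2) \<omega> \<partial>M N)\<bar>
        \<le> c / real N ^ (card (keys L1) + card (keys L2))"
proof -
  obtain c where c: "c \<ge> 1" "\<forall>N\<ge>1. \<forall>L. set L \<subseteq> box N \<longrightarrow> length L \<le> length (L1 @ L2) \<longrightarrow>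
     \<bar>\<integral>\<omega>. mon N L \<omega> \<partial>M N\<bar> \<le> c / real N ^ card (keys L)"
    using mon_bound by blast
  have b: "\<bar>\<integral>\<omega>. mon N (amap \<psi> L) \<omega> \<partial>M N\<bar> \<le> c / real N ^ card (keys L)"
    if "N \<ge> 1" "\<psi> \<in> inj_maps V N" "set L \<subseteq> V \<times> V" "length L \<le> length (L1 @ L2)" for N \<psi> and L :: "('v \<times> 'v) list"
    using c(2)[rule_format, OF that(1) amap_in_box[OF that(2,3)]] that(4)
      card_keys_amap[OF inj_mapsD(1)[OF that(2)] that(3)] by simp
  have cc: "c \<le> c * c" using c(1) by simp
  show ?thesis
  proof (intro exI[of _ "c * c"] allI impI ballI conjI)
    fix N \<psi> assume h: "1 \<le> N" "\<psi> \<in> inj_maps V N"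
    have "\<bar>\<integral>\<omega>. mon N (amap \<psi> (L1 @ L2)) \<omega> \<partial>M N\<bar> \<le> c / real N ^ card (keys (L1 @ L2))"
      by (rule b[OF h]) (use L in auto)
    also have "\<dots> \<le> c * c / real N ^ card (keys (L1 @ L2))" by (intro divide_right_mono cc) simp
    finally show "\<bar>\<integral>\<omega>. mon N (amap \<psi> (L1 @ L2)) \<omega> \<partial>M N\<bar> \<le> c * c / real N ^ card (keys (L1 @ L2))" .
    have "\<bar>\<integral>\<omega>. mon N (amap \<psi> L1) \<omega> \<partial>M N\<bar> * \<bar>\<integral>\<omega>. mon N (amap \<psi> L2) \<omega> \<partial>M N\<bar>
      \<le> (c / real N ^ card (keys L1)) * (c / real N ^ card (keys L2))"
      using c(1) by (intro mult_mono b[OF h] L) auto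
    then show "\<bar>(\<integral>\<omega>. mon N (amap \<psi> L1) \<omega> \<partial>M N) * (\<integral>\<omega>. mon N (amap \<psi> L2) \<omega> \<partial>M N)\<bar>
        \<le> c * c / real N ^ (card (keys L1) + card (keys L2))"
      by (simp add: abs_mult power_add)
  qed
qed

text \<open>There are at most \<open>N ^ card V\<close> labellings, so the sum stays bounded and the
  division by \<open>N\<close> makes it vanish.\<close>

lemma sum_inj_maps_tendsto_0:
  assumes V: "finite V" and e: "card V \<le> e"
    and b: "\<And>N \<psi>. N \<ge> 1 \<Longrightarrow> \<psi> \<in> inj_maps V N \<Longrightarrow> \<bar>f N \<psi>\<bar> \<le> c / real N ^ e"
  shows "(\<lambda>N. (\<Sum>\<psi>\<in>inj_maps V N. f N \<psi>) / real N) \<longlonglongrightarrow> 0"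
proof (rule Lim_null_comparison)
  have "(\<lambda>N. \<bar>c\<bar> * inverse (real N)) \<longlonglongrightarrow> \<bar>c\<bar> * 0" by (intro tendsto_intros lim_inverse_n)
  then show "(\<lambda>N. \<bar>c\<bar> * inverse (real N)) \<longlonglongrightarrow> 0" by simp
  show "\<forall>\<^sub>F N in sequentially. norm ((\<Sum>\<psi>\<in>inj_maps V N. f N \<psi>) / real N) \<le> \<bar>c\<bar> * inverse (real N)"
    using eventually_ge_at_top[of 1]
  proof eventually_elim
    case (elim N)
    have N0: "real N > 0" "real N \<ge> 1" using elim by auto
    have "\<bar>\<Sum>\<psi>\<in>inj_maps V N. f N \<psi>\<bar> \<le> (\<Sum>\<psi>\<in>inj_maps V N. \<bar>c\<bar> / real N ^ e)"
    proof (rule order_trans[OF sum_abs], rule sum_mono)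
      fix \<psi> assume "\<psi> \<in> inj_maps V N"
      then have "\<bar>f N \<psi>\<bar> \<le> c / real N ^ e" using b elim by blast
      also have "\<dots> \<le> \<bar>c\<bar> / real N ^ e" by (intro divide_right_mono) auto
      finally show "\<bar>f N \<psi>\<bar> \<le> \<bar>c\<bar> / real N ^ e" .
    qed
    also have "\<dots> = real (card (inj_maps V N)) * (\<bar>c\<bar> / real N ^ e)" by simp
    also have "\<dots> \<le> real N ^ e * (\<bar>c\<bar> / real N ^ e)"
    proof (rule mult_right_mono)
      have "real (card (inj_maps V N)) \<le> real (N ^ card V)" using card_inj_maps_le[OF V] by simp
      also have "\<dots> \<le> real N ^ e" using power_increasing[OF e N0(2)] by simp
      finally show "real (card (inj_maps V N)) \<le> real N ^ e" .
    qed simp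
    also have "\<dots> = \<bar>c\<bar>" using N0 by simp
    finally show ?case using N0 by (simp add: divide_inverse abs_mult mult_right_mono)
  qed
qed

lemma glued_limit_small:
  fixes L1 L2 :: "('v \<times> 'v) list"
  assumes V: "finite V" and L: "set L1 \<subseteq> V \<times> V" "set L2 \<subseteq> V \<times> V"
    and le: "card V \<le> card (keys (L1 @ L2))"
  shows "(\<lambda>N. (\<Sum>\<psi>\<in>inj_maps V N. mon_cov N (amap \<psi> L1) (amap \<psi> L2)) / real N) \<longlonglongrightarrow> 0"
proof -
  obtain c where c: "\<And>N \<psi>. N \<ge> 1 \<Longrightarrow> \<psi> \<in> inj_maps V N \<Longrightarrow>
      \<bar>\<integral>\<omega>. mon N (amap \<psi> (L1 @ L2)) \<omega> \<partial>M N\<bar> \<le> c / real N ^ card (keys (L1 @ L2))"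
      "\<And>N \<psi>. N \<ge> 1 \<Longrightarrow> \<psi> \<in> inj_maps V N \<Longrightarrow>
      \<bar>(\<integral>\<omega>. mon N (amap \<psi> L1) \<omega> \<partial>M N) * (\<integral>\<omega>. mon N (amap \<psi> L2) \<omega> \<partial>M N)\<bar>
        \<le> c / real N ^ (card (keys L1) + card (keys L2))"
    using glued_cov_bound[OF V L] by blast
  show ?thesis
  proof (rule sum_inj_maps_tendsto_0[OF V le, where c = "\<bar>c\<bar> + \<bar>c\<bar>"])
    fix N \<psi> assume h: "1 \<le> N" "\<psi> \<in> inj_maps V N"
    have N1: "real N \<ge> 1" using h by simp
    have "card (keys (L1 @ L2)) \<le> card (keys L1) + card (keys L2)"
      by (simp add: image_Un card_Un_le)
    then have "\<bar>c\<bar> / real N ^ (card (keys L1) + card (keys L2)) \<le> \<bar>c\<bar> / real N ^ card (keys (L1 @ L2))"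
      using N1 by (intro divide_left_mono power_increasing) auto
    moreover have "c / real N ^ n \<le> \<bar>c\<bar> / real N ^ n" for n by (intro divide_right_mono) auto
    ultimately have b: "\<bar>\<integral>\<omega>. mon N (amap \<psi> (L1 @ L2)) \<omega> \<partial>M N\<bar> \<le> \<bar>c\<bar> / real N ^ card (keys (L1 @ L2))"
      "\<bar>(\<integral>\<omega>. mon N (amap \<psi> L1) \<omega> \<partial>M N) * (\<integral>\<omega>. mon N (amap \<psi> L2) \<omega> \<partial>M N)\<bar> \<le> \<bar>c\<bar> / real N ^ card (keys (L1 @ L2))"
      using c[OF h] by (meson order_trans)+
    have "mon_cov N (amap \<psi> L1) (amap \<psi> L2) = (\<integral>\<omega>. mon N (amap \<psi> (L1 @ L2)) \<omega> \<partial>M N)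
        - (\<integral>\<omega>. mon N (amap \<psi> L1) \<omega> \<partial>M N) * (\<integral>\<omega>. mon N (amap \<psi> L2) \<omega> \<partial>M N)"
      using mon_cov_eq[OF h(1) amap_in_box[OF h(2) L(1)] amap_in_box[OF h(2) L(2)]] by simp
    then show "\<bar>mon_cov N (amap \<psi> L1) (amap \<psi> L2)\<bar> \<le> (\<bar>c\<bar> + \<bar>c\<bar>) / real N ^ card (keys (L1 @ L2))"
      unfolding add_divide_distrib by (simp only:) (rule order_trans[OF abs_triangle_ineq4 add_mono[OF b]])
  qed
qed

text \<open>A common edge is counted twice in the product of the two means, so its bound has at
  least one factor 1/N more than that of the joint expectation and the product disappears. In the
  joint expectation about \<open>N ^ card V\<close> labellings, the factor 1/N per edge and the
  outer 1/N balance exactly.\<close>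

lemma glued_limit_tree:
  fixes L1 L2 :: "('v \<times> 'v) list"
  assumes V: "finite V" and L: "set L1 \<subseteq> V \<times> V" "set L2 \<subseteq> V \<times> V" and r: "linear_order_on V r"
    and share: "keys L1 \<inter> keys L2 \<noteq> {}"
    and tree: "card V = card (keys (L1 @ L2)) + 1"
    and nl: "\<forall>e\<in>set (L1 @ L2). fst e \<noteq> snd e"
    and mult: "\<forall>p\<in>keys (L1 @ L2). length (filter (\<lambda>e. key e = p) (L1 @ L2)) \<ge> 2"
  shows "(\<lambda>N. (\<Sum>\<psi>\<in>inj_maps V N. mon_cov N (amap \<psi> L1) (amap \<psi> L2)) / real N)
    \<longlonglongrightarrow> (\<Prod>(u, v)\<in>oriented_edges r V (L1 @ L2). C (count_list (L1 @ L2) (u, v)) (count_list (L1 @ L2) (v, u)))"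
proof -
  let ?L = "L1 @ L2" and ?E = "oriented_edges r V (L1 @ L2)"
  let ?P = "\<lambda>N. \<Prod>(u, v)\<in>?E. pair_moment N (count_list ?L (u, v)) (count_list ?L (v, u))"
  have Ls: "set ?L \<subseteq> V \<times> V" using L by auto
  obtain c where c: "\<And>N \<psi>. N \<ge> 1 \<Longrightarrow> \<psi> \<in> inj_maps V N \<Longrightarrow>
      \<bar>(\<integral>\<omega>. mon N (amap \<psi> L1) \<omega> \<partial>M N) * (\<integral>\<omega>. mon N (amap \<psi> L2) \<omega> \<partial>M N)\<bar>
        \<le> c / real N ^ (card (keys L1) + card (keys L2))"
    using glued_cov_bound[OF V L] by blast
  have "card (keys ?L) < card (keys L1) + card (keys L2)"
    using card_Un_Int[of "keys L1" "keys L2"] share by (simp add: image_Un card_gt_0_iff)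
  then have Z: "(\<lambda>N. (\<Sum>\<psi>\<in>inj_maps V N. (\<integral>\<omega>. mon N (amap \<psi> L1) \<omega> \<partial>M N) * (\<integral>\<omega>. mon N (amap \<psi> L2) \<omega> \<partial>M N)) / real N) \<longlonglongrightarrow> 0"
    using tree by (intro sum_inj_maps_tendsto_0[OF V _ c]) auto
  have cE: "card ?E = card (keys ?L)"
    by (rule bij_betw_same_card[OF bij_oriented_edges[OF r Ls nl]])
  have "(\<lambda>N. (\<Prod>(u, v)\<in>?E. real N * pair_moment N (count_list ?L (u, v)) (count_list ?L (v, u))))
      \<longlonglongrightarrow> (\<Prod>(u, v)\<in>?E. C (count_list ?L (u, v)) (count_list ?L (v, u)))"
  proof (intro tendsto_prod, clarify)
    fix u v assume uv: "(u, v) \<in> ?E"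
    then have "u \<noteq> v" "{u, v} \<in> keys ?L" by (auto simp: oriented_edges_def)
    then have "count_list ?L (u, v) + count_list ?L (v, u) \<ge> 2"
      using mult length_filter_key[of u v ?L] by metis
    then show "(\<lambda>N. real N * pair_moment N (count_list ?L (u, v)) (count_list ?L (v, u)))
        \<longlonglongrightarrow> C (count_list ?L (u, v)) (count_list ?L (v, u))"
      by (rule pair_moment_limit)
  qed
  from tendsto_mult[OF card_inj_maps_limit[OF V] this]
  have lim: "(\<lambda>N. real (card (inj_maps V N)) / real N ^ card V * (\<Prod>(u, v)\<in>?E. real N * pair_moment N (count_list ?L (u, v)) (count_list ?L (v, u))))
      \<longlonglongrightarrow> (\<Prod>(u, v)\<in>?E. C (count_list ?L (u, v)) (count_list ?L (v, u)))" by simp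
  have A: "(\<lambda>N. (\<Sum>\<psi>\<in>inj_maps V N. (\<integral>\<omega>. mon N (amap \<psi> ?L) \<omega> \<partial>M N)) / real N)
      \<longlonglongrightarrow> (\<Prod>(u, v)\<in>?E. C (count_list ?L (u, v)) (count_list ?L (v, u)))"
  proof (rule Lim_transform_eventually[OF lim])
    show "\<forall>\<^sub>F N in sequentially. real (card (inj_maps V N)) / real N ^ card V * (\<Prod>(u, v)\<in>?E. real N * pair_moment N (count_list ?L (u, v)) (count_list ?L (v, u)))
       = (\<Sum>\<psi>\<in>inj_maps V N. (\<integral>\<omega>. mon N (amap \<psi> ?L) \<omega> \<partial>M N)) / real N"
      using eventually_ge_at_top[of 1]
    proof eventually_elim
      case (elim N)
      have "(\<Sum>\<psi>\<in>inj_maps V N. (\<integral>\<omega>. mon N (amap \<psi> ?L) \<omega> \<partial>M N)) = (\<Sum>\<psi>\<in>inj_maps V N. ?P N)"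
        by (intro sum.cong refl mon_expectation_oriented[OF elim V r Ls nl])
      also have "\<dots> = real (card (inj_maps V N)) * ?P N" by simp
      finally have 1: "(\<Sum>\<psi>\<in>inj_maps V N. (\<integral>\<omega>. mon N (amap \<psi> ?L) \<omega> \<partial>M N)) = real (card (inj_maps V N)) * ?P N" .
      have "(\<Prod>(u, v)\<in>?E. real N * pair_moment N (count_list ?L (u, v)) (count_list ?L (v, u)))
          = real N ^ card (keys ?L) * ?P N"
        by (simp add: case_prod_unfold prod.distrib cE)
      then show ?case unfolding 1 using elim by (simp add: tree)
    qed
  qed
  have "(\<lambda>N. (\<Sum>\<psi>\<in>inj_maps V N. (\<integral>\<omega>. mon N (amap \<psi> ?L) \<omega> \<partial>M N)) / real N
      - (\<Sum>\<psi>\<in>inj_maps V N. (\<integral>\<omega>. mon N (amap \<psi> L1) \<omega> \<partial>M N) * (\<integral>\<omega>. mon N (amap \<psi> L2) \<omega> \<partial>M N)) / real N)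
      \<longlonglongrightarrow> (\<Prod>(u, v)\<in>?E. C (count_list ?L (u, v)) (count_list ?L (v, u))) - 0"
    by (intro tendsto_diff A Z)
  then have "(\<lambda>N. (\<Sum>\<psi>\<in>inj_maps V N. (\<integral>\<omega>. mon N (amap \<psi> ?L) \<omega> \<partial>M N)) / real N
      - (\<Sum>\<psi>\<in>inj_maps V N. (\<integral>\<omega>. mon N (amap \<psi> L1) \<omega> \<partial>M N) * (\<integral>\<omega>. mon N (amap \<psi> L2) \<omega> \<partial>M N)) / real N)
      \<longlonglongrightarrow> (\<Prod>(u, v)\<in>?E. C (count_list ?L (u, v)) (count_list ?L (v, u)))" by simp
  then show ?thesis
  proof (rule Lim_transform_eventually)
    show "\<forall>\<^sub>F N in sequentially. (\<Sum>\<psi>\<in>inj_maps V N. (\<integral>\<omega>. mon N (amap \<psi> ?L) \<omega> \<partial>M N)) / real N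
      - (\<Sum>\<psi>\<in>inj_maps V N. (\<integral>\<omega>. mon N (amap \<psi> L1) \<omega> \<partial>M N) * (\<integral>\<omega>. mon N (amap \<psi> L2) \<omega> \<partial>M N)) / real N
      = (\<Sum>\<psi>\<in>inj_maps V N. mon_cov N (amap \<psi> L1) (amap \<psi> L2)) / real N"
      using eventually_ge_at_top[of 1]
    proof eventually_elim
      case (elim N)
      have "mon_cov N (amap \<psi> L1) (amap \<psi> L2) = (\<integral>\<omega>. mon N (amap \<psi> ?L) \<omega> \<partial>M N)
        - (\<integral>\<omega>. mon N (amap \<psi> L1) \<omega> \<partial>M N) * (\<integral>\<omega>. mon N (amap \<psi> L2) \<omega> \<partial>M N)" if "\<psi> \<in> inj_maps V N" for \<psi>
        using mon_cov_eq[OF elim amap_in_box[OF that L(1)] amap_in_box[OF that L(2)]] by simp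
      then show ?case by (simp add: sum_subtractf diff_divide_distrib)
    qed
  qed
qed

end


section \<open>Partition graphs and gluings\<close>

lemma block_of_eq:
  assumes "partition_on V \<sigma>" "B \<in> \<sigma>" "x \<in> B"
  shows "block_of \<sigma> x = B"
  unfolding block_of_def
proof (rule the_equality)
  fix B' assume "B' \<in> \<sigma> \<and> x \<in> B'"
  then show "B' = B" using assms partition_onD2[OF assms(1)] by (auto simp: disjoint_def)
qed (use assms in auto)

lemma block_of_in:
  assumes "partition_on V \<sigma>" "x \<in> V"
  shows "block_of \<sigma> x \<in> \<sigma>" "x \<in> block_of \<sigma> x"
proof -
  obtain B where "B \<in> \<sigma>" "x \<in> B" using assms partition_onD1[OF assms(1)] by auto
  then show "block_of \<sigma> x \<in> \<sigma>" "x \<in> block_of \<sigma> x"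
    using block_of_eq[OF assms(1)] by auto
qed

lemma image_block_of:
  assumes "partition_on V \<sigma>"
  shows "block_of \<sigma> ` V = \<sigma>"
proof (intro equalityI subsetI)
  fix B assume B: "B \<in> \<sigma>"
  then obtain x where x: "x \<in> B" using partition_onD3[OF assms] by (metis ex_in_conv)
  then have "x \<in> V" using B partition_onD1[OF assms] by auto
  then show "B \<in> block_of \<sigma> ` V" using block_of_eq[OF assms B x] by auto
qed (use block_of_in[OF assms] in auto)

text \<open>The closed walk of this word runs through the arcs 1, ..., k of
  \<open>partition_graph\<close> in order, which translates the graph into the language of
  walks.\<close>

definition block_word :: "nat set set \<Rightarrow> nat set list" where
  "block_word \<pi> = map (block_of \<pi>) [1..<Suc (card (\<Union>\<pi>))]"

lemma all_partitionsD:
  assumes "\<pi> \<in> all_partitions"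
  shows "card (\<Union>\<pi>) \<ge> 1" "\<Union>\<pi> = {1..card (\<Union>\<pi>)}" "partition_on {1..card (\<Union>\<pi>)} \<pi>" "finite \<pi>"
proof -
  obtain k where k: "k \<ge> 1" "partition_on {1..k} \<pi>" using assms by (auto simp: all_partitions_def)
  then have "\<Union>\<pi> = {1..k}" using partition_onD1 by blast
  moreover from this have "card (\<Union>\<pi>) = k" by simp
  ultimately show "card (\<Union>\<pi>) \<ge> 1" "\<Union>\<pi> = {1..card (\<Union>\<pi>)}" "partition_on {1..card (\<Union>\<pi>)} \<pi>"
    using k by simp_all
  show "finite \<pi>" using k(2) by (rule finite_elements[rotated]) simp
qed

lemma set_block_word:
  assumes "\<pi> \<in> all_partitions"
  shows "set (block_word \<pi>) = \<pi>"
proof -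
  have "{1..<Suc (card (\<Union>\<pi>))} = {1..card (\<Union>\<pi>)}" by auto
  then show ?thesis
    using image_block_of[OF all_partitionsD(3)[OF assms]] by (simp add: block_word_def del: upt_Suc)
qed

lemma block_word_nonempty: "\<pi> \<in> all_partitions \<Longrightarrow> block_word \<pi> \<noteq> []"
  using all_partitionsD(1) by (auto simp: block_word_def)

lemma cyc_map: "cyc (map f xs) = amap f (cyc xs)"
  by (simp add: cyc_def rotate1_map zip_map_map map_prod_def)

lemma set_cyc_subset: "set (cyc xs) \<subseteq> set xs \<times> set xs"
  by (auto simp: cyc_def dest: set_zip_leftD set_zip_rightD)

lemma cyc_upt:
  assumes "k \<ge> 1"
  shows "cyc (map f [1..<Suc k]) = map (\<lambda>m. (f m, f (if m = k then 1 else m + 1))) [1..<Suc k]"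
proof (rule nth_equalityI)
  fix i assume "i < length (cyc (map f [1..<Suc k]))"
  then have i: "i < k" by (simp del: upt_Suc)
  have "map f [1..<Suc k] ! j = f (Suc j)" if "j < k" for j
    using that by (subst nth_map) (auto simp del: upt_Suc)
  moreover have "Suc i mod k < k" using assms by simp
  moreover have "Suc i mod k = (if Suc i = k then 0 else Suc i)" using i by auto
  ultimately show "cyc (map f [1..<Suc k]) ! i = map (\<lambda>m. (f m, f (if m = k then 1 else m + 1))) [1..<Suc k] ! i"
    using i by (simp add: cyc_def nth_rotate1 del: upt_Suc)
qed simp

lemma cyc_block_word:
  assumes "\<pi> \<in> all_partitions"
  shows "cyc (block_word \<pi>) =
    map (\<lambda>m. (tail (partition_graph \<pi>) m, head (partition_graph \<pi>) m)) [1..<Suc (card (\<Union>\<pi>))]"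
  unfolding block_word_def cyc_upt[OF all_partitionsD(1)[OF assms]]
  by (simp add: partition_graph_def Let_def del: upt_Suc)

lemma arcs_partition_graph: "arcs (partition_graph \<pi>) = set [1..<Suc (card (\<Union>\<pi>))]"
  by (auto simp: partition_graph_def Let_def)

lemma verts_partition_graph [simp]: "verts (partition_graph \<pi>) = \<pi>"
  by (simp add: partition_graph_def Let_def)

lemma count_list_map_distinct:
  "distinct xs \<Longrightarrow> count_list (map f xs) y = card {x \<in> set xs. f x = y}"
proof (induction xs)
  case (Cons x xs)
  have "{z \<in> set (x # xs). f z = y} = (if f x = y then insert x {z \<in> set xs. f z = y} else {z \<in> set xs. f z = y})"
    by auto
  then show ?case using Cons by simp
qed simp

definition left_word :: "(nat set + nat set) set set \<Rightarrow> nat set set \<Rightarrow> (nat set + nat set) set list" where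
  "left_word \<sigma> \<pi> = map (\<lambda>B. block_of \<sigma> (Inl B)) (block_word \<pi>)"

definition right_word :: "(nat set + nat set) set set \<Rightarrow> nat set set \<Rightarrow> (nat set + nat set) set list" where
  "right_word \<sigma> \<pi> = map (\<lambda>B. block_of \<sigma> (Inr B)) (block_word \<pi>)"

text \<open>The glued graph in the form of a list: two closed walks, the images of the two words
  under the identification. Arc counts and simple edges become counts and keys of this list.\<close>

definition glue_arcs :: "nat set set \<Rightarrow> nat set set \<Rightarrow> (nat set + nat set) set set
    \<Rightarrow> ((nat set + nat set) set \<times> (nat set + nat set) set) list" where
  "glue_arcs \<pi>1 \<pi>2 \<sigma> = cyc (left_word \<sigma> \<pi>1) @ cyc (right_word \<sigma> \<pi>2)"

lemma cyc_left_word: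
  assumes "\<pi>1 \<in> all_partitions"
  shows "cyc (left_word \<sigma> \<pi>1) = map (\<lambda>e. (tail (glue (partition_graph \<pi>1) (partition_graph \<pi>2) \<sigma>) (Inl e),
      head (glue (partition_graph \<pi>1) (partition_graph \<pi>2) \<sigma>) (Inl e))) [1..<Suc (card (\<Union>\<pi>1))]"
  unfolding left_word_def cyc_map cyc_block_word[OF assms] by (simp add: glue_def del: upt_Suc)

lemma cyc_right_word:
  assumes "\<pi>2 \<in> all_partitions"
  shows "cyc (right_word \<sigma> \<pi>2) = map (\<lambda>e. (tail (glue (partition_graph \<pi>1) (partition_graph \<pi>2) \<sigma>) (Inr e),
      head (glue (partition_graph \<pi>1) (partition_graph \<pi>2) \<sigma>) (Inr e))) [1..<Suc (card (\<Union>\<pi>2))]"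
  unfolding right_word_def cyc_map cyc_block_word[OF assms] by (simp add: glue_def del: upt_Suc)

lemma arcs_glue: "arcs (glue (partition_graph \<pi>1) (partition_graph \<pi>2) \<sigma>) =
    set [1..<Suc (card (\<Union>\<pi>1))] <+> set [1..<Suc (card (\<Union>\<pi>2))]"
  by (simp only: glue_def arcs_partition_graph pre_digraph.simps)

lemma verts_glue [simp]: "verts (glue T1 T2 \<sigma>) = \<sigma>"
  by (simp add: glue_def)

lemma set_glue_arcs:
  assumes "\<pi>1 \<in> all_partitions" "\<pi>2 \<in> all_partitions"
  shows "set (glue_arcs \<pi>1 \<pi>2 \<sigma>) =
    (\<lambda>e. (tail (glue (partition_graph \<pi>1) (partition_graph \<pi>2) \<sigma>) e,
          head (glue (partition_graph \<pi>1) (partition_graph \<pi>2) \<sigma>) e)) `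
      arcs (glue (partition_graph \<pi>1) (partition_graph \<pi>2) \<sigma>)"
  unfolding glue_arcs_def set_append cyc_left_word[OF assms(1), of \<sigma> \<pi>2] cyc_right_word[OF assms(2), of \<sigma> \<pi>1]
    arcs_glue set_map Plus_def image_Un image_image ..

lemma simple_edges_glue:
  assumes "\<pi>1 \<in> all_partitions" "\<pi>2 \<in> all_partitions"
  shows "simple_edges (glue (partition_graph \<pi>1) (partition_graph \<pi>2) \<sigma>) = keys (glue_arcs \<pi>1 \<pi>2 \<sigma>)"
  unfolding set_glue_arcs[OF assms] simple_edges_def image_image key_def by simp

lemma arc_count_glue:
  assumes "\<pi>1 \<in> all_partitions" "\<pi>2 \<in> all_partitions"
  shows "arc_count (glue (partition_graph \<pi>1) (partition_graph \<pi>2) \<sigma>) u v = count_list (glue_arcs \<pi>1 \<pi>2 \<sigma>) (u, v)"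
proof -
  let ?T = "glue (partition_graph \<pi>1) (partition_graph \<pi>2) \<sigma>"
  let ?A = "{e \<in> set [1..<Suc (card (\<Union>\<pi>1))]. (tail ?T (Inl e), head ?T (Inl e)) = (u, v)}"
  let ?B = "{e \<in> set [1..<Suc (card (\<Union>\<pi>2))]. (tail ?T (Inr e), head ?T (Inr e)) = (u, v)}"
  have "{e \<in> arcs ?T. tail ?T e = u \<and> head ?T e = v} = ?A <+> ?B"
    unfolding arcs_glue by (auto simp del: upt_Suc set_upt)
  then have "arc_count ?T u v = card ?A + card ?B"
    unfolding arc_count_def by (simp add: card_Plus del: upt_Suc set_upt)
  also have "\<dots> = count_list (glue_arcs \<pi>1 \<pi>2 \<sigma>) (u, v)"
    unfolding glue_arcs_def cyc_left_word[OF assms(1), of \<sigma> \<pi>2] cyc_right_word[OF assms(2), of \<sigma> \<pi>1]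
    by (simp only: count_list_append count_list_map_distinct distinct_upt)
  finally show ?thesis .
qed

lemma gluing_partitionsD:
  assumes "\<sigma> \<in> gluing_partitions V W"
  shows "partition_on (V <+> W) \<sigma>"
    "B \<in> \<sigma> \<Longrightarrow> Inl x \<in> B \<Longrightarrow> Inl y \<in> B \<Longrightarrow> x = y" "B \<in> \<sigma> \<Longrightarrow> Inr z \<in> B \<Longrightarrow> Inr w \<in> B \<Longrightarrow> z = w"
  using assms by (auto simp: gluing_partitions_def)

lemma finite_gluing_partitions:
  assumes "finite V" "finite W"
  shows "finite (gluing_partitions V W)"
proof (rule finite_subset)
  show "gluing_partitions V W \<subseteq> {\<sigma>. partition_on (V <+> W) \<sigma>}" by (auto simp: gluing_partitions_def)
  show "finite {\<sigma>. partition_on (V <+> W) \<sigma>}" by (rule finitely_many_partition_on) (use assms in simp)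
qed

lemma set_words:
  assumes "\<pi>1 \<in> all_partitions" "\<pi>2 \<in> all_partitions" "\<sigma> \<in> gluing_partitions \<pi>1 \<pi>2"
  shows "set (left_word \<sigma> \<pi>1) \<union> set (right_word \<sigma> \<pi>2) = \<sigma>"
proof -
  have "set (left_word \<sigma> \<pi>1) \<union> set (right_word \<sigma> \<pi>2) = block_of \<sigma> ` (\<pi>1 <+> \<pi>2)"
    using assms(1,2) by (simp add: left_word_def right_word_def set_block_word Plus_def image_Un image_image)
  also have "\<dots> = \<sigma>" by (rule image_block_of[OF gluing_partitionsD(1)[OF assms(3)]])
  finally show ?thesis .
qed

lemma common_edge_iff:
  assumes "\<pi>1 \<in> all_partitions" "\<pi>2 \<in> all_partitions"
  shows "\<sigma> \<in> common_edge_gluings (partition_graph \<pi>1) (partition_graph \<pi>2) \<longleftrightarrow>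
    \<sigma> \<in> gluing_partitions \<pi>1 \<pi>2 \<and> keys (cyc (left_word \<sigma> \<pi>1)) \<inter> keys (cyc (right_word \<sigma> \<pi>2)) \<noteq> {}"
proof -
  let ?T = "glue (partition_graph \<pi>1) (partition_graph \<pi>2) \<sigma>"
  have 1: "keys (cyc (left_word \<sigma> \<pi>1)) = (\<lambda>e. {tail ?T (Inl e), head ?T (Inl e)}) ` arcs (partition_graph \<pi>1)"
    unfolding cyc_left_word[OF assms(1), of \<sigma> \<pi>2] arcs_partition_graph set_map image_image key_def by simp
  have 2: "keys (cyc (right_word \<sigma> \<pi>2)) = (\<lambda>e. {tail ?T (Inr e), head ?T (Inr e)}) ` arcs (partition_graph \<pi>2)"
    unfolding cyc_right_word[OF assms(2), of \<sigma> \<pi>1] arcs_partition_graph set_map image_image key_def by simp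
  show ?thesis
    unfolding common_edge_gluings_def 1 2 Let_def mem_Collect_eq verts_partition_graph by blast
qed

text \<open>A pair of injections amounts to its coincidence pattern \<open>\<sigma>\<close> and an injection of the blocks of \<open>\<sigma>\<close>.\<close>

lemma sum_over_gluings:
  fixes f :: "('v \<Rightarrow> nat) \<Rightarrow> ('w \<Rightarrow> nat) \<Rightarrow> real"
  assumes V: "finite V" and W: "finite W"
  shows "(\<Sum>\<phi>1\<in>inj_maps V N. \<Sum>\<phi>2\<in>inj_maps W N. f \<phi>1 \<phi>2) =
    (\<Sum>\<sigma>\<in>gluing_partitions V W. \<Sum>\<psi>\<in>inj_maps \<sigma> N.
       f (\<lambda>x\<in>V. \<psi> (block_of \<sigma> (Inl x))) (\<lambda>y\<in>W. \<psi> (block_of \<sigma> (Inr y))))"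
proof -
  define D where "D = V <+> W"
  define G where "G = (\<lambda>(\<sigma>, \<psi>). (\<lambda>x\<in>V. (\<psi> :: ('v + 'w) set \<Rightarrow> nat) (block_of \<sigma> (Inl x)), \<lambda>y\<in>W. \<psi> (block_of \<sigma> (Inr y))))"
  let ?S = "SIGMA \<sigma>:gluing_partitions V W. inj_maps \<sigma> N"
  have finS: "finite (inj_maps \<sigma> N)" if "\<sigma> \<in> gluing_partitions V W" for \<sigma> :: "('v + 'w) set set"
  proof (rule finite_inj_maps)
    show "finite \<sigma>"
      using finite_elements[OF _ gluing_partitionsD(1)[OF that]] V W by simp
  qed
  have inl: "Inl x \<in> D \<longleftrightarrow> x \<in> V" and inr: "Inr y \<in> D \<longleftrightarrow> y \<in> W" for x y
    by (auto simp: D_def)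
  have maps: "G s \<in> inj_maps V N \<times> inj_maps W N" if "s \<in> ?S" for s
  proof -
    obtain \<sigma> \<psi> where s: "s = (\<sigma>, \<psi>)" "\<sigma> \<in> gluing_partitions V W" "\<psi> \<in> inj_maps \<sigma> N" using \<open>s \<in> ?S\<close> by auto
    note P = gluing_partitionsD(1)[OF s(2), folded D_def]
    note b = block_of_in[OF P]
    have "(\<lambda>x\<in>V. \<psi> (block_of \<sigma> (Inl x))) \<in> inj_maps V N"
      unfolding inj_maps_def
    proof (intro CollectI conjI inj_onI)
      show "(\<lambda>x\<in>V. \<psi> (block_of \<sigma> (Inl x))) \<in> V \<rightarrow>\<^sub>E {1..N}"
        using inj_mapsD(2)[OF s(3) b(1)] inl by (auto simp del: atLeastAtMost_iff)
      fix x y assume xy: "x \<in> V" "y \<in> V" "(\<lambda>x\<in>V. \<psi> (block_of \<sigma> (Inl x))) x = (\<lambda>x\<in>V. \<psi> (block_of \<sigma> (Inl x))) y"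
      then have "block_of \<sigma> (Inl x) = block_of \<sigma> (Inl y)"
        using inj_mapsD(1)[OF s(3)] b(1) inl by (auto simp: inj_on_eq_iff)
      then show "x = y" using gluing_partitionsD(2)[OF s(2) b(1)] b(2) inl xy by metis
    qed
    moreover have "(\<lambda>x\<in>W. \<psi> (block_of \<sigma> (Inr x))) \<in> inj_maps W N"
      unfolding inj_maps_def
    proof (intro CollectI conjI inj_onI)
      show "(\<lambda>x\<in>W. \<psi> (block_of \<sigma> (Inr x))) \<in> W \<rightarrow>\<^sub>E {1..N}"
        using inj_mapsD(2)[OF s(3) b(1)] inr by (auto simp del: atLeastAtMost_iff)
      fix x y assume xy: "x \<in> W" "y \<in> W" "(\<lambda>x\<in>W. \<psi> (block_of \<sigma> (Inr x))) x = (\<lambda>x\<in>W. \<psi> (block_of \<sigma> (Inr x))) y"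
      then have "block_of \<sigma> (Inr x) = block_of \<sigma> (Inr y)"
        using inj_mapsD(1)[OF s(3)] b(1) inr by (auto simp: inj_on_eq_iff)
      then show "x = y" using gluing_partitionsD(3)[OF s(2) b(1)] b(2) inr xy by metis
    qed
    ultimately show ?thesis by (simp add: G_def s(1))
  qed
  \<comment> \<open>A block is the fibre of the combined labelling through any of its points,
    because \<open>\<psi>\<close> separates blocks. So the pair of labellings determines
    \<open>\<sigma>\<close>, and then also \<open>\<psi>\<close>.\<close>
  have fibre: "block_of \<sigma> x = {y \<in> D. case_sum (fst (G (\<sigma>, \<psi>))) (snd (G (\<sigma>, \<psi>))) y = case_sum (fst (G (\<sigma>, \<psi>))) (snd (G (\<sigma>, \<psi>))) x}"
    and val: "case_sum (fst (G (\<sigma>, \<psi>))) (snd (G (\<sigma>, \<psi>))) x = \<psi> (block_of \<sigma> x)"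
    if s: "\<sigma> \<in> gluing_partitions V W" "\<psi> \<in> inj_maps \<sigma> N" and x: "x \<in> D" for \<sigma> \<psi> x
  proof -
    note P = gluing_partitionsD(1)[OF s(1), folded D_def]
    note b = block_of_in[OF P]
    have v: "case_sum (fst (G (\<sigma>, \<psi>))) (snd (G (\<sigma>, \<psi>))) y = \<psi> (block_of \<sigma> y)" if "y \<in> D" for y
      using that by (cases y) (auto simp: G_def inl inr)
    then show "case_sum (fst (G (\<sigma>, \<psi>))) (snd (G (\<sigma>, \<psi>))) x = \<psi> (block_of \<sigma> x)" using x by blast
    have "y \<in> block_of \<sigma> x \<longleftrightarrow> \<psi> (block_of \<sigma> y) = \<psi> (block_of \<sigma> x)" if "y \<in> D" for y
      using inj_mapsD(1)[OF s(2)] b[OF that] b[OF x] block_of_eq[OF P]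
      by (metis inj_on_eq_iff)
    moreover have "block_of \<sigma> x \<subseteq> D" using b(1)[OF x] partition_onD1[OF P] by blast
    ultimately show "block_of \<sigma> x = {y \<in> D. case_sum (fst (G (\<sigma>, \<psi>))) (snd (G (\<sigma>, \<psi>))) y = case_sum (fst (G (\<sigma>, \<psi>))) (snd (G (\<sigma>, \<psi>))) x}"
      using v x by auto
  qed
  have "bij_betw G ?S (inj_maps V N \<times> inj_maps W N)"
    unfolding bij_betw_def
  proof
    show "inj_on G ?S"
    proof (rule inj_onI, clarify)
      fix \<sigma> \<psi> \<sigma>' \<psi>'
      assume s: "\<sigma> \<in> gluing_partitions V W" "\<psi> \<in> inj_maps \<sigma> N"
        and s': "\<sigma>' \<in> gluing_partitions V W" "\<psi>' \<in> inj_maps \<sigma>' N" and eq: "G (\<sigma>, \<psi>) = G (\<sigma>', \<psi>')"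
      have bl: "block_of \<sigma> x = block_of \<sigma>' x" if "x \<in> D" for x
        using fibre[OF s that] fibre[OF s' that] unfolding eq by simp
      have im: "\<sigma> = block_of \<sigma> ` D" "\<sigma>' = block_of \<sigma>' ` D"
        using image_block_of[OF gluing_partitionsD(1)[OF s(1), folded D_def]]
          image_block_of[OF gluing_partitionsD(1)[OF s'(1), folded D_def]] by simp_all
      then have "\<sigma> = \<sigma>'" using bl by (metis image_cong)
      moreover have "\<psi> = \<psi>'"
      proof
        fix B show "\<psi> B = \<psi>' B"
        proof (cases "B \<in> \<sigma>")
          case True
          then obtain x where "x \<in> D" "B = block_of \<sigma> x" using im(1) by blast
          then show ?thesis using val[OF s] val[OF s'] bl eq by metis
        next
          case False
          then show ?thesis using s(2) s'(2) \<open>\<sigma> = \<sigma>'\<close> by (auto simp: inj_maps_def PiE_def extensional_def)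
        qed
      qed
      ultimately show "\<sigma> = \<sigma>' \<and> \<psi> = \<psi>'" by blast
    qed
    show "G ` ?S = inj_maps V N \<times> inj_maps W N"
    proof (intro equalityI subsetI)
      fix q assume "q \<in> inj_maps V N \<times> inj_maps W N"
      then obtain \<phi>1 \<phi>2 where q: "q = (\<phi>1, \<phi>2)" "\<phi>1 \<in> inj_maps V N" "\<phi>2 \<in> inj_maps W N" by auto
      define \<Phi> where "\<Phi> = case_sum \<phi>1 \<phi>2"
      define fib where "fib x = {y \<in> D. \<Phi> y = \<Phi> x}" for x
      define \<sigma> where "\<sigma> = fib ` D"
      have P: "partition_on D \<sigma>"
        by (rule partition_onI) (auto simp: \<sigma>_def fib_def disjnt_def)
      have bf: "block_of \<sigma> x = fib x" if "x \<in> D" for x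
        using that by (intro block_of_eq[OF P]) (auto simp: \<sigma>_def fib_def)
      have g: "\<sigma> \<in> gluing_partitions V W"
        unfolding gluing_partitions_def
      proof (intro CollectI conjI ballI allI impI)
        show "partition_on (V <+> W) \<sigma>" using P by (simp add: D_def)
        fix B assume "B \<in> \<sigma>"
        then have B: "u \<in> D" "\<Phi> u = \<Phi> v" if "u \<in> B" "v \<in> B" for u v
          using that by (auto simp: \<sigma>_def fib_def)
        show "x = y" if "Inl x \<in> B \<and> Inl y \<in> B" for x y
          using B[of "Inl x" "Inl y"] B[of "Inl y" "Inl x"] that inj_mapsD(1)[OF q(2)]
          by (auto simp: \<Phi>_def inl inj_on_eq_iff)
        show "x = y" if "Inr x \<in> B \<and> Inr y \<in> B" for x y
          using B[of "Inr x" "Inr y"] B[of "Inr y" "Inr x"] that inj_mapsD(1)[OF q(3)]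
          by (auto simp: \<Phi>_def inr inj_on_eq_iff)
      qed
      \<comment> \<open>\<open>\<Phi>\<close> is constant on each fibre, so the choice of the
        representative does not matter.\<close>
      define \<psi> where "\<psi> = (\<lambda>B\<in>\<sigma>. \<Phi> (SOME x. x \<in> B))"
      have pf: "\<psi> (fib x) = \<Phi> x" if x: "x \<in> D" for x
      proof -
        have "x \<in> fib x" using x by (simp add: fib_def)
        then have "(SOME y. y \<in> fib x) \<in> fib x" by (rule someI)
        then show ?thesis using x by (simp add: \<psi>_def \<sigma>_def fib_def)
      qed
      have \<Phi>N: "\<Phi> x \<in> {1..N}" if "x \<in> D" for x
        using that inj_mapsD(2)[OF q(2)] inj_mapsD(2)[OF q(3)]
        by (cases x) (auto simp: \<Phi>_def inl inr simp del: atLeastAtMost_iff)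
      have "\<psi> \<in> inj_maps \<sigma> N"
        unfolding inj_maps_def
      proof (intro CollectI conjI inj_onI)
        show "\<psi> \<in> \<sigma> \<rightarrow>\<^sub>E {1..N}"
        proof (rule PiE_I)
          fix B assume "B \<in> \<sigma>"
          then show "\<psi> B \<in> {1..N}" using pf \<Phi>N by (auto simp: \<sigma>_def simp del: atLeastAtMost_iff)
        qed (simp add: \<psi>_def)
        fix B B' assume "B \<in> \<sigma>" "B' \<in> \<sigma>" "\<psi> B = \<psi> B'"
        then obtain x y where "x \<in> D" "y \<in> D" "B = fib x" "B' = fib y" "\<Phi> x = \<Phi> y"
          using pf by (auto simp: \<sigma>_def)
        then show "B = B'" by (simp add: fib_def)
      qed
      moreover have "G (\<sigma>, \<psi>) = (\<phi>1, \<phi>2)"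
      proof -
        have "(\<lambda>x\<in>V. \<psi> (block_of \<sigma> (Inl x))) = \<phi>1"
        proof
          fix x show "(\<lambda>x\<in>V. \<psi> (block_of \<sigma> (Inl x))) x = \<phi>1 x"
            using bf[of "Inl x"] pf[of "Inl x"] q(2)
            by (cases "x \<in> V") (auto simp: inl \<Phi>_def inj_maps_def PiE_def extensional_def)
        qed
        moreover have "(\<lambda>x\<in>W. \<psi> (block_of \<sigma> (Inr x))) = \<phi>2"
        proof
          fix x show "(\<lambda>x\<in>W. \<psi> (block_of \<sigma> (Inr x))) x = \<phi>2 x"
            using bf[of "Inr x"] pf[of "Inr x"] q(3)
            by (cases "x \<in> W") (auto simp: inr \<Phi>_def inj_maps_def PiE_def extensional_def)
        qed
        ultimately show ?thesis by (simp add: G_def)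
      qed
      ultimately show "q \<in> G ` ?S" using g q(1) by force
    qed (use maps in blast)
  qed
  from sum.reindex_bij_betw[OF this, of "\<lambda>(a, b). f a b"]
  have "(\<Sum>q\<in>inj_maps V N \<times> inj_maps W N. case q of (a, b) \<Rightarrow> f a b) = (\<Sum>s\<in>?S. case G s of (a, b) \<Rightarrow> f a b)"
    by simp
  also have "\<dots> = (\<Sum>\<sigma>\<in>gluing_partitions V W. \<Sum>\<psi>\<in>inj_maps \<sigma> N. case G (\<sigma>, \<psi>) of (a, b) \<Rightarrow> f a b)"
    using finite_gluing_partitions[OF V W] finS by (subst sum.Sigma) (auto intro!: sum.cong)
  finally show ?thesis by (simp add: sum.cartesian_product G_def)
qed


section \<open>The limiting covariance\<close>

lemma walk_reachable:
  assumes "set u \<subseteq> S" "set (cyc u) \<subseteq> R" "x \<in> set u"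
  shows "(hd u, x) \<in> rtrancl_on S R"
proof -
  have n: "u \<noteq> []" using assms(3) by auto
  have "i < length u \<Longrightarrow> (u ! 0, u ! i) \<in> rtrancl_on S R" for i
  proof (induction i)
    case 0
    then show ?case using n assms(1) by (intro rtrancl_on_refl) auto
  next
    case (Suc i)
    have "cyc u ! i = (u ! i, u ! Suc i)" using Suc.prems by (simp add: cyc_def nth_rotate1)
    moreover have "cyc u ! i \<in> set (cyc u)" using Suc.prems by (intro nth_mem) simp
    ultimately have "(u ! i, u ! Suc i) \<in> R" using assms(2) by auto
    then show ?case using Suc assms(1) by (intro rtrancl_on_into_rtrancl_on[OF Suc.IH]) auto
  qed
  then show ?thesis using assms(3) n by (auto simp: in_set_conv_nth hd_conv_nth)
qed

lemma tree_walk_map: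
  assumes "inj_on f (set xs)"
  shows "tree_walk (map f xs) \<longleftrightarrow> tree_walk xs"
  unfolding tree_walk_def cyc_map
  using card_image[OF assms] card_keys_amap[OF assms set_cyc_subset] by simp

locale glued_walks =
  fixes \<pi>1 \<pi>2 :: "nat set set" and \<sigma> :: "(nat set + nat set) set set"
  assumes p1: "\<pi>1 \<in> all_partitions" and p2: "\<pi>2 \<in> all_partitions"
    and common: "\<sigma> \<in> common_edge_gluings (partition_graph \<pi>1) (partition_graph \<pi>2)"
begin

abbreviation "u1 \<equiv> left_word \<sigma> \<pi>1"
abbreviation "u2 \<equiv> right_word \<sigma> \<pi>2"
abbreviation "L \<equiv> glue_arcs \<pi>1 \<pi>2 \<sigma>"
abbreviation "T \<equiv> glue (partition_graph \<pi>1) (partition_graph \<pi>2) \<sigma>"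

lemma gluing: "\<sigma> \<in> gluing_partitions \<pi>1 \<pi>2" and share: "keys (cyc u1) \<inter> keys (cyc u2) \<noteq> {}"
  using common common_edge_iff[OF p1 p2] by auto

lemma fin: "finite \<sigma>"
  using finite_elements[OF _ gluing_partitionsD(1)[OF gluing]] all_partitionsD(4)[OF p1] all_partitionsD(4)[OF p2]
  by simp

lemma words: "set u1 \<union> set u2 = \<sigma>"
  by (rule set_words[OF p1 p2 gluing])

lemma ne: "u1 \<noteq> []" "u2 \<noteq> []"
  using block_word_nonempty[OF p1] block_word_nonempty[OF p2] by (simp_all add: left_word_def right_word_def)

lemma L_subset: "set (cyc u1) \<subseteq> \<sigma> \<times> \<sigma>" "set (cyc u2) \<subseteq> \<sigma> \<times> \<sigma>" "set L \<subseteq> \<sigma> \<times> \<sigma>"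
  using set_cyc_subset[of u1] set_cyc_subset[of u2] words by (auto simp: glue_arcs_def)

lemma keys_L: "keys L = keys (cyc u1) \<union> keys (cyc u2)"
  by (simp add: glue_arcs_def image_Un)

lemma meet: "set u1 \<inter> set u2 \<noteq> {}"
proof -
  obtain p where "p \<in> keys (cyc u1)" "p \<in> keys (cyc u2)" using share by auto
  moreover from this have "p \<noteq> {}" by (auto simp: key_def)
  ultimately show ?thesis using Union_keys_cyc[of u1] Union_keys_cyc[of u2] by blast
qed

text \<open>The first walk satisfies the bound by itself; the second meets it and so adds at least
  as many edges as vertices.\<close>

lemma card_le: "card \<sigma> \<le> card (keys L) + 1"
proof -
  have "card (set u1 \<union> set u2) + card (keys (cyc u1)) \<le> card (set u1) + card (keys (cyc u1) \<union> keys (cyc u2))"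
    using meet Union_keys_cyc[of u1] by (intro closed_walk_card_le_keys) auto
  then show ?thesis using card_walk_le[OF ne(1)] words keys_L by simp
qed

lemma tree_walks:
  assumes "card \<sigma> = card (keys L) + 1"
  shows "tree_walk u1" "tree_walk u2"
proof -
  show "tree_walk u1" using assms meet ne words keys_L by (intro tree_walk_of_union[of u1 u2]) auto
  show "tree_walk u2" using assms meet ne words keys_L
    by (intro tree_walk_of_union[of u2 u1]) (auto simp: Un_commute Int_commute)
qed

lemma tree_no_loop:
  assumes "card \<sigma> = card (keys L) + 1"
  shows "\<forall>e\<in>set L. fst e \<noteq> snd e"
  using tree_walk_loopfree[OF tree_walks(1)[OF assms]] tree_walk_loopfree[OF tree_walks(2)[OF assms]]
  by (auto simp: glue_arcs_def)

lemma tree_mult: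
  assumes "card \<sigma> = card (keys L) + 1"
  shows "\<forall>p\<in>keys L. length (filter (\<lambda>e. key e = p) L) \<ge> 2"
proof
  fix p assume "p \<in> keys L"
  then consider "p \<in> keys (cyc u1)" | "p \<in> keys (cyc u2)" by (auto simp: keys_L)
  then show "length (filter (\<lambda>e. key e = p) L) \<ge> 2"
    using tree_walk_thick[OF tree_walks(1)[OF assms]] tree_walk_thick[OF tree_walks(2)[OF assms]]
    by cases (auto simp: glue_arcs_def trans_le_add1 trans_le_add2)
qed

text \<open>A gluing never merges two vertices of the same graph, so the left walk is an injective
  image of the word of \<open>\<pi>1\<close>, and the tree property passes back. A graph that is not
  a tree therefore has no gluing into a thick tree.\<close>

lemma left_tree:
  assumes "card \<sigma> = card (keys L) + 1"
  shows "tree_walk (block_word \<pi>1)"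
proof -
  have "inj_on (\<lambda>B. block_of \<sigma> (Inl B)) (set (block_word \<pi>1))"
    unfolding set_block_word[OF p1]
  proof (rule inj_onI)
    fix B B' assume B: "B \<in> \<pi>1" "B' \<in> \<pi>1" and eq: "block_of \<sigma> (Inl B) = block_of \<sigma> (Inl B')"
    note P = gluing_partitionsD(1)[OF gluing]
    show "B = B'"
      using gluing_partitionsD(2)[OF gluing, of "block_of \<sigma> (Inl B)" B B']
        block_of_in[OF P, of "Inl B"] block_of_in[OF P, of "Inl B'"] B eq by auto
  qed
  from tree_walk_map[OF this] show ?thesis
    using tree_walks(1)[OF assms] by (simp add: left_word_def)
qed

lemma fin_digraph_glue: "fin_digraph T"
proof
  show "finite (verts T)" using fin by simp
  show "finite (arcs T)" unfolding arcs_glue by simp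
  fix e assume "e \<in> arcs T"
  then have "(tail T e, head T e) \<in> set L" unfolding set_glue_arcs[OF p1 p2] by blast
  then show "tail T e \<in> verts T" "head T e \<in> verts T" using L_subset(3) by auto
qed

text \<open>Both walks pass through a common vertex, from which each of them reaches all of its
  vertices.\<close>

lemma connected_glue: "Digraph_Component.connected T"
proof -
  let ?R = "parcs (mk_symmetric T)"
  have R: "set L \<subseteq> ?R" unfolding set_glue_arcs[OF p1 p2] by (auto simp: mk_symmetric_def)
  have "sym ?R" by (auto simp: mk_symmetric_def intro!: symI)
  then have sy: "sym (rtrancl_on \<sigma> ?R)" by (rule rtrancl_on_sym)
  obtain w where w: "w \<in> set u1" "w \<in> set u2" using meet by auto
  have c: "set (cyc u1) \<subseteq> ?R" "set (cyc u2) \<subseteq> ?R" using R by (auto simp: glue_arcs_def)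
  have s: "set u1 \<subseteq> \<sigma>" "set u2 \<subseteq> \<sigma>" using words by auto
  have "(w, x) \<in> rtrancl_on \<sigma> ?R" if "x \<in> \<sigma>" for x
  proof -
    from that words consider "x \<in> set u1" | "x \<in> set u2" by auto
    then show ?thesis
    proof cases
      case 1
      then show ?thesis
        using walk_reachable[OF s(1) c(1)] w(1) sy by (meson rtrancl_on_trans symD)
    next
      case 2
      then show ?thesis
        using walk_reachable[OF s(2) c(2)] w(2) sy by (meson rtrancl_on_trans symD)
    qed
  qed
  then have "(x, y) \<in> rtrancl_on \<sigma> ?R" if "x \<in> \<sigma>" "y \<in> \<sigma>" for x y
    using that sy by (meson rtrancl_on_trans symD)
  moreover have "\<sigma> \<noteq> {}" using words ne by auto
  ultimately show ?thesis
    unfolding Digraph_Component.connected_def strongly_connected_def reachable_def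
    by (simp add: mk_symmetric_def)
qed

text \<open>Connectedness is automatic for two closed walks that meet, and in the case of equality
  \<open>tree_walk_loopfree\<close> and \<open>tree_walk_thick\<close> supply the conditions on
  loops and multiplicities. What decides is the count of vertices.\<close>

lemma thick_tree_glue: "thick_tree T \<longleftrightarrow> card \<sigma> = card (keys L) + 1"
proof
  assume "thick_tree T"
  then show "card \<sigma> = card (keys L) + 1" by (simp add: thick_tree_def simple_edges_glue[OF p1 p2])
next
  assume tree: "card \<sigma> = card (keys L) + 1"
  interpret fin_digraph T by (rule fin_digraph_glue)
  have nl: "tail T e \<noteq> head T e" if "e \<in> arcs T" for e
    using tree_no_loop[OF tree] that unfolding set_glue_arcs[OF p1 p2] by auto
  have "loopfree_digraph T" by unfold_locales (rule nl)
  moreover have "arc_count T u v + arc_count T v u \<ge> 2" if "{u, v} \<in> simple_edges T" for u v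
  proof -
    have k: "{u, v} \<in> keys L" using that by (simp add: simple_edges_glue[OF p1 p2])
    have "u \<noteq> v"
    proof
      assume "u = v"
      with k obtain e where "e \<in> set L" "key e = {u}" by auto
      then show False using tree_no_loop[OF tree] by (auto simp: key_def)
    qed
    then show ?thesis
      using tree_mult[OF tree] k length_filter_key[of u v L] unfolding arc_count_glue[OF p1 p2] by metis
  qed
  ultimately show "thick_tree T"
    using fin_digraph_glue connected_glue tree unfolding thick_tree_def simple_edges_glue[OF p1 p2] by simp
qed

text \<open>The product over edges is regrouped by the pair of multiplicities:
  \<open>pair_count r T k l\<close> is the size of the fibre over \<open>(k, l)\<close> of the map
  \<open>g\<close>, which records these multiplicities.\<close>

lemma tau_limit_glue:
  assumes r: "linear_order_on \<sigma> r"
  shows "tau_limit C r T = (if card \<sigma> = card (keys L) + 1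
    then \<Prod>(u, v)\<in>oriented_edges r \<sigma> L. C (count_list L (u, v)) (count_list L (v, u)) else 0)"
proof (cases "card \<sigma> = card (keys L) + 1")
  case False
  then show ?thesis using thick_tree_glue by (simp add: tau_limit_def)
next
  case tree: True
  let ?E = "oriented_edges r \<sigma> L"
  define g where "g = (\<lambda>(u, v). (count_list L (u, v), count_list L (v, u)))"
  have finE: "finite ?E"
    by (rule finite_subset[of _ "\<sigma> \<times> \<sigma>"]) (use fin in \<open>auto simp: oriented_edges_def\<close>)
  have ge2: "fst (g x) + snd (g x) \<ge> 2" if "x \<in> ?E" for x
  proof -
    obtain u v where x: "x = (u, v)" by (cases x)
    then have "u \<noteq> v" "{u, v} \<in> keys L" using that by (auto simp: oriented_edges_def)
    moreover from this have "length (filter (\<lambda>e. key e = {u, v}) L) \<ge> 2"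
      by (intro bspec[OF tree_mult[OF tree]])
    ultimately show ?thesis using length_filter_key[of u v L] by (simp add: g_def x)
  qed
  have pc: "pair_count r T k l = card {x \<in> ?E. g x = (k, l)}" if "k + l \<ge> 2" for k l
  proof -
    have "{u, v} \<in> keys L" if "count_list L (u, v) + count_list L (v, u) \<ge> 2" for u v
    proof -
      have "(u, v) \<in> set L \<or> (v, u) \<in> set L"
        using that count_notin[of "(u, v)" L] count_notin[of "(v, u)" L] by fastforce
      then show ?thesis by (force simp: key_def insert_commute)
    qed
    then have "{(u, v). u \<in> verts T \<and> v \<in> verts T \<and> (u, v) \<in> r \<and> u \<noteq> v \<and> arc_count T u v = k \<and> arc_count T v u = l}
        = {x \<in> ?E. g x = (k, l)}"
      using that by (auto simp: arc_count_glue[OF p1 p2] oriented_edges_def g_def)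
    then show ?thesis unfolding pair_count_def by simp
  qed
  have S: "{(k, l). k + l \<ge> 2 \<and> pair_count r T k l \<noteq> 0} = g ` ?E"
  proof (intro equalityI subsetI)
    fix q assume "q \<in> {(k, l). k + l \<ge> 2 \<and> pair_count r T k l \<noteq> 0}"
    then obtain k l where q: "q = (k, l)" "k + l \<ge> 2" "pair_count r T k l \<noteq> 0" by auto
    then have "card {x \<in> ?E. g x = (k, l)} \<noteq> 0" using pc by simp
    then have "{x \<in> ?E. g x = (k, l)} \<noteq> {}" by (metis card.empty)
    then obtain x where "x \<in> ?E" "g x = (k, l)" by blast
    then show "q \<in> g ` ?E" using q(1) by force
  next
    fix q assume "q \<in> g ` ?E"
    then obtain x where x: "x \<in> ?E" "q = g x" by auto
    obtain k l where kl: "g x = (k, l)" by (cases "g x")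
    then have 2: "k + l \<ge> 2" using ge2[OF x(1)] by simp
    have "finite {x \<in> ?E. g x = (k, l)}" using finE by simp
    moreover have "x \<in> {x \<in> ?E. g x = (k, l)}" using x(1) kl by simp
    ultimately have "0 < card {x \<in> ?E. g x = (k, l)}" unfolding card_gt_0_iff by blast
    then show "q \<in> {(k, l). k + l \<ge> 2 \<and> pair_count r T k l \<noteq> 0}"
      unfolding x(2) kl using 2 pc[OF 2] by simp
  qed
  have "(\<Prod>(k, l)\<in>{(k, l). k + l \<ge> 2 \<and> pair_count r T k l \<noteq> 0}. C k l ^ pair_count r T k l)
      = (\<Prod>q\<in>g ` ?E. \<Prod>x\<in>{x \<in> ?E. g x = q}. case g x of (k, l) \<Rightarrow> C k l)"
    unfolding S
  proof (intro prod.cong refl)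
    fix q assume "q \<in> g ` ?E"
    then obtain x where x: "x \<in> ?E" "q = g x" by auto
    obtain k l where k: "q = (k, l)" by (cases q)
    have "k + l \<ge> 2" using ge2[OF x(1)] unfolding x(2)[symmetric] k by simp
    note kl = k this
    have "(\<Prod>x\<in>{x \<in> ?E. g x = q}. case g x of (k, l) \<Rightarrow> C k l) = (\<Prod>x\<in>{x \<in> ?E. g x = q}. C k l)"
      by (intro prod.cong refl) (auto simp: kl)
    then show "(case q of (k, l) \<Rightarrow> C k l ^ pair_count r T k l) = (\<Prod>x\<in>{x \<in> ?E. g x = q}. case g x of (k, l) \<Rightarrow> C k l)"
      by (simp add: kl pc)
  qed
  also have "\<dots> = (\<Prod>x\<in>?E. case g x of (k, l) \<Rightarrow> C k l)"
    by (rule prod.group) (use finE in auto)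
  also have "\<dots> = (\<Prod>(u, v)\<in>?E. C (count_list L (u, v)) (count_list L (v, u)))"
    by (intro prod.cong refl) (auto simp: g_def)
  finally show ?thesis using tree thick_tree_glue by (simp add: tau_limit_def)
qed

end

section \<open>Limits of the covariances of two traces\<close>

context exploding_elliptic_matrices_one
begin

abbreviation arcs_at :: "nat set set \<Rightarrow> (nat set \<Rightarrow> nat) \<Rightarrow> (nat \<times> nat) list" where
  "arcs_at \<pi> \<phi> \<equiv> amap \<phi> (cyc (block_word \<pi>))"

lemma amap_cong_on: "set L \<subseteq> V \<times> V \<Longrightarrow> (\<And>x. x \<in> V \<Longrightarrow> f x = g x) \<Longrightarrow> amap f L = amap g L"
  by (rule map_cong[OF refl]) (auto simp: map_prod_def split: prod.splits)

lemma arcs_at_block: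
  assumes "\<pi> \<in> all_partitions"
  shows "arcs_at \<pi> (\<lambda>B\<in>\<pi>. \<psi> (f B)) = amap \<psi> (cyc (map f (block_word \<pi>)))"
proof -
  have "set (cyc (block_word \<pi>)) \<subseteq> \<pi> \<times> \<pi>"
    using set_cyc_subset[of "block_word \<pi>"] set_block_word[OF assms] by simp
  then have "arcs_at \<pi> (\<lambda>B\<in>\<pi>. \<psi> (f B)) = amap (\<lambda>B. \<psi> (f B)) (cyc (block_word \<pi>))"
    by (rule amap_cong_on) simp
  also have "\<dots> = amap \<psi> (cyc (map f (block_word \<pi>)))"
    unfolding cyc_map by (simp add: map_prod_def comp_def case_prod_unfold)
  finally show ?thesis .
qed

text \<open>The covariance of two fluctuations; the factor 1/N is the product of their
  normalizations \<open>1 / sqrt (real N)\<close>.\<close>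

definition trace_cov :: "nat \<Rightarrow> nat set set \<Rightarrow> nat set set \<Rightarrow> real" where
  "trace_cov N \<pi>1 \<pi>2 =
     (\<Sum>\<phi>1\<in>inj_maps \<pi>1 N. \<Sum>\<phi>2\<in>inj_maps \<pi>2 N. mon_cov N (arcs_at \<pi>1 \<phi>1) (arcs_at \<pi>2 \<phi>2)) / real N"

text \<open>For a gluing without common edge the two monomials are independent, so its contribution
  is exactly 0 at every \<open>N\<close> \<ge> 1. Each remaining gluing falls under
  \<open>glued_limit_tree\<close> or \<open>glued_limit_small\<close>, according to its number of
  vertices.\<close>

lemma trace_cov_limit:
  fixes ord :: "((nat set + nat set) set, nat + nat) pre_digraph \<Rightarrow> (nat set + nat set) set rel"
  assumes p: "\<pi>1 \<in> all_partitions" "\<pi>2 \<in> all_partitions" and ord: "\<And>T. linear_order_on (verts T) (ord T)"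
  shows "(\<lambda>N. trace_cov N \<pi>1 \<pi>2) \<longlonglongrightarrow>
    (\<Sum>\<sigma>\<in>common_edge_gluings (partition_graph \<pi>1) (partition_graph \<pi>2).
       tau_limit C (ord (glue (partition_graph \<pi>1) (partition_graph \<pi>2) \<sigma>)) (glue (partition_graph \<pi>1) (partition_graph \<pi>2) \<sigma>))"
proof -
  let ?G = "gluing_partitions \<pi>1 \<pi>2" and ?E = "common_edge_gluings (partition_graph \<pi>1) (partition_graph \<pi>2)"
  let ?c = "\<lambda>N \<sigma> \<psi>. mon_cov N (amap \<psi> (cyc (left_word \<sigma> \<pi>1))) (amap \<psi> (cyc (right_word \<sigma> \<pi>2)))"
  have fins: "finite \<pi>1" "finite \<pi>2" using all_partitionsD(4) p by auto
  have EG: "?E \<subseteq> ?G" "\<And>\<sigma>. \<sigma> \<in> ?G \<Longrightarrow> \<sigma> \<notin> ?E \<Longrightarrow> keys (cyc (left_word \<sigma> \<pi>1)) \<inter> keys (cyc (right_word \<sigma> \<pi>2)) = {}"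
    using common_edge_iff[OF p] by auto
  have finG: "finite ?G" by (rule finite_gluing_partitions[OF fins])
  have eq: "trace_cov N \<pi>1 \<pi>2 = (\<Sum>\<sigma>\<in>?E. (\<Sum>\<psi>\<in>inj_maps \<sigma> N. ?c N \<sigma> \<psi>) / real N)" if N: "N \<ge> 1" for N
  proof -
    have "(\<Sum>\<phi>1\<in>inj_maps \<pi>1 N. \<Sum>\<phi>2\<in>inj_maps \<pi>2 N. mon_cov N (arcs_at \<pi>1 \<phi>1) (arcs_at \<pi>2 \<phi>2)) =
        (\<Sum>\<sigma>\<in>?G. \<Sum>\<psi>\<in>inj_maps \<sigma> N. ?c N \<sigma> \<psi>)"
      unfolding sum_over_gluings[OF fins] left_word_def right_word_def
      by (intro sum.cong refl arg_cong2[of _ _ _ _ "mon_cov N"] arcs_at_block p)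
    also have "\<dots> = (\<Sum>\<sigma>\<in>?E. \<Sum>\<psi>\<in>inj_maps \<sigma> N. ?c N \<sigma> \<psi>)"
    proof (rule sum.mono_neutral_right[OF finG EG(1)], intro ballI sum.neutral)
      fix \<sigma> \<psi> assume s: "\<sigma> \<in> ?G - ?E" and \<psi>: "\<psi> \<in> inj_maps \<sigma> N"
      have sub: "set (cyc (left_word \<sigma> \<pi>1)) \<subseteq> \<sigma> \<times> \<sigma>" "set (cyc (right_word \<sigma> \<pi>2)) \<subseteq> \<sigma> \<times> \<sigma>"
        using set_cyc_subset[of "left_word \<sigma> \<pi>1"] set_cyc_subset[of "right_word \<sigma> \<pi>2"] set_words[OF p, of \<sigma>] s by auto
      show "?c N \<sigma> \<psi> = 0"
      proof (rule mon_cov_disjoint[OF N])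
        show "keys (amap \<psi> (cyc (left_word \<sigma> \<pi>1))) \<inter> keys (amap \<psi> (cyc (right_word \<sigma> \<pi>2))) = {}"
          using keys_amap_disjoint[OF inj_mapsD(1)[OF \<psi>] sub] EG(2) s by blast
      qed (intro amap_in_box[OF \<psi>] sub)+
    qed
    finally show ?thesis by (simp add: trace_cov_def sum_divide_distrib)
  qed
  have "(\<lambda>N. \<Sum>\<sigma>\<in>?E. (\<Sum>\<psi>\<in>inj_maps \<sigma> N. ?c N \<sigma> \<psi>) / real N) \<longlonglongrightarrow>
    (\<Sum>\<sigma>\<in>?E. tau_limit C (ord (glue (partition_graph \<pi>1) (partition_graph \<pi>2) \<sigma>)) (glue (partition_graph \<pi>1) (partition_graph \<pi>2) \<sigma>))"
  proof (rule tendsto_sum)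
    fix \<sigma> assume "\<sigma> \<in> ?E"
    then interpret glued_walks \<pi>1 \<pi>2 \<sigma> by unfold_locales (use p in auto)
    have r: "linear_order_on \<sigma> (ord T)" using ord[of T] by simp
    have Le: "L = cyc u1 @ cyc u2" by (simp add: glue_arcs_def)
    show "(\<lambda>N. (\<Sum>\<psi>\<in>inj_maps \<sigma> N. ?c N \<sigma> \<psi>) / real N) \<longlonglongrightarrow> tau_limit C (ord T) T"
    proof (cases "card \<sigma> = card (keys L) + 1")
      case True
      then show ?thesis
        using glued_limit_tree[OF fin L_subset(1,2) r share] tree_no_loop[OF True] tree_mult[OF True]
        unfolding tau_limit_glue[OF r] Le by simp
    next
      case False
      then have "card \<sigma> \<le> card (keys (cyc u1 @ cyc u2))" using card_le unfolding Le by simp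
      from glued_limit_small[OF fin L_subset(1,2) this] show ?thesis
        using False unfolding tau_limit_glue[OF r] by simp
    qed
  qed
  then show ?thesis
  proof (rule Lim_transform_eventually)
    show "\<forall>\<^sub>F N in sequentially. (\<Sum>\<sigma>\<in>?E. (\<Sum>\<psi>\<in>inj_maps \<sigma> N. ?c N \<sigma> \<psi>) / real N) = trace_cov N \<pi>1 \<pi>2"
      using eventually_ge_at_top[of 1] by eventually_elim (simp only: eq)
  qed
qed

lemma tau_sum_not_tree:
  fixes ord :: "((nat set + nat set) set, nat + nat) pre_digraph \<Rightarrow> (nat set + nat set) set rel"
  assumes p: "\<pi>1 \<in> all_partitions" "\<pi>2 \<in> all_partitions" and ord: "\<And>T. linear_order_on (verts T) (ord T)"
    and nt: "\<not> tree_walk (block_word \<pi>1)"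
  shows "(\<Sum>\<sigma>\<in>common_edge_gluings (partition_graph \<pi>1) (partition_graph \<pi>2).
       tau_limit C (ord (glue (partition_graph \<pi>1) (partition_graph \<pi>2) \<sigma>)) (glue (partition_graph \<pi>1) (partition_graph \<pi>2) \<sigma>)) = 0"
proof (rule sum.neutral, rule ballI)
  fix \<sigma> assume "\<sigma> \<in> common_edge_gluings (partition_graph \<pi>1) (partition_graph \<pi>2)"
  then interpret glued_walks \<pi>1 \<pi>2 \<sigma> by unfold_locales (use p in auto)
  have "linear_order_on \<sigma> (ord T)" using ord[of T] by simp
  from tau_limit_glue[OF this] show "tau_limit C (ord T) T = 0" using left_tree nt by auto
qed

end


section \<open>Fluctuations of tree-like traces\<close>

lemma finite_words: "finite A \<Longrightarrow> finite {xs. set xs \<subseteq> A \<and> length xs = n}"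
  by (rule finite_lists_length_eq)

text \<open>Each further letter is either one of the boundedly many vertices already present, or one of at
  most \<open>N\<close> new ones, which cost a factor \<open>1 / N\<close>.\<close>

lemma sum_words_le:
  assumes N: "N \<ge> 1" and U: "finite U"
  shows "(\<Sum>xs | set xs \<subseteq> {1..N} \<and> length xs = n. (1 / real N) ^ card (U \<union> set xs))
    \<le> real (1 + card U + n) ^ n * (1 / real N) ^ card U"
proof (induction n)
  case 0
  have "{xs. set xs \<subseteq> {1..N} \<and> length xs = 0} = {[]}" by auto
  then show ?case by simp
next
  case (Suc n)
  let ?q = "1 / real N" and ?A = "{xs. set xs \<subseteq> {1..N} \<and> length xs = n}"
  have q: "0 \<le> ?q" "real N * ?q = 1" using N by auto
  have fA: "finite ?A" by (rule finite_words) simp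
  have "{xs. set xs \<subseteq> {1..N} \<and> length xs = Suc n} = (\<lambda>(xs, x). x # xs) ` (?A \<times> {1..N})"
    by (auto simp: length_Suc_conv image_iff)
  moreover have "inj_on (\<lambda>(xs, x). x # xs) (?A \<times> {1..N})" by (auto simp: inj_on_def)
  ultimately have "(\<Sum>xs | set xs \<subseteq> {1..N} \<and> length xs = Suc n. ?q ^ card (U \<union> set xs))
      = (\<Sum>(xs, x)\<in>?A \<times> {1..N}. ?q ^ card (U \<union> set (x # xs)))"
    by (simp add: sum.reindex case_prod_unfold)
  also have "\<dots> = (\<Sum>xs\<in>?A. \<Sum>x\<in>{1..N}. ?q ^ card (insert x (U \<union> set xs)))"
    using fA by (subst sum.cartesian_product[symmetric]) simp
  also have "\<dots> \<le> (\<Sum>xs\<in>?A. real (1 + card U + n) * ?q ^ card (U \<union> set xs))"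
  proof (rule sum_mono)
    fix xs assume xs: "xs \<in> ?A"
    define W where "W = U \<union> set xs"
    have W: "finite W" using U by (simp add: W_def)
    have cW: "card W \<le> card U + n"
      using card_Un_le[of U "set xs"] card_length[of xs] xs by (simp add: W_def)
    have "(\<Sum>x\<in>{1..N}. ?q ^ card (insert x W)) \<le> (\<Sum>x\<in>{1..N}. (if x \<in> W then ?q ^ card W else 0) + ?q * ?q ^ card W)"
      using W q(1) by (intro sum_mono) (auto simp: insert_absorb)
    also have "\<dots> = real (card ({1..N} \<inter> W)) * ?q ^ card W + real N * ?q * ?q ^ card W"
      by (simp add: sum.distrib sum.If_cases)
    also have "\<dots> \<le> real (card W) * ?q ^ card W + 1 * ?q ^ card W"
      using W unfolding q(2) by (intro add_mono mult_right_mono order_refl) (auto intro: card_mono)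
    also have "\<dots> \<le> real (1 + card U + n) * ?q ^ card W"
      using cW mult_right_mono[of "real (card W + 1)" "real (1 + card U + n)" "?q ^ card W"] by (simp add: algebra_simps)
    finally show "(\<Sum>x\<in>{1..N}. ?q ^ card (insert x (U \<union> set xs))) \<le> real (1 + card U + n) * ?q ^ card (U \<union> set xs)"
      by (simp only: W_def)
  qed
  also have "\<dots> = real (1 + card U + n) * (\<Sum>xs\<in>?A. ?q ^ card (U \<union> set xs))"
    by (simp add: sum_distrib_left)
  also have "\<dots> \<le> real (1 + card U + n) * (real (1 + card U + n) ^ n * ?q ^ card U)"
    by (intro mult_left_mono Suc.IH) simp
  also have "\<dots> = real (1 + card U + n) ^ Suc n * ?q ^ card U" by simp
  also have "\<dots> \<le> real (1 + card U + Suc n) ^ Suc n * ?q ^ card U"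
    by (intro mult_right_mono power_mono) auto
  finally show ?case .
qed

text \<open>A labelling is encoded by the word that it makes of \<open>block_word \<pi>\<close>,
  which loses nothing because that word contains every block; then the sum is enlarged to all words.
  The parameter \<open>D\<close> makes the constant uniform in \<open>U\<close>.\<close>

lemma sum_inj_maps_le:
  assumes N: "N \<ge> 1" and U: "finite U" "card U \<le> D" and \<pi>: "\<pi> \<in> all_partitions"
  shows "(\<Sum>\<phi>\<in>inj_maps \<pi> N. (1 / real N) ^ card (U \<union> \<phi> ` \<pi>))
    \<le> real (1 + D + length (block_word \<pi>)) ^ length (block_word \<pi>) * (1 / real N) ^ card U"
proof -
  let ?n = "length (block_word \<pi>)" and ?q = "1 / real N"
  let ?w = "\<lambda>\<phi>::nat set \<Rightarrow> nat. map \<phi> (block_word \<pi>)"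
  note sw = set_block_word[OF \<pi>]
  have inj: "inj_on ?w (inj_maps \<pi> N)"
  proof (rule inj_onI)
    fix \<phi> \<phi>' assume h: "\<phi> \<in> inj_maps \<pi> N" "\<phi>' \<in> inj_maps \<pi> N" "?w \<phi> = ?w \<phi>'"
    then have "\<phi> x = \<phi>' x" if "x \<in> \<pi>" for x using that sw by auto
    then show "\<phi> = \<phi>'" using h by (intro PiE_ext[of \<phi> \<pi> "\<lambda>_. {1..N}"]) (auto simp: inj_maps_def simp del: atLeastAtMost_iff)
  qed
  have "(\<Sum>\<phi>\<in>inj_maps \<pi> N. ?q ^ card (U \<union> \<phi> ` \<pi>)) = (\<Sum>xs\<in>?w ` inj_maps \<pi> N. ?q ^ card (U \<union> set xs))"
    using sw by (simp add: sum.reindex[OF inj])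
  also have "\<dots> \<le> (\<Sum>xs | set xs \<subseteq> {1..N} \<and> length xs = ?n. ?q ^ card (U \<union> set xs))"
    using inj_mapsD(2)[of _ \<pi> N] sw
    by (intro sum_mono2 finite_words) (auto simp del: atLeastAtMost_iff)
  also have "\<dots> \<le> real (1 + card U + ?n) ^ ?n * ?q ^ card U"
    by (rule sum_words_le[OF N U(1)])
  also have "\<dots> \<le> real (1 + D + ?n) ^ ?n * ?q ^ card U"
    using U(2) by (intro mult_right_mono power_mono) auto
  finally show ?thesis .
qed

text \<open>What is used of connectedness: a connected graph has at most one vertex more than it has edges.\<close>

definition conn :: "'v set \<Rightarrow> 'v set set \<Rightarrow> bool" where
  "conn U F \<longleftrightarrow> finite U \<and> finite F \<and> \<Union>F \<subseteq> U \<and> card U \<le> card F + 1"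

lemma conn_walk: "xs \<noteq> [] \<Longrightarrow> conn (set xs) (keys (cyc xs))"
  using card_walk_le[of xs] Union_keys_cyc[of xs] by (auto simp: conn_def)

text \<open>A shared edge provides a shared vertex, so the new closed walk adds at least as many
  edges as vertices.\<close>

lemma conn_step:
  assumes "conn U F" "keys (cyc xs) \<inter> F \<noteq> {}"
  shows "conn (U \<union> set xs) (F \<union> keys (cyc xs))"
proof -
  obtain p where p: "p \<in> keys (cyc xs)" "p \<in> F" using assms(2) by blast
  then have "p \<noteq> {}" "p \<subseteq> set xs" "p \<subseteq> U"
    using Union_keys_cyc[of xs] assms(1) by (auto simp: key_def conn_def)
  then have "set xs \<inter> U \<noteq> {}" by blast
  then have "card (U \<union> set xs) + card F \<le> card U + card (F \<union> keys (cyc xs))"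
    using assms(1) by (intro closed_walk_card_le_keys) (auto simp: conn_def)
  moreover have "\<Union>(F \<union> keys (cyc xs)) \<subseteq> U \<union> set xs"
    using assms(1) Union_keys_cyc[of xs] by (auto simp: conn_def)
  ultimately show ?thesis using assms(1) by (auto simp: conn_def)
qed

section \<open>Fluctuations as normalized sums of centered monomials\<close>

context exploding_elliptic_matrices_one
begin

lemma arcs_at_cyc: "arcs_at \<pi> \<phi> = cyc (map \<phi> (block_word \<pi>))"
  by (simp add: cyc_map)

lemma arcs_at_box:
  assumes "\<pi> \<in> all_partitions" "\<phi> \<in> inj_maps \<pi> N"
  shows "set (arcs_at \<pi> \<phi>) \<subseteq> box N"
  using set_cyc_subset[of "block_word \<pi>"] set_block_word[OF assms(1)] by (intro amap_in_box[OF assms(2)]) simp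

lemma thick_arcs_at:
  assumes "tree_walk (block_word \<pi>)" "\<phi> \<in> inj_maps \<pi> N" "\<pi> \<in> all_partitions"
  shows "thick (arcs_at \<pi> \<phi>)"
proof -
  have "tree_walk (map \<phi> (block_word \<pi>))"
    using tree_walk_map[of \<phi> "block_word \<pi>"] assms inj_mapsD(1)[OF assms(2)] set_block_word[OF assms(3)] by simp
  then show ?thesis unfolding thick_def arcs_at_cyc using tree_walk_thick by blast
qed

definition fluct :: "nat \<Rightarrow> nat set set \<Rightarrow> 'a \<Rightarrow> real" where
  "fluct N \<pi> \<omega> = (\<Sum>\<phi>\<in>inj_maps \<pi> N. center N (arcs_at \<pi> \<phi>) \<omega>) / sqrt (real N)"

lemma tau_e_eq:
  assumes "\<pi> \<in> all_partitions"
  shows "tau_e (\<lambda>N i j \<omega>. 1 / sqrt (real N) * X N i j \<omega>) N (partition_graph \<pi>) \<omega> =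
    (\<Sum>\<phi>\<in>inj_maps \<pi> N. mon N (arcs_at \<pi> \<phi>) \<omega>) / real N"
proof -
  let ?T = "partition_graph \<pi>" and ?k = "card (\<Union>\<pi>)"
  have "(\<Prod>e\<in>arcs ?T. 1 / sqrt (real N) * X N (\<phi> (tail ?T e)) (\<phi> (head ?T e)) \<omega>) = mon N (arcs_at \<pi> \<phi>) \<omega>" for \<phi>
    unfolding arcs_partition_graph mon_def cyc_block_word[OF assms]
    by (subst prod.distinct_set_conv_list) (simp_all add: entry_def comp_def del: upt_Suc set_upt)
  then show ?thesis by (simp add: tau_e_def inj_maps_def)
qed

lemma fluctuation_eq:
  assumes N: "N \<ge> 1" and \<pi>: "\<pi> \<in> all_partitions"
  shows "fluctuation M (\<lambda>N i j \<omega>. 1 / sqrt (real N) * X N i j \<omega>) N (partition_graph \<pi>) \<omega> = fluct N \<pi> \<omega>"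
proof -
  have s: "sqrt (real N) * (x / real N) = x / sqrt (real N)" for x
  proof -
    have "r * (x / n) = x / r" if "r > 0" "n = r * r" for r n :: real using that by simp
    from this[of "sqrt (real N)" "real N"] show ?thesis using N by simp
  qed
  have "(\<integral>\<omega>'. (\<Sum>\<phi>\<in>inj_maps \<pi> N. mon N (arcs_at \<pi> \<phi>) \<omega>') / real N \<partial>M N) =
      (\<Sum>\<phi>\<in>inj_maps \<pi> N. \<integral>\<omega>'. mon N (arcs_at \<pi> \<phi>) \<omega>' \<partial>M N) / real N"
    using mon_integrable[OF N arcs_at_box[OF \<pi>]] by simp
  note i = this
  show ?thesis
    unfolding fluctuation_def tau_e_eq[OF \<pi>] i diff_divide_distrib[symmetric] s
    by (simp add: fluct_def center_def sum_subtractf)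
qed

lemma center_integrable:
  assumes N: "N \<ge> 1" and L: "set L \<subseteq> box N" "set L' \<subseteq> box N"
  shows "center N L \<in> borel_measurable (M N)" "integrable (M N) (center N L)"
    "integrable (M N) (\<lambda>\<omega>. center N L \<omega> * center N L' \<omega>)" "(\<integral>\<omega>. center N L \<omega> \<partial>M N) = 0"
proof -
  interpret prob_space "M N" by (rule prob_space[OF N])
  have i: "integrable (M N) (mon N L)" "integrable (M N) (mon N L')" "integrable (M N) (\<lambda>\<omega>. mon N L \<omega> * mon N L' \<omega>)"
    using mon_integrable[OF N L(1)] mon_integrable[OF N L(2)] mon_integrable[OF N, of "L @ L'"] L
    by (auto simp: mon_append[abs_def])
  show "center N L \<in> borel_measurable (M N)" "integrable (M N) (center N L)"
    unfolding center_def[abs_def] using i mon_measurable[OF N L(1)] by auto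
  show "integrable (M N) (\<lambda>\<omega>. center N L \<omega> * center N L' \<omega>)"
    unfolding center_def using i by (simp add: algebra_simps)
  show "(\<integral>\<omega>. center N L \<omega> \<partial>M N) = 0"
    unfolding center_def using i by (simp add: prob_space)
qed

lemma fluct_moments:
  assumes N: "N \<ge> 1" and p: "\<pi>1 \<in> all_partitions" "\<pi>2 \<in> all_partitions"
  shows "fluct N \<pi>1 \<in> borel_measurable (M N)" "integrable (M N) (fluct N \<pi>1)" "integrable (M N) (\<lambda>\<omega>. fluct N \<pi>1 \<omega> * fluct N \<pi>2 \<omega>)"
    "(\<integral>\<omega>. fluct N \<pi>1 \<omega> * fluct N \<pi>2 \<omega> \<partial>M N) = trace_cov N \<pi>1 \<pi>2"
proof -
  note c1 = center_integrable[OF N arcs_at_box[OF p(1)] arcs_at_box[OF p(2)]]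
  show "fluct N \<pi>1 \<in> borel_measurable (M N)" "integrable (M N) (fluct N \<pi>1)"
    unfolding fluct_def[abs_def] using c1(1,2) center_integrable[OF N arcs_at_box[OF p(1)] arcs_at_box[OF p(1)]] by auto
  have e: "(\<lambda>\<omega>. fluct N \<pi>1 \<omega> * fluct N \<pi>2 \<omega>) =
    (\<lambda>\<omega>. (\<Sum>\<phi>1\<in>inj_maps \<pi>1 N. \<Sum>\<phi>2\<in>inj_maps \<pi>2 N. center N (arcs_at \<pi>1 \<phi>1) \<omega> * center N (arcs_at \<pi>2 \<phi>2) \<omega>) / real N)"
    using N by (simp add: fluct_def sum_product)
  show "integrable (M N) (\<lambda>\<omega>. fluct N \<pi>1 \<omega> * fluct N \<pi>2 \<omega>)"
    unfolding e using c1(3) by auto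
  show "(\<integral>\<omega>. fluct N \<pi>1 \<omega> * fluct N \<pi>2 \<omega> \<partial>M N) = trace_cov N \<pi>1 \<pi>2"
    unfolding e trace_cov_def mon_cov_def using c1(3) by simp
qed

lemma fluct_comb_second_moment:
  assumes N: "N \<ge> 1" and p: "\<And>i. i \<in> A \<Longrightarrow> e i \<in> all_partitions"
  shows "(\<integral>\<omega>. (\<Sum>i\<in>A. t i * fluct N (e i) \<omega>)\<^sup>2 \<partial>M N) = (\<Sum>i\<in>A. \<Sum>j\<in>A. t i * t j * trace_cov N (e i) (e j))"
    and "integrable (M N) (\<lambda>\<omega>. (\<Sum>i\<in>A. t i * fluct N (e i) \<omega>)\<^sup>2)"
proof -
  have e: "(\<lambda>\<omega>. (\<Sum>i\<in>A. t i * fluct N (e i) \<omega>)\<^sup>2) = (\<lambda>\<omega>. \<Sum>i\<in>A. \<Sum>j\<in>A. (t i * t j) * (fluct N (e i) \<omega> * fluct N (e j) \<omega>))"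
    by (simp add: power2_eq_square sum_product mult_ac)
  show "integrable (M N) (\<lambda>\<omega>. (\<Sum>i\<in>A. t i * fluct N (e i) \<omega>)\<^sup>2)"
    unfolding e using fluct_moments(3)[OF N p p] by auto
  show "(\<integral>\<omega>. (\<Sum>i\<in>A. t i * fluct N (e i) \<omega>)\<^sup>2 \<partial>M N) = (\<Sum>i\<in>A. \<Sum>j\<in>A. t i * t j * trace_cov N (e i) (e j))"
    unfolding e using fluct_moments(3,4)[OF N p p] by simp
qed

end

section \<open>The central limit theorem for combinations of tree-like traces\<close>

locale tree_sums = exploding_elliptic_matrices_one M X C
  for M :: "nat \<Rightarrow> 'a measure" and X C +
  fixes F :: "nat set set set" and t :: "nat set set \<Rightarrow> real"
  assumes finF: "finite F" and FI: "F \<subseteq> all_partitions" and tree: "\<And>\<pi>. \<pi> \<in> F \<Longrightarrow> tree_walk (block_word \<pi>)"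
begin

definition labelled :: "nat \<Rightarrow> (nat set set \<times> (nat set \<Rightarrow> nat)) set" where
  "labelled N = (SIGMA \<pi>:F. inj_maps \<pi> N)"

definition arcs_of :: "nat set set \<times> (nat set \<Rightarrow> nat) \<Rightarrow> (nat \<times> nat) list" where
  "arcs_of i = arcs_at (fst i) (snd i)"

definition walk_of :: "nat set set \<times> (nat set \<Rightarrow> nat) \<Rightarrow> nat list" where
  "walk_of i = map (snd i) (block_word (fst i))"

text \<open>The coefficients of the linear combination are built into the summands, so that joint
  convergence reduces to scalar limits, one for each \<open>t\<close>.\<close>

definition W :: "nat \<Rightarrow> nat set set \<times> (nat set \<Rightarrow> nat) \<Rightarrow> 'a \<Rightarrow> real" where
  "W N i \<omega> = t (fst i) / sqrt (real N) * center N (arcs_of i) \<omega>"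

definition kmax :: nat where
  "kmax = (\<Sum>\<pi>\<in>F. length (block_word \<pi>))"

definition tmax :: real where
  "tmax = (\<Sum>\<pi>\<in>F. \<bar>t \<pi>\<bar>)"

text \<open>The term \<open>3 * kmax\<close> bounds the number of vertices already present when a
  walk is summed out: in a sum over four walks at most three others are still there.\<close>

definition label_bound :: real where
  "label_bound = (\<Sum>\<pi>\<in>F. real (1 + 3 * kmax + length (block_word \<pi>)) ^ length (block_word \<pi>))"

lemma labelledD:
  assumes "i \<in> labelled N"
  shows "fst i \<in> F" "fst i \<in> all_partitions" "snd i \<in> inj_maps (fst i) N"
  using assms FI by (auto simp: labelled_def)

lemma finite_labelled: "finite (labelled N)"
  unfolding labelled_def using finF FI all_partitionsD(4) by (auto intro!: finite_inj_maps)

lemma labelled_props: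
  assumes "i \<in> labelled N"
  shows "set (arcs_of i) \<subseteq> box N" "thick (arcs_of i)" "arcs_of i = cyc (walk_of i)" "length (arcs_of i) \<le> kmax" "walk_of i \<noteq> []"
    "set (walk_of i) = snd i ` fst i" "card (set (walk_of i)) \<le> kmax" "\<bar>t (fst i)\<bar> \<le> tmax" "keys (arcs_of i) \<subseteq> key_space N"
proof -
  note i = labelledD[OF assms]
  show b: "set (arcs_of i) \<subseteq> box N" unfolding arcs_of_def by (rule arcs_at_box[OF i(2,3)])
  show "thick (arcs_of i)" unfolding arcs_of_def by (rule thick_arcs_at[OF tree[OF i(1)] i(3,2)])
  show "arcs_of i = cyc (walk_of i)" unfolding arcs_of_def walk_of_def by (rule arcs_at_cyc)
  have k: "length (block_word (fst i)) \<le> kmax"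
    unfolding kmax_def using i(1) finF by (intro member_le_sum) auto
  then show "length (arcs_of i) \<le> kmax" by (simp add: arcs_of_def)
  show "walk_of i \<noteq> []" using block_word_nonempty[OF i(2)] by (simp add: walk_of_def)
  show "set (walk_of i) = snd i ` fst i" using set_block_word[OF i(2)] by (simp add: walk_of_def)
  show "card (set (walk_of i)) \<le> kmax" using card_length[of "walk_of i"] k by (simp add: walk_of_def)
  show "\<bar>t (fst i)\<bar> \<le> tmax" unfolding tmax_def using i(1) finF by (intro member_le_sum) auto
  show "keys (arcs_of i) \<subseteq> key_space N" by (rule keys_in_key_space[OF b])
qed

lemma sum_labelled_le:
  assumes N: "N \<ge> 1" and U: "finite U" "card U \<le> 3 * kmax"
  shows "(\<Sum>i\<in>labelled N. (1 / real N) ^ card (U \<union> set (walk_of i))) \<le> label_bound * (1 / real N) ^ card U"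
proof -
  have "(\<Sum>i\<in>labelled N. (1 / real N) ^ card (U \<union> set (walk_of i))) = (\<Sum>i\<in>labelled N. (1 / real N) ^ card (U \<union> snd i ` fst i))"
    by (intro sum.cong refl) (simp add: labelled_props(6))
  also have "\<dots> = (\<Sum>\<pi>\<in>F. \<Sum>\<phi>\<in>inj_maps \<pi> N. (1 / real N) ^ card (U \<union> \<phi> ` \<pi>))"
    unfolding labelled_def using finF FI all_partitionsD(4)
    by (subst sum.Sigma) (auto intro!: finite_inj_maps sum.cong)
  also have "\<dots> \<le> (\<Sum>\<pi>\<in>F. real (1 + 3 * kmax + length (block_word \<pi>)) ^ length (block_word \<pi>) * (1 / real N) ^ card U)"
    using FI by (intro sum_mono sum_inj_maps_le N U) auto
  also have "\<dots> = label_bound * (1 / real N) ^ card U" by (simp add: label_bound_def sum_distrib_right)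
  finally show ?thesis .
qed

lemma label_bound_nonneg: "0 \<le> label_bound"
  unfolding label_bound_def by (intro sum_nonneg) auto

lemma tmax_nonneg: "0 \<le> tmax"
  unfolding tmax_def by (intro sum_nonneg) auto

text \<open>The walks are summed out from the last to the first. Each sum costs one constant
  \<open>label_bound\<close> and reduces the exponent to the vertices of the walks that remain,
  until none is left.\<close>

lemma sum_labelled3_le:
  assumes N: "N \<ge> 1"
  shows "(\<Sum>i\<in>labelled N. \<Sum>j\<in>labelled N. \<Sum>k\<in>labelled N. (1 / real N) ^ card (set (walk_of i) \<union> set (walk_of j) \<union> set (walk_of k))) \<le> label_bound ^ 3"
proof -
  let ?q = "1 / real N" and ?V = "\<lambda>i. set (walk_of i)"
  have "(\<Sum>i\<in>labelled N. \<Sum>j\<in>labelled N. \<Sum>k\<in>labelled N. ?q ^ card (?V i \<union> ?V j \<union> ?V k))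
      \<le> (\<Sum>i\<in>labelled N. \<Sum>j\<in>labelled N. label_bound * ?q ^ card (?V i \<union> ?V j))"
  proof (intro sum_mono sum_labelled_le[OF N])
    fix i j assume "i \<in> labelled N" "j \<in> labelled N"
    then show "card (?V i \<union> ?V j) \<le> 3 * kmax"
      using card_Un_le[of "?V i" "?V j"] labelled_props(7)[of i N] labelled_props(7)[of j N] by linarith
  qed simp
  also have "\<dots> = label_bound * (\<Sum>i\<in>labelled N. \<Sum>j\<in>labelled N. ?q ^ card (?V i \<union> ?V j))" by (simp add: sum_distrib_left)
  also have "\<dots> \<le> label_bound * (\<Sum>i\<in>labelled N. label_bound * ?q ^ card (?V i))"
  proof (intro mult_left_mono sum_mono sum_labelled_le[OF N] label_bound_nonneg)
    fix i assume "i \<in> labelled N"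
    then show "card (?V i) \<le> 3 * kmax" using labelled_props(7)[of i N] by linarith
  qed simp
  also have "\<dots> = label_bound * label_bound * (\<Sum>i\<in>labelled N. ?q ^ card ({} \<union> ?V i))" by (simp add: sum_distrib_left mult.assoc)
  also have "\<dots> \<le> label_bound * label_bound * (label_bound * ?q ^ card ({} :: nat set))"
    by (intro mult_left_mono sum_labelled_le[OF N] mult_nonneg_nonneg label_bound_nonneg) auto
  also have "\<dots> = label_bound ^ 3" by (simp add: power3_eq_cube)
  finally show ?thesis .
qed

lemma sum_labelled4_le:
  assumes N: "N \<ge> 1"
  shows "(\<Sum>i\<in>labelled N. \<Sum>j\<in>labelled N. \<Sum>k\<in>labelled N. \<Sum>l\<in>labelled N.
    (1 / real N) ^ card (set (walk_of i) \<union> set (walk_of j) \<union> set (walk_of k) \<union> set (walk_of l))) \<le> label_bound ^ 4"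
proof -
  let ?q = "1 / real N" and ?V = "\<lambda>i. set (walk_of i)"
  have "(\<Sum>i\<in>labelled N. \<Sum>j\<in>labelled N. \<Sum>k\<in>labelled N. \<Sum>l\<in>labelled N. ?q ^ card (?V i \<union> ?V j \<union> ?V k \<union> ?V l))
      \<le> (\<Sum>i\<in>labelled N. \<Sum>j\<in>labelled N. \<Sum>k\<in>labelled N. label_bound * ?q ^ card (?V i \<union> ?V j \<union> ?V k))"
  proof (intro sum_mono sum_labelled_le[OF N])
    fix i j k assume "i \<in> labelled N" "j \<in> labelled N" "k \<in> labelled N"
    then show "card (?V i \<union> ?V j \<union> ?V k) \<le> 3 * kmax"
      using card_Un_le[of "?V i \<union> ?V j" "?V k"] card_Un_le[of "?V i" "?V j"]
        labelled_props(7)[of i N] labelled_props(7)[of j N] labelled_props(7)[of k N] by linarith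
  qed simp
  also have "\<dots> = label_bound * (\<Sum>i\<in>labelled N. \<Sum>j\<in>labelled N. \<Sum>k\<in>labelled N. ?q ^ card (?V i \<union> ?V j \<union> ?V k))"
    by (simp add: sum_distrib_left)
  also have "\<dots> \<le> label_bound * label_bound ^ 3"
    by (intro mult_left_mono sum_labelled3_le N label_bound_nonneg)
  also have "\<dots> = label_bound ^ 4" by (simp add: power3_eq_cube power4_eq_xxxx)
  finally show ?thesis .
qed

definition share_edge :: "nat set set \<times> (nat set \<Rightarrow> nat) \<Rightarrow> nat set set \<times> (nat set \<Rightarrow> nat) \<Rightarrow> bool" where
  "share_edge i j \<longleftrightarrow> keys (arcs_of i) \<inter> keys (arcs_of j) \<noteq> {}"

text \<open>Moments are bounded in terms of edges, labellings are counted by vertices; this converts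
  the one into the other. The price is a single factor N, paid once per connected
  configuration.\<close>

lemma q_conn:
  assumes N: "N \<ge> 1" and c: "conn U K"
  shows "(1 / real N) ^ card K \<le> real N * (1 / real N) ^ card U"
proof -
  have "(1 / real N) ^ card K = real N * (1 / real N) ^ (card K + 1)" using N by simp
  also have "\<dots> \<le> real N * (1 / real N) ^ card U"
    using N c by (intro mult_left_mono power_decreasing) (auto simp: conn_def)
  finally show ?thesis .
qed

lemma W_L4:
  assumes N: "N \<ge> 1" and i: "i \<in> labelled N"
  shows "L4 (M N) (W N i)"
proof -
  note a = labelled_props[OF i]
  obtain c where "\<forall>N\<ge>1. \<forall>Ls. (\<forall>L\<in>set Ls. set L \<subseteq> box N \<and> thick L) \<longrightarrow> length Ls \<le> 4 \<longrightarrow> sum_list (map length Ls) \<le> 4 * kmax \<longrightarrow>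
    integrable (M N) (\<lambda>\<omega>. \<Prod>L\<leftarrow>Ls. center N L \<omega>) \<and>
    (\<integral>\<omega>. \<bar>\<Prod>L\<leftarrow>Ls. center N L \<omega>\<bar> \<partial>M N) \<le> c / real N ^ card (\<Union>L\<in>set Ls. keys L)"
    using center_prod_bound[of 4 "4 * kmax"] by blast
  from this[rule_format, OF N, of "[arcs_of i, arcs_of i, arcs_of i, arcs_of i]"]
  have "integrable (M N) (\<lambda>\<omega>. center N (arcs_of i) \<omega> ^ 4)"
    using a by (simp add: power4_eq_xxxx mult.assoc)
  then have "L4 (M N) (center N (arcs_of i))"
    using center_integrable(1)[OF N a(1) a(1)] by (simp add: L4_def)
  then show ?thesis unfolding W_def[abs_def] by (rule L4_cmult)
qed

lemma W_determined:
  assumes N: "N \<ge> 1" and i: "i \<in> labelled N"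
  shows "determined N (keys (arcs_of i)) (W N i)"
proof -
  note a = labelled_props[OF i]
  have 1: "determined N (keys (arcs_of i)) (mon N (arcs_of i))" by (intro determined_mon a order_refl)
  have "(\<lambda>x. t (fst i) / sqrt (real N) * (x - (\<integral>\<omega>'. mon N (arcs_of i) \<omega>' \<partial>M N))) \<in> borel_measurable borel" by measurable
  from determined_compose[OF 1 this] show ?thesis by (simp add: W_def[abs_def] center_def)
qed

lemma W_mean:
  assumes N: "N \<ge> 1" and i: "i \<in> labelled N"
  shows "(\<integral>\<omega>. W N i \<omega> \<partial>M N) = 0" "integrable (M N) (W N i)"
  unfolding W_def[abs_def]
  using center_integrable[OF N labelled_props(1)[OF i] labelled_props(1)[OF i]] by simp_all

text \<open>Independence is required from the whole sum at once, not from each summand separately.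
  It holds because that sum is determined by the edges outside
  \<open>keys (arcs_of i)\<close>.\<close>

lemma W_stein:
  assumes N: "N \<ge> 1" and i: "i \<in> labelled N"
  shows "(\<integral>\<omega>. W N i \<omega> * iexp (s * (\<Sum>j\<in>{j\<in>labelled N. \<not> share_edge i j}. W N j \<omega>)) \<partial>M N) = 0"
proof -
  interpret prob_space "M N" by (rule prob_space[OF N])
  let ?S = "\<lambda>\<omega>. \<Sum>j\<in>{j\<in>labelled N. \<not> share_edge i j}. W N j \<omega>"
  let ?K = "key_space N - keys (arcs_of i)"
  have S: "determined N ?K ?S"
  proof (rule determined_sum)
    fix j assume j: "j \<in> {j\<in>labelled N. \<not> share_edge i j}"
    then have j': "j \<in> labelled N" by simp
    have "keys (arcs_of j) \<subseteq> ?K" using labelled_props(9)[OF j'] j unfolding share_edge_def by blast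
    then show "determined N ?K (W N j)" by (rule determined_mono[OF W_determined[OF N j']]) blast
  qed blast
  have m1: "(\<lambda>x. complex_of_real x) \<in> borel_measurable borel" and m2: "(\<lambda>x. iexp (s * x)) \<in> borel_measurable borel"
    by measurable
  have "indep_var borel (\<lambda>\<omega>. complex_of_real (W N i \<omega>)) borel (\<lambda>\<omega>. iexp (s * ?S \<omega>))"
    by (rule determined_indep[OF N determined_compose[OF W_determined[OF N i] m1] determined_compose[OF S m2]]) auto
  moreover have "integrable (M N) (\<lambda>\<omega>. complex_of_real (W N i \<omega>))" using W_mean[OF N i] by simp
  moreover have "integrable (M N) (\<lambda>\<omega>. iexp (s * ?S \<omega>))"
    using L4_measurable[OF W_L4[OF N]] by (intro integrable_iexp) auto
  ultimately have "(\<integral>\<omega>. W N i \<omega> * iexp (s * ?S \<omega>) \<partial>M N) = (\<integral>\<omega>. complex_of_real (W N i \<omega>) \<partial>M N) * (\<integral>\<omega>. iexp (s * ?S \<omega>) \<partial>M N)"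
    by (rule indep_var_lebesgue_integral)
  also have "(\<integral>\<omega>. complex_of_real (W N i \<omega>) \<partial>M N) = 0" using W_mean[OF N i] by simp
  finally show ?thesis by (simp only: mult_zero_left)
qed

lemma W_uncorrelated:
  assumes N: "N \<ge> 1" and ij: "i \<in> labelled N" "j \<in> labelled N" "\<not> share_edge i j"
  shows "(\<integral>\<omega>. W N i \<omega> * W N j \<omega> \<partial>M N) = 0"
proof -
  have "(\<integral>\<omega>. W N i \<omega> * W N j \<omega> \<partial>M N) = (\<integral>\<omega>. (t (fst i) / sqrt (real N) * (t (fst j) / sqrt (real N))) * (center N (arcs_of i) \<omega> * center N (arcs_of j) \<omega>) \<partial>M N)"
    by (intro Bochner_Integration.integral_cong refl) (simp add: W_def)
  also have "\<dots> = (t (fst i) / sqrt (real N) * (t (fst j) / sqrt (real N))) * mon_cov N (arcs_of i) (arcs_of j)"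
    unfolding mon_cov_def by (rule integral_mult_right_zero)
  also have "mon_cov N (arcs_of i) (arcs_of j) = 0"
    using ij by (intro mon_cov_disjoint N labelled_props(1)) (auto simp: share_edge_def)
  finally show ?thesis by simp
qed

lemma W_sum: "(\<Sum>i\<in>labelled N. W N i \<omega>) = (\<Sum>\<pi>\<in>F. t \<pi> * fluct N \<pi> \<omega>)"
proof -
  have "(\<Sum>i\<in>labelled N. W N i \<omega>) = (\<Sum>\<pi>\<in>F. \<Sum>\<phi>\<in>inj_maps \<pi> N. W N (\<pi>, \<phi>) \<omega>)"
    unfolding labelled_def using finF FI all_partitionsD(4)
    by (subst sum.Sigma) (auto intro!: finite_inj_maps sum.cong)
  then show ?thesis by (simp add: W_def fluct_def arcs_of_def sum_distrib_left sum_divide_distrib)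
qed

lemma coef_le:
  assumes "i \<in> labelled N"
  shows "\<bar>t (fst i) / sqrt (real N)\<bar> \<le> tmax / sqrt (real N)"
  using labelled_props(8)[OF assms] by (simp add: divide_right_mono)

text \<open>Stated for lists, so that one constant serves products of two, three and four
  summands.\<close>

lemma center_products_bound:
  "\<exists>c\<ge>1. \<forall>N\<ge>1. \<forall>is. set is \<subseteq> labelled N \<longrightarrow> length is \<le> 4 \<longrightarrow>
    (\<integral>\<omega>. \<bar>\<Prod>i\<leftarrow>is. W N i \<omega>\<bar> \<partial>M N) \<le> c * (tmax / sqrt (real N)) ^ length is * (1 / real N) ^ card (\<Union>i\<in>set is. keys (arcs_of i))"
proof -
  obtain c where c: "c \<ge> 1" "\<forall>N\<ge>1. \<forall>Ls. (\<forall>L\<in>set Ls. set L \<subseteq> box N \<and> thick L) \<longrightarrow> length Ls \<le> 4 \<longrightarrow> sum_list (map length Ls) \<le> 4 * kmax \<longrightarrow>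
    integrable (M N) (\<lambda>\<omega>. \<Prod>L\<leftarrow>Ls. center N L \<omega>) \<and>
    (\<integral>\<omega>. \<bar>\<Prod>L\<leftarrow>Ls. center N L \<omega>\<bar> \<partial>M N) \<le> c / real N ^ card (\<Union>L\<in>set Ls. keys L)"
    using center_prod_bound[of 4 "4 * kmax"] by blast
  have "(\<integral>\<omega>. \<bar>\<Prod>i\<leftarrow>is. W N i \<omega>\<bar> \<partial>M N) \<le> c * (tmax / sqrt (real N)) ^ length is * (1 / real N) ^ card (\<Union>i\<in>set is. keys (arcs_of i))"
    if N: "N \<ge> 1" and s: "set is \<subseteq> labelled N" "length is \<le> 4" for N "is"
  proof -
    let ?P = "\<lambda>\<omega>. \<Prod>L\<leftarrow>map arcs_of is. center N L \<omega>"
    have len: "sum_list (map length (map arcs_of is)) \<le> length is * kmax"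
      using s(1) by (induction "is") (auto intro!: add_mono labelled_props(4))
    also have "\<dots> \<le> 4 * kmax" using s(2) by simp
    finally have h: "integrable (M N) ?P \<and> (\<integral>\<omega>. \<bar>?P \<omega>\<bar> \<partial>M N) \<le> c / real N ^ card (\<Union>L\<in>set (map arcs_of is). keys L)"
    proof (intro c(2)[rule_format, OF N] conjI)
      fix L assume "L \<in> set (map arcs_of is)"
      then obtain i where "i \<in> labelled N" "L = arcs_of i" using s(1) by auto
      then show "set L \<subseteq> box N" "thick L" using labelled_props(1,2) by blast+
    qed (use s in simp_all)
    have W: "\<bar>\<Prod>i\<leftarrow>is. W N i \<omega>\<bar> \<le> (tmax / sqrt (real N)) ^ length is * \<bar>?P \<omega>\<bar>" for \<omega>
      using s(1)
    proof (induction "is")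
      case (Cons i js)
      have "\<bar>W N i \<omega>\<bar> \<le> tmax / sqrt (real N) * \<bar>center N (arcs_of i) \<omega>\<bar>"
        unfolding W_def abs_mult using coef_le Cons.prems by (intro mult_right_mono) auto
      then have "\<bar>W N i \<omega>\<bar> * \<bar>\<Prod>i\<leftarrow>js. W N i \<omega>\<bar> \<le> (tmax / sqrt (real N) * \<bar>center N (arcs_of i) \<omega>\<bar>) *
          ((tmax / sqrt (real N)) ^ length js * \<bar>\<Prod>L\<leftarrow>map arcs_of js. center N L \<omega>\<bar>)"
        using Cons tmax_nonneg by (intro mult_mono) auto
      then show ?case by (simp add: abs_mult mult_ac)
    qed simp
    have meas: "(\<lambda>\<omega>. \<Prod>i\<leftarrow>is. W N i \<omega>) \<in> borel_measurable (M N)"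
      using s(1)
    proof (induction "is")
      case (Cons i js)
      then show ?case using L4_measurable[OF W_L4[OF N]] by auto
    qed simp
    have int: "integrable (M N) (\<lambda>\<omega>. (tmax / sqrt (real N)) ^ length is * \<bar>?P \<omega>\<bar>)" using h by auto
    have "(\<integral>\<omega>. \<bar>\<Prod>i\<leftarrow>is. W N i \<omega>\<bar> \<partial>M N) \<le> (\<integral>\<omega>. (tmax / sqrt (real N)) ^ length is * \<bar>?P \<omega>\<bar> \<partial>M N)"
    proof (rule integral_mono[OF _ int W])
      show "integrable (M N) (\<lambda>\<omega>. \<bar>\<Prod>i\<leftarrow>is. W N i \<omega>\<bar>)"
        by (rule Bochner_Integration.integrable_bound[OF int])
           (use meas in simp, intro AE_I2, unfold real_norm_def abs_idempotent, rule order_trans[OF W abs_ge_self])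
    qed
    also have "\<dots> = (tmax / sqrt (real N)) ^ length is * (\<integral>\<omega>. \<bar>?P \<omega>\<bar> \<partial>M N)" by (rule integral_mult_right_zero)
    also have "\<dots> \<le> (tmax / sqrt (real N)) ^ length is * (c / real N ^ card (\<Union>L\<in>set (map arcs_of is). keys L))"
      using h tmax_nonneg by (intro mult_left_mono) auto
    finally show ?thesis by (simp add: power_one_over mult_ac)
  qed
  with c(1) show ?thesis by blast
qed

lemma connected3:
  assumes "i \<in> labelled N" "j \<in> labelled N" "k \<in> labelled N" "share_edge i j" "share_edge i k"
  shows "conn (set (walk_of i) \<union> set (walk_of j) \<union> set (walk_of k)) (keys (arcs_of i) \<union> keys (arcs_of j) \<union> keys (arcs_of k))"
proof -
  have arcs_of: "arcs_of i = cyc (walk_of i)" "arcs_of j = cyc (walk_of j)" "arcs_of k = cyc (walk_of k)"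
    using assms labelled_props(3) by auto
  have c1: "conn (set (walk_of i)) (keys (cyc (walk_of i)))" using labelled_props(5)[OF assms(1)] by (rule conn_walk)
  have c2: "conn (set (walk_of i) \<union> set (walk_of j)) (keys (cyc (walk_of i)) \<union> keys (cyc (walk_of j)))"
    using assms(4) unfolding share_edge_def arcs_of by (intro conn_step[OF c1]) blast
  have "conn (set (walk_of i) \<union> set (walk_of j) \<union> set (walk_of k)) (keys (cyc (walk_of i)) \<union> keys (cyc (walk_of j)) \<union> keys (cyc (walk_of k)))"
    using assms(5) unfolding share_edge_def arcs_of by (intro conn_step[OF c2]) blast
  then show ?thesis unfolding arcs_of .
qed

text \<open>The two pairs meet in an edge of \<open>k\<close> or of \<open>l\<close>. The walk that
  has this edge is attached first, and the other one follows through the edge that \<open>k\<close>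
  and \<open>l\<close> share.\<close>

lemma connected4:
  assumes ix: "i \<in> labelled N" "j \<in> labelled N" "k \<in> labelled N" "l \<in> labelled N" and r: "share_edge i j" "share_edge k l"
    and m: "(keys (arcs_of i) \<union> keys (arcs_of j)) \<inter> (keys (arcs_of k) \<union> keys (arcs_of l)) \<noteq> {}"
  shows "conn (set (walk_of i) \<union> set (walk_of j) \<union> set (walk_of k) \<union> set (walk_of l)) (keys (arcs_of i) \<union> keys (arcs_of j) \<union> keys (arcs_of k) \<union> keys (arcs_of l))"
proof -
  have arcs_of: "arcs_of i = cyc (walk_of i)" "arcs_of j = cyc (walk_of j)" "arcs_of k = cyc (walk_of k)" "arcs_of l = cyc (walk_of l)"
    using ix labelled_props(3) by auto
  have c1: "conn (set (walk_of i)) (keys (cyc (walk_of i)))" using labelled_props(5)[OF ix(1)] by (rule conn_walk)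
  have ij: "conn (set (walk_of i) \<union> set (walk_of j)) (keys (cyc (walk_of i)) \<union> keys (cyc (walk_of j)))"
    using r(1) unfolding share_edge_def arcs_of by (intro conn_step[OF c1]) blast
  have kl: "keys (cyc (walk_of l)) \<inter> keys (cyc (walk_of k)) \<noteq> {}" using r(2) unfolding share_edge_def arcs_of by blast
  consider "keys (cyc (walk_of k)) \<inter> (keys (cyc (walk_of i)) \<union> keys (cyc (walk_of j))) \<noteq> {}"
    | "keys (cyc (walk_of l)) \<inter> (keys (cyc (walk_of i)) \<union> keys (cyc (walk_of j))) \<noteq> {}"
    using m unfolding arcs_of by blast
  then show ?thesis
  proof cases
    case 1
    from conn_step[OF ij 1] have "conn (set (walk_of i) \<union> set (walk_of j) \<union> set (walk_of k) \<union> set (walk_of l))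
        (keys (cyc (walk_of i)) \<union> keys (cyc (walk_of j)) \<union> keys (cyc (walk_of k)) \<union> keys (cyc (walk_of l)))"
      by (rule conn_step) (use kl in blast)
    then show ?thesis unfolding arcs_of .
  next
    case 2
    from conn_step[OF ij 2] have "conn (set (walk_of i) \<union> set (walk_of j) \<union> set (walk_of l) \<union> set (walk_of k))
        (keys (cyc (walk_of i)) \<union> keys (cyc (walk_of j)) \<union> keys (cyc (walk_of l)) \<union> keys (cyc (walk_of k)))"
      by (rule conn_step) (use kl in blast)
    moreover have "set (walk_of i) \<union> set (walk_of j) \<union> set (walk_of l) \<union> set (walk_of k) = set (walk_of i) \<union> set (walk_of j) \<union> set (walk_of k) \<union> set (walk_of l)"
      "keys (cyc (walk_of i)) \<union> keys (cyc (walk_of j)) \<union> keys (cyc (walk_of l)) \<union> keys (cyc (walk_of k)) =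
       keys (cyc (walk_of i)) \<union> keys (cyc (walk_of j)) \<union> keys (cyc (walk_of k)) \<union> keys (cyc (walk_of l))" by (simp_all add: Un_ac)
    ultimately show ?thesis unfolding arcs_of by (simp only:)
  qed
qed

lemma third_moments:
  "(\<lambda>N. \<Sum>i\<in>labelled N. \<Sum>j\<in>{j\<in>labelled N. share_edge i j}. \<Sum>k\<in>{k\<in>labelled N. share_edge i k}.
      (\<integral>\<omega>. \<bar>W N i \<omega> * W N j \<omega> * W N k \<omega>\<bar> \<partial>M N)) \<longlonglongrightarrow> 0"
proof -
  obtain c where c: "c \<ge> 1" "\<forall>N\<ge>1. \<forall>is. set is \<subseteq> labelled N \<longrightarrow> length is \<le> 4 \<longrightarrow>
    (\<integral>\<omega>. \<bar>\<Prod>i\<leftarrow>is. W N i \<omega>\<bar> \<partial>M N) \<le> c * (tmax / sqrt (real N)) ^ length is * (1 / real N) ^ card (\<Union>i\<in>set is. keys (arcs_of i))"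
    using center_products_bound by blast
  let ?B = "\<lambda>N. c * tmax ^ 3 * label_bound ^ 3 * inverse (sqrt (real N))"
  have bound: "(\<Sum>i\<in>labelled N. \<Sum>j\<in>{j\<in>labelled N. share_edge i j}. \<Sum>k\<in>{k\<in>labelled N. share_edge i k}.
      (\<integral>\<omega>. \<bar>W N i \<omega> * W N j \<omega> * W N k \<omega>\<bar> \<partial>M N)) \<le> ?B N" if N: "N \<ge> 1" for N
  proof -
    let ?V = "\<lambda>i j k. set (walk_of i) \<union> set (walk_of j) \<union> set (walk_of k)"
    \<comment> \<open>N^(-3/2) from the three normalizations times the N of \<open>q_conn\<close>:
      altogether N^(-1/2).\<close>
    let ?C = "c * (tmax / sqrt (real N)) ^ 3 * real N"
    have C0: "0 \<le> ?C" using c(1) tmax_nonneg by simp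
    have "(\<Sum>i\<in>labelled N. \<Sum>j\<in>{j\<in>labelled N. share_edge i j}. \<Sum>k\<in>{k\<in>labelled N. share_edge i k}. (\<integral>\<omega>. \<bar>W N i \<omega> * W N j \<omega> * W N k \<omega>\<bar> \<partial>M N))
      \<le> (\<Sum>i\<in>labelled N. \<Sum>j\<in>{j\<in>labelled N. share_edge i j}. \<Sum>k\<in>{k\<in>labelled N. share_edge i k}. ?C * (1 / real N) ^ card (?V i j k))"
    proof (intro sum_mono)
      fix i j k assume h: "i \<in> labelled N" "j \<in> {j\<in>labelled N. share_edge i j}" "k \<in> {k\<in>labelled N. share_edge i k}"
      have "(\<integral>\<omega>. \<bar>W N i \<omega> * W N j \<omega> * W N k \<omega>\<bar> \<partial>M N) \<le> c * (tmax / sqrt (real N)) ^ 3 * (1 / real N) ^ card (keys (arcs_of i) \<union> keys (arcs_of j) \<union> keys (arcs_of k))"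
        using c(2)[rule_format, OF N, of "[i, j, k]"] h by (simp add: mult.assoc Un_assoc eval_nat_numeral)
      also have "\<dots> \<le> c * (tmax / sqrt (real N)) ^ 3 * (real N * (1 / real N) ^ card (?V i j k))"
        using c(1) tmax_nonneg h by (intro mult_left_mono q_conn[OF N] connected3) auto
      finally show "(\<integral>\<omega>. \<bar>W N i \<omega> * W N j \<omega> * W N k \<omega>\<bar> \<partial>M N) \<le> ?C * (1 / real N) ^ card (?V i j k)"
        by (simp only: mult.assoc)
    qed
    \<comment> \<open>The restriction to shared edges has done its work in establishing
      connectedness; dropping it now only adds nonnegative terms.\<close>
    also have "\<dots> \<le> (\<Sum>i\<in>labelled N. \<Sum>j\<in>labelled N. \<Sum>k\<in>labelled N. ?C * (1 / real N) ^ card (?V i j k))"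
    proof (rule sum_mono, rule order_trans[OF sum_mono sum_mono2])
      fix i j
      show "(\<Sum>k\<in>{k\<in>labelled N. share_edge i k}. ?C * (1 / real N) ^ card (?V i j k)) \<le> (\<Sum>k\<in>labelled N. ?C * (1 / real N) ^ card (?V i j k))"
        using C0 finite_labelled by (intro sum_mono2) auto
    qed (use C0 finite_labelled in \<open>auto intro!: sum_nonneg\<close>)
    also have "\<dots> = ?C * (\<Sum>i\<in>labelled N. \<Sum>j\<in>labelled N. \<Sum>k\<in>labelled N. (1 / real N) ^ card (?V i j k))"
      by (simp add: sum_distrib_left)
    also have "\<dots> \<le> ?C * label_bound ^ 3" using C0 by (intro mult_left_mono sum_labelled3_le N)
    also have "\<dots> = ?B N"
    proof -
      have s: "sqrt (real N) > 0" "real N = sqrt (real N) * sqrt (real N)" using N by auto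
      have "(tmax / sqrt (real N)) ^ 3 * real N = tmax ^ 3 * inverse (sqrt (real N))"
        using s(1) by (subst s(2)) (simp add: power3_eq_cube field_simps)
      then show ?thesis by (simp add: mult_ac)
    qed
    finally show ?thesis .
  qed
  have "(\<lambda>N. inverse (sqrt (real N))) \<longlonglongrightarrow> 0"
    by (intro tendsto_inverse_0_at_top filterlim_compose[OF sqrt_at_top filterlim_real_sequentially])
  then have "?B \<longlonglongrightarrow> c * tmax ^ 3 * label_bound ^ 3 * 0" by (intro tendsto_mult_left)
  then have lim: "?B \<longlonglongrightarrow> 0" by simp
  show ?thesis
  proof (rule Lim_null_comparison[OF _ lim])
    show "\<forall>\<^sub>F N in sequentially. norm (\<Sum>i\<in>labelled N. \<Sum>j\<in>{j\<in>labelled N. share_edge i j}. \<Sum>k\<in>{k\<in>labelled N. share_edge i k}.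
      (\<integral>\<omega>. \<bar>W N i \<omega> * W N j \<omega> * W N k \<omega>\<bar> \<partial>M N)) \<le> ?B N"
      using eventually_ge_at_top[of 1]
    proof eventually_elim
      case (elim N)
      have "0 \<le> (\<Sum>i\<in>labelled N. \<Sum>j\<in>{j\<in>labelled N. share_edge i j}. \<Sum>k\<in>{k\<in>labelled N. share_edge i k}.
        (\<integral>\<omega>. \<bar>W N i \<omega> * W N j \<omega> * W N k \<omega>\<bar> \<partial>M N))" by (intro sum_nonneg) simp
      then show ?case using bound[OF elim] by simp
    qed
  qed
qed

text \<open>Two pairs without a common edge are independent, so their covariance vanishes. Otherwise
  the four walks are connected, and N^(-2) from the normalizations times the N of
  \<open>q_conn\<close> leaves 1/N. In this case the joint moment and the product of the means are
  bounded separately.\<close>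

lemma fourth_cov:
  "(\<lambda>N. \<Sum>i\<in>labelled N. \<Sum>j\<in>{j\<in>labelled N. share_edge i j}. \<Sum>k\<in>labelled N. \<Sum>l\<in>{l\<in>labelled N. share_edge k l}.
        \<bar>(\<integral>\<omega>. W N i \<omega> * W N j \<omega> * W N k \<omega> * W N l \<omega> \<partial>M N)
         - (\<integral>\<omega>. W N i \<omega> * W N j \<omega> \<partial>M N) * (\<integral>\<omega>. W N k \<omega> * W N l \<omega> \<partial>M N)\<bar>) \<longlonglongrightarrow> 0"
proof -
  obtain c where c: "c \<ge> 1" "\<forall>N\<ge>1. \<forall>is. set is \<subseteq> labelled N \<longrightarrow> length is \<le> 4 \<longrightarrow>
    (\<integral>\<omega>. \<bar>\<Prod>i\<leftarrow>is. W N i \<omega>\<bar> \<partial>M N) \<le> c * (tmax / sqrt (real N)) ^ length is * (1 / real N) ^ card (\<Union>i\<in>set is. keys (arcs_of i))"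
    using center_products_bound by blast
  let ?B = "\<lambda>N. (c + c * c) * tmax ^ 4 * label_bound ^ 4 * inverse (real N)"
  let ?cov = "\<lambda>N i j k l. \<bar>(\<integral>\<omega>. W N i \<omega> * W N j \<omega> * W N k \<omega> * W N l \<omega> \<partial>M N)
         - (\<integral>\<omega>. W N i \<omega> * W N j \<omega> \<partial>M N) * (\<integral>\<omega>. W N k \<omega> * W N l \<omega> \<partial>M N)\<bar>"
  have bound: "(\<Sum>i\<in>labelled N. \<Sum>j\<in>{j\<in>labelled N. share_edge i j}. \<Sum>k\<in>labelled N. \<Sum>l\<in>{l\<in>labelled N. share_edge k l}. ?cov N i j k l) \<le> ?B N" if N: "N \<ge> 1" for N
  proof -
    interpret prob_space "M N" by (rule prob_space[OF N])
    let ?V = "\<lambda>i j k l. set (walk_of i) \<union> set (walk_of j) \<union> set (walk_of k) \<union> set (walk_of l)"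
    let ?q = "1 / real N" and ?T = "tmax / sqrt (real N)"
    let ?C = "(c + c * c) * ?T ^ 4 * real N"
    have T0: "0 \<le> ?T" using tmax_nonneg by simp
    have C0: "0 \<le> ?C" using c(1) T0 by simp
    have bnd: "?cov N i j k l \<le> ?C * ?q ^ card (?V i j k l)"
      if h: "i \<in> labelled N" "j \<in> labelled N" "k \<in> labelled N" "l \<in> labelled N" "share_edge i j" "share_edge k l" for i j k l
    proof (cases "(keys (arcs_of i) \<union> keys (arcs_of j)) \<inter> (keys (arcs_of k) \<union> keys (arcs_of l)) = {}")
      case True
      have d: "determined N (keys (arcs_of a) \<union> keys (arcs_of b)) (\<lambda>\<omega>. W N a \<omega> * W N b \<omega>)" if "a \<in> labelled N" "b \<in> labelled N" for a b
        using labelled_props(9) that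
        by (intro determined_mult determined_mono[OF W_determined[OF N that(1)]] determined_mono[OF W_determined[OF N that(2)]]) auto
      have iW: "integrable (M N) (\<lambda>\<omega>. W N a \<omega> * W N b \<omega>)" if "a \<in> labelled N" "b \<in> labelled N" for a b
        using L4_integrable(2)[OF W_L4[OF N] W_L4[OF N] W_L4[OF N]] that by blast
      have "indep_var borel (\<lambda>\<omega>. W N i \<omega> * W N j \<omega>) borel (\<lambda>\<omega>. W N k \<omega> * W N l \<omega>)"
        by (rule determined_indep[OF N d[OF h(1,2)] d[OF h(3,4)] True])
      from indep_var_lebesgue_integral[OF this iW[OF h(1,2)] iW[OF h(3,4)]]
      have "?cov N i j k l = 0" by (simp add: mult.assoc)
      then show ?thesis using C0 N by simp
    next
      case False
      let ?K = "keys (arcs_of i) \<union> keys (arcs_of j) \<union> keys (arcs_of k) \<union> keys (arcs_of l)"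
      have 4: "\<bar>\<integral>\<omega>. W N i \<omega> * W N j \<omega> * W N k \<omega> * W N l \<omega> \<partial>M N\<bar> \<le> c * ?T ^ 4 * ?q ^ card ?K"
        using order_trans[OF integral_abs_bound c(2)[rule_format, OF N, of "[i, j, k, l]"]] h
        by (simp add: mult.assoc Un_assoc eval_nat_numeral)
      have 2: "\<bar>\<integral>\<omega>. W N a \<omega> * W N b \<omega> \<partial>M N\<bar> \<le> c * ?T ^ 2 * ?q ^ card (keys (arcs_of a) \<union> keys (arcs_of b))"
        if "a \<in> labelled N" "b \<in> labelled N" for a b
        using order_trans[OF integral_abs_bound c(2)[rule_format, OF N, of "[a, b]"]] that
        by (simp add: mult.assoc eval_nat_numeral)
      have "\<bar>(\<integral>\<omega>. W N i \<omega> * W N j \<omega> \<partial>M N) * (\<integral>\<omega>. W N k \<omega> * W N l \<omega> \<partial>M N)\<bar> \<le>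
          (c * ?T ^ 2 * ?q ^ card (keys (arcs_of i) \<union> keys (arcs_of j))) * (c * ?T ^ 2 * ?q ^ card (keys (arcs_of k) \<union> keys (arcs_of l)))"
        unfolding abs_mult using c(1) T0 by (intro mult_mono 2 h) auto
      also have "\<dots> = c * c * ?T ^ 4 * ?q ^ (card (keys (arcs_of i) \<union> keys (arcs_of j)) + card (keys (arcs_of k) \<union> keys (arcs_of l)))"
      proof -
        have T4: "?T ^ 4 = ?T ^ 2 * ?T ^ 2" by (simp flip: power_add)
        show ?thesis by (simp only: power_add T4 mult_ac)
      qed
      \<comment> \<open>Edges common to both pairs count twice on the left, which only makes it
        smaller because \<open>?q \<le> 1\<close>.\<close>
      also have "\<dots> \<le> c * c * ?T ^ 4 * ?q ^ card ?K"
      proof (intro mult_left_mono power_decreasing)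
        show "card ?K \<le> card (keys (arcs_of i) \<union> keys (arcs_of j)) + card (keys (arcs_of k) \<union> keys (arcs_of l))"
          using card_Un_le[of "keys (arcs_of i) \<union> keys (arcs_of j)" "keys (arcs_of k) \<union> keys (arcs_of l)"] by (simp add: Un_assoc)
      qed (use c(1) T0 N in auto)
      finally have 22: "\<bar>(\<integral>\<omega>. W N i \<omega> * W N j \<omega> \<partial>M N) * (\<integral>\<omega>. W N k \<omega> * W N l \<omega> \<partial>M N)\<bar> \<le> c * c * ?T ^ 4 * ?q ^ card ?K" .
      have "?cov N i j k l \<le> c * ?T ^ 4 * ?q ^ card ?K + c * c * ?T ^ 4 * ?q ^ card ?K"
        by (rule order_trans[OF abs_triangle_ineq4 add_mono[OF 4 22]])
      also have "\<dots> = (c + c * c) * ?T ^ 4 * ?q ^ card ?K" by (simp only: distrib_right)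
      also have "\<dots> \<le> (c + c * c) * ?T ^ 4 * (real N * ?q ^ card (?V i j k l))"
        using c(1) T0 by (intro mult_left_mono q_conn[OF N] connected4[OF h False]) auto
      finally show ?thesis by (simp only: mult.assoc)
    qed
    have "(\<Sum>i\<in>labelled N. \<Sum>j\<in>{j\<in>labelled N. share_edge i j}. \<Sum>k\<in>labelled N. \<Sum>l\<in>{l\<in>labelled N. share_edge k l}. ?cov N i j k l)
      \<le> (\<Sum>i\<in>labelled N. \<Sum>j\<in>{j\<in>labelled N. share_edge i j}. \<Sum>k\<in>labelled N. \<Sum>l\<in>{l\<in>labelled N. share_edge k l}. ?C * ?q ^ card (?V i j k l))"
      by (intro sum_mono bnd) auto
    also have "\<dots> \<le> (\<Sum>i\<in>labelled N. \<Sum>j\<in>labelled N. \<Sum>k\<in>labelled N. \<Sum>l\<in>labelled N. ?C * ?q ^ card (?V i j k l))"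
    proof (rule sum_mono, rule order_trans[OF sum_mono sum_mono2])
      fix i j
      show "(\<Sum>k\<in>labelled N. \<Sum>l\<in>{l\<in>labelled N. share_edge k l}. ?C * ?q ^ card (?V i j k l)) \<le> (\<Sum>k\<in>labelled N. \<Sum>l\<in>labelled N. ?C * ?q ^ card (?V i j k l))"
        using C0 finite_labelled by (intro sum_mono sum_mono2) auto
    qed (use C0 finite_labelled in \<open>auto intro!: sum_nonneg\<close>)
    also have "\<dots> = ?C * (\<Sum>i\<in>labelled N. \<Sum>j\<in>labelled N. \<Sum>k\<in>labelled N. \<Sum>l\<in>labelled N. ?q ^ card (?V i j k l))"
      by (simp only: sum_distrib_left)
    also have "\<dots> \<le> ?C * label_bound ^ 4" using C0 by (intro mult_left_mono sum_labelled4_le N)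
    also have "\<dots> = ?B N"
    proof -
      have s: "sqrt (real N) > 0" "real N = sqrt (real N) * sqrt (real N)" using N by auto
      have "sqrt (real N) ^ 4 = real N * real N" by (simp add: power4_eq_xxxx mult.assoc[symmetric])
      then have "?T ^ 4 * real N = tmax ^ 4 * inverse (real N)"
        using N by (simp add: power_divide field_simps)
      then show ?thesis by (simp add: mult_ac)
    qed
    finally show ?thesis .
  qed
  have "?B \<longlonglongrightarrow> (c + c * c) * tmax ^ 4 * label_bound ^ 4 * 0" by (intro tendsto_mult_left lim_inverse_n)
  then have lim: "?B \<longlonglongrightarrow> 0" by simp
  show ?thesis
  proof (rule Lim_null_comparison[OF _ lim])
    show "\<forall>\<^sub>F N in sequentially. norm (\<Sum>i\<in>labelled N. \<Sum>j\<in>{j\<in>labelled N. share_edge i j}. \<Sum>k\<in>labelled N. \<Sum>l\<in>{l\<in>labelled N. share_edge k l}. ?cov N i j k l) \<le> ?B N"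
      using eventually_ge_at_top[of 1]
    proof eventually_elim
      case (elim N)
      have "0 \<le> (\<Sum>i\<in>labelled N. \<Sum>j\<in>{j\<in>labelled N. share_edge i j}. \<Sum>k\<in>labelled N. \<Sum>l\<in>{l\<in>labelled N. share_edge k l}. ?cov N i j k l)" by (intro sum_nonneg) simp
      then show ?case using bound[OF elim] by simp
    qed
  qed
qed

lemma tree_clt:
  assumes v: "(\<lambda>N. \<Sum>\<pi>\<in>F. \<Sum>\<pi>'\<in>F. t \<pi> * t \<pi>' * trace_cov N \<pi> \<pi>') \<longlonglongrightarrow> v"
  shows "(\<lambda>N. \<integral>\<omega>. iexp (\<Sum>\<pi>\<in>F. t \<pi> * fluct N \<pi> \<omega>) \<partial>M N) \<longlonglongrightarrow> complex_of_real (exp (- v / 2))"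
proof -
  have "(\<lambda>N. \<integral>\<omega>. iexp (\<Sum>i\<in>labelled N. W N i \<omega>) \<partial>M N) \<longlonglongrightarrow> complex_of_real (exp (- v / 2))"
  proof (rule dissociated_clt[where R = "\<lambda>_. share_edge", OF prob_space finite_labelled W_L4 W_stein W_uncorrelated third_moments fourth_cov])
    show "(\<lambda>N. \<integral>\<omega>. (\<Sum>i\<in>labelled N. W N i \<omega>)\<^sup>2 \<partial>M N) \<longlonglongrightarrow> v"
      unfolding W_sum
    proof (rule Lim_transform_eventually[OF v])
      show "\<forall>\<^sub>F N in sequentially. (\<Sum>\<pi>\<in>F. \<Sum>\<pi>'\<in>F. t \<pi> * t \<pi>' * trace_cov N \<pi> \<pi>') = (\<integral>\<omega>. (\<Sum>\<pi>\<in>F. t \<pi> * fluct N \<pi> \<omega>)\<^sup>2 \<partial>M N)"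
        using eventually_ge_at_top[of 1]
        by eventually_elim (use FI in \<open>subst fluct_comb_second_moment(1); auto\<close>)
    qed
  qed
  then show ?thesis unfolding W_sum .
qed

end


section \<open>Convergence to the Gaussian process\<close>

lemma char_normal_law:
  assumes "s \<ge> 0"
  shows "real_distribution (normal_law 0 s)" "char (normal_law 0 s) = (\<lambda>x. complex_of_real (exp (- (s * x)\<^sup>2 / 2)))"
proof -
  have "real_distribution (normal_law 0 s) \<and> char (normal_law 0 s) = (\<lambda>x. complex_of_real (exp (- (s * x)\<^sup>2 / 2)))"
  proof (cases "s = 0")
    case True
    have "prob_space (return borel (0::real))" by (intro prob_space_return) simp
    then have "real_distribution (return borel (0::real))"
      by (simp add: real_distribution_def real_distribution_axioms_def)
    moreover have "char (return borel 0) = (\<lambda>x. complex_of_real (exp (- (s * x)\<^sup>2 / 2)))"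
      by (rule ext) (simp add: char_def integral_return True)
    ultimately show ?thesis by (simp add: normal_law_def True)
  next
    case False
    then have s: "s > 0" using assms by simp
    interpret SN: real_distribution std_normal_distribution by (rule real_dist_normal_dist)
    have "distributed std_normal_distribution lborel (\<lambda>x. x) std_normal_density"
      by (simp add: distributed_def distr_id2)
    from SN.normal_density_affine[OF this, of s 0] s
    have "distributed std_normal_distribution lborel (\<lambda>x. 0 + s * x) (normal_density 0 s)" by simp
    then have d: "distr std_normal_distribution lborel (\<lambda>x. s * x) = density lborel (\<lambda>x. ennreal (normal_density 0 s x))"
      by (simp add: distributed_def)
    have "distr std_normal_distribution borel (\<lambda>x. s * x) = distr std_normal_distribution lborel (\<lambda>x. s * x)"
      by (intro distr_cong) auto
    then have e: "normal_law 0 s = distr std_normal_distribution borel (\<lambda>x. s * x)"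
      using d s by (simp add: normal_law_def)
    have "prob_space (normal_law 0 s)" unfolding e by (intro SN.prob_space_distr) simp
    then have "real_distribution (normal_law 0 s)"
      by (simp add: real_distribution_def real_distribution_axioms_def e)
    moreover have "char (normal_law 0 s) x = complex_of_real (exp (- (s * x)\<^sup>2 / 2))" for x
    proof -
      have "char (normal_law 0 s) x = char std_normal_distribution (s * x)"
        unfolding e by (simp add: char_def integral_distr mult_ac)
      then show ?thesis by (simp add: char_std_normal_distribution)
    qed
    ultimately show ?thesis by blast
  qed
  then show "real_distribution (normal_law 0 s)" "char (normal_law 0 s) = (\<lambda>x. complex_of_real (exp (- (s * x)\<^sup>2 / 2)))"
    by auto
qed

lemma (in prob_space) distr_eq_normal_law:
  assumes S: "S \<in> borel_measurable M" and v: "v \<ge> 0"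
    and ch: "\<And>x. (\<integral>\<omega>. iexp (x * S \<omega>) \<partial>M) = complex_of_real (exp (- (x\<^sup>2 * v) / 2))"
  shows "distr M borel S = normal_law 0 (sqrt v)"
proof (rule Levy_uniqueness)
  have "prob_space (distr M borel S)" by (rule prob_space_distr[OF S])
  then show "real_distribution (distr M borel S)"
    by (simp add: real_distribution_def real_distribution_axioms_def)
  show "real_distribution (normal_law 0 (sqrt v))" by (rule char_normal_law) (use v in simp)
  show "char (distr M borel S) = char (normal_law 0 (sqrt v))"
  proof
    fix x
    have c: "char (distr M borel S) x = (\<integral>\<omega>. iexp (x * S \<omega>) \<partial>M)"
      unfolding char_def using S by (subst integral_distr) auto
    show "char (distr M borel S) x = char (normal_law 0 (sqrt v)) x"
      unfolding c ch using v by (simp add: char_normal_law(2) power_mult_distrib mult.commute)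
  qed
qed

lemma countable_all_partitions: "countable all_partitions"
proof (rule countable_subset)
  show "all_partitions \<subseteq> {A. finite A \<and> A \<subseteq> Collect finite}"
  proof
    fix \<pi> assume \<pi>: "\<pi> \<in> all_partitions"
    have "finite B" if "B \<in> \<pi>" for B
    proof (rule finite_subset)
      show "B \<subseteq> {1..card (\<Union>\<pi>)}" using that all_partitionsD(2)[OF \<pi>] by blast
    qed simp
    then show "\<pi> \<in> {A. finite A \<and> A \<subseteq> Collect finite}"
      using all_partitionsD(4)[OF \<pi>] by blast
  qed
  have "countable {B :: nat set. finite B}" by (rule countable_Collect_finite)
  then show "countable {A. finite A \<and> A \<subseteq> {B :: nat set. finite B}}"
    by (rule countable_Collect_finite_subset)
qed

lemma all_partitions_nonempty: "all_partitions \<noteq> {}"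
proof -
  have "{{1}} \<in> all_partitions"
    unfolding all_partitions_def by (intro CollectI exI[of _ 1] conjI partition_onI) auto
  then show ?thesis by auto
qed

section \<open>The limiting covariance and the limit of the characteristic functions\<close>

context exploding_elliptic_matrices_one
begin

definition limit_cov ::
    "(((nat set + nat set) set, nat + nat) pre_digraph \<Rightarrow> (nat set + nat set) set rel)
      \<Rightarrow> nat set set \<Rightarrow> nat set set \<Rightarrow> real" where
  "limit_cov ord \<pi>1 \<pi>2 =
    (\<Sum>\<sigma>\<in>common_edge_gluings (partition_graph \<pi>1) (partition_graph \<pi>2).
       tau_limit C (ord (glue (partition_graph \<pi>1) (partition_graph \<pi>2) \<sigma>)) (glue (partition_graph \<pi>1) (partition_graph \<pi>2) \<sigma>))"

context
  fixes ord :: "((nat set + nat set) set, nat + nat) pre_digraph \<Rightarrow> (nat set + nat set) set rel"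
  assumes ord: "\<And>T. linear_order_on (verts T) (ord T)"
begin

lemma limit_cov_lim:
  "\<pi>1 \<in> all_partitions \<Longrightarrow> \<pi>2 \<in> all_partitions \<Longrightarrow> (\<lambda>N. trace_cov N \<pi>1 \<pi>2) \<longlonglongrightarrow> limit_cov ord \<pi>1 \<pi>2"
  unfolding limit_cov_def by (rule trace_cov_limit[OF _ _ ord])

text \<open>Inherited from \<open>trace_cov\<close>. A direct comparison would have to match the
  gluings of the two arrangements and the total orders that \<open>ord\<close> chooses on
  them.\<close>

lemma limit_cov_sym:
  assumes p: "\<pi>1 \<in> all_partitions" "\<pi>2 \<in> all_partitions"
  shows "limit_cov ord \<pi>1 \<pi>2 = limit_cov ord \<pi>2 \<pi>1"
proof (rule LIMSEQ_unique[OF limit_cov_lim[OF p]])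
  show "(\<lambda>N. trace_cov N \<pi>1 \<pi>2) \<longlonglongrightarrow> limit_cov ord \<pi>2 \<pi>1"
  proof (rule Lim_transform_eventually[OF limit_cov_lim[OF p(2,1)]])
    show "\<forall>\<^sub>F N in sequentially. trace_cov N \<pi>2 \<pi>1 = trace_cov N \<pi>1 \<pi>2"
      using eventually_ge_at_top[of 1]
    proof eventually_elim
      case (elim N)
      show ?case using fluct_moments(4)[OF elim p] fluct_moments(4)[OF elim p(2,1)] by (simp add: mult.commute)
    qed
  qed
qed

lemma limit_cov_not_tree:
  assumes p: "\<pi>1 \<in> all_partitions" "\<pi>2 \<in> all_partitions"
    and nt: "\<not> tree_walk (block_word \<pi>1) \<or> \<not> tree_walk (block_word \<pi>2)"
  shows "limit_cov ord \<pi>1 \<pi>2 = 0"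
  using nt
proof
  assume "\<not> tree_walk (block_word \<pi>1)"
  from tau_sum_not_tree[OF p ord this] show ?thesis by (simp only: limit_cov_def)
next
  assume "\<not> tree_walk (block_word \<pi>2)"
  from tau_sum_not_tree[OF p(2,1) ord this] have "limit_cov ord \<pi>2 \<pi>1 = 0" by (simp only: limit_cov_def)
  then show ?thesis by (simp only: limit_cov_sym[OF p])
qed

lemma second_moment_lim:
  assumes p: "\<And>i. i \<in> A \<Longrightarrow> e i \<in> all_partitions"
  shows "(\<lambda>N. \<integral>\<omega>. (\<Sum>i\<in>A. t i * fluct N (e i) \<omega>)\<^sup>2 \<partial>M N) \<longlonglongrightarrow> (\<Sum>i\<in>A. \<Sum>j\<in>A. t i * t j * limit_cov ord (e i) (e j))"
proof (rule Lim_transform_eventually)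
  show "(\<lambda>N. \<Sum>i\<in>A. \<Sum>j\<in>A. t i * t j * trace_cov N (e i) (e j)) \<longlonglongrightarrow> (\<Sum>i\<in>A. \<Sum>j\<in>A. t i * t j * limit_cov ord (e i) (e j))"
    by (intro tendsto_sum tendsto_mult_left limit_cov_lim p)
  show "\<forall>\<^sub>F N in sequentially. (\<Sum>i\<in>A. \<Sum>j\<in>A. t i * t j * trace_cov N (e i) (e j)) = (\<integral>\<omega>. (\<Sum>i\<in>A. t i * fluct N (e i) \<omega>)\<^sup>2 \<partial>M N)"
    using eventually_ge_at_top[of 1] by eventually_elim (rule fluct_comb_second_moment(1)[OF _ p, symmetric])
qed

text \<open>The form is a limit of second moments of real random variables, so its positivity
  requires no inspection of the gluings.\<close>

lemma limit_cov_psd: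
  assumes p: "\<And>i. i \<in> A \<Longrightarrow> e i \<in> all_partitions"
  shows "0 \<le> (\<Sum>i\<in>A. \<Sum>j\<in>A. t i * t j * limit_cov ord (e i) (e j))"
  by (rule LIMSEQ_le_const[OF second_moment_lim[OF p]]) auto

text \<open>Only the partitions whose graph is a tree contribute in the limit; the others vanish in \<open>L\<^sup>2\<close>.\<close>

lemma char_lim:
  assumes F: "finite F" "F \<subseteq> all_partitions"
  shows "(\<lambda>N. \<integral>\<omega>. iexp (\<Sum>\<pi>\<in>F. t \<pi> * fluct N \<pi> \<omega>) \<partial>M N) \<longlonglongrightarrow>
    complex_of_real (exp (- (\<Sum>\<pi>\<in>F. \<Sum>\<pi>'\<in>F. t \<pi> * t \<pi>' * limit_cov ord \<pi> \<pi>') / 2))"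
proof -
  define F1 where "F1 = {\<pi> \<in> F. tree_walk (block_word \<pi>)}"
  define F2 where "F2 = {\<pi> \<in> F. \<not> tree_walk (block_word \<pi>)}"
  have F12: "F = F1 \<union> F2" "F1 \<inter> F2 = {}" "finite F1" "finite F2" "F1 \<subseteq> all_partitions" "F2 \<subseteq> all_partitions"
    using F by (auto simp: F1_def F2_def)
  interpret T: tree_sums M X C F1 t
  proof
    show "finite F1" "F1 \<subseteq> all_partitions" by (rule F12)+
    show "tree_walk (block_word \<pi>)" if "\<pi> \<in> F1" for \<pi> using that by (simp add: F1_def)
  qed
  let ?S = "\<lambda>N \<omega>. \<Sum>\<pi>\<in>F. t \<pi> * fluct N \<pi> \<omega>" and ?S1 = "\<lambda>N \<omega>. \<Sum>\<pi>\<in>F1. t \<pi> * fluct N \<pi> \<omega>"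
  let ?R = "\<lambda>N \<omega>. \<Sum>\<pi>\<in>F2. t \<pi> * fluct N \<pi> \<omega>"
  let ?v = "\<Sum>\<pi>\<in>F. \<Sum>\<pi>'\<in>F. t \<pi> * t \<pi>' * limit_cov ord \<pi> \<pi>'"
  have K0: "t \<pi> * t \<pi>' * limit_cov ord \<pi> \<pi>' = 0" if "\<pi> \<in> F" "\<pi>' \<in> F" "\<pi> \<notin> F1 \<or> \<pi>' \<notin> F1" for \<pi> \<pi>'
  proof -
    have "limit_cov ord \<pi> \<pi>' = 0"
      using that F(2) by (intro limit_cov_not_tree) (auto simp: F1_def)
    then show ?thesis by (simp only: mult_zero_right)
  qed
  have sub: "F1 \<subseteq> F" "F2 \<subseteq> F" by (auto simp: F1_def F2_def)
  have "?v = (\<Sum>\<pi>\<in>F1. \<Sum>\<pi>'\<in>F. t \<pi> * t \<pi>' * limit_cov ord \<pi> \<pi>')"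
    using sub by (intro sum.mono_neutral_right[OF F(1)] ballI sum.neutral K0) auto
  also have "\<dots> = (\<Sum>\<pi>\<in>F1. \<Sum>\<pi>'\<in>F1. t \<pi> * t \<pi>' * limit_cov ord \<pi> \<pi>')"
    using sub by (intro sum.cong refl sum.mono_neutral_right[OF F(1)] ballI K0) auto
  finally have "?v = (\<Sum>\<pi>\<in>F1. \<Sum>\<pi>'\<in>F1. t \<pi> * t \<pi>' * limit_cov ord \<pi> \<pi>')" .
  moreover have "(\<lambda>N. \<integral>\<omega>. iexp (?S1 N \<omega>) \<partial>M N) \<longlonglongrightarrow> complex_of_real (exp (- (\<Sum>\<pi>\<in>F1. \<Sum>\<pi>'\<in>F1. t \<pi> * t \<pi>' * limit_cov ord \<pi> \<pi>') / 2))"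
    using F12(5) by (intro T.tree_clt tendsto_sum tendsto_mult_left limit_cov_lim) auto
  ultimately have 1: "(\<lambda>N. \<integral>\<omega>. iexp (?S1 N \<omega>) \<partial>M N) \<longlonglongrightarrow> complex_of_real (exp (- ?v / 2))" by (simp only:)
  have "(\<lambda>N. \<integral>\<omega>. (?R N \<omega>)\<^sup>2 \<partial>M N) \<longlonglongrightarrow> (\<Sum>\<pi>\<in>F2. \<Sum>\<pi>'\<in>F2. t \<pi> * t \<pi>' * limit_cov ord \<pi> \<pi>')"
    using F12(6) by (intro second_moment_lim) auto
  also have "(\<Sum>\<pi>\<in>F2. \<Sum>\<pi>'\<in>F2. t \<pi> * t \<pi>' * limit_cov ord \<pi> \<pi>') = 0"
    using sub(2) by (intro sum.neutral ballI K0) (auto simp: F1_def F2_def)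
  finally have "(\<lambda>N. sqrt (\<integral>\<omega>. (?R N \<omega>)\<^sup>2 \<partial>M N)) \<longlonglongrightarrow> sqrt 0" by (rule tendsto_real_sqrt)
  then have R: "(\<lambda>N. sqrt (\<integral>\<omega>. (?R N \<omega>)\<^sup>2 \<partial>M N)) \<longlonglongrightarrow> 0" by simp
  \<comment> \<open>The exponential is 1-Lipschitz on the imaginary axis, so the two characteristic
    functions differ by at most the mean of \<open>\<bar>?R N \<omega>\<bar>\<close>, hence by at
    most the root of its second moment.\<close>
  have "(\<lambda>N. (\<integral>\<omega>. iexp (?S N \<omega>) \<partial>M N) - (\<integral>\<omega>. iexp (?S1 N \<omega>) \<partial>M N)) \<longlonglongrightarrow> 0"
  proof (rule Lim_null_comparison[OF _ R])
    show "\<forall>\<^sub>F N in sequentially. norm ((\<integral>\<omega>. iexp (?S N \<omega>) \<partial>M N) - (\<integral>\<omega>. iexp (?S1 N \<omega>) \<partial>M N)) \<le> sqrt (\<integral>\<omega>. (?R N \<omega>)\<^sup>2 \<partial>M N)"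
      using eventually_ge_at_top[of 1]
    proof eventually_elim
      case (elim N)
      interpret prob_space "M N" by (rule prob_space[OF elim])
      have m: "fluct N \<pi> \<in> borel_measurable (M N)" "integrable (M N) (fluct N \<pi>)" if "\<pi> \<in> all_partitions" for \<pi>
        using fluct_moments(1,2)[OF elim that that] by auto
      have mS: "?S N \<in> borel_measurable (M N)" "?S1 N \<in> borel_measurable (M N)"
        using m F(2) F12(5) by (auto intro!: borel_measurable_sum borel_measurable_times)
      have iS: "integrable (M N) (\<lambda>\<omega>. iexp (?S N \<omega>))" "integrable (M N) (\<lambda>\<omega>. iexp (?S1 N \<omega>))"
      proof -
        have "integrable (M N) (\<lambda>\<omega>. iexp (f \<omega>))" if "f \<in> borel_measurable (M N)" for f :: "'a \<Rightarrow> real"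
          using that by (intro integrable_iexp) auto
        from this[OF mS(1)] this[OF mS(2)]
        show "integrable (M N) (\<lambda>\<omega>. iexp (?S N \<omega>))" "integrable (M N) (\<lambda>\<omega>. iexp (?S1 N \<omega>))" .
      qed
      have iR: "integrable (M N) (?R N)"
        using F12(6) by (intro Bochner_Integration.integrable_sum integrable_mult_right m(2)) auto
      have iR2: "integrable (M N) (\<lambda>\<omega>. (?R N \<omega>)\<^sup>2)"
        using F12(6) by (intro fluct_comb_second_moment(2) elim) auto
      have le: "norm (iexp (?S N \<omega>) - iexp (?S1 N \<omega>)) \<le> \<bar>?R N \<omega>\<bar>" for \<omega>
      proof -
        have "?S N \<omega> = ?S1 N \<omega> + ?R N \<omega>" 
          by (subst F12(1), rule sum.union_disjoint[OF F12(3,4,2)])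
        then have "iexp (?S N \<omega>) = iexp (?S1 N \<omega>) * iexp (?R N \<omega>)"
          by (simp only: of_real_add distrib_left exp_add)
        then have "iexp (?S N \<omega>) - iexp (?S1 N \<omega>) = iexp (?S1 N \<omega>) * (iexp (?R N \<omega>) - 1)"
          by (simp only: right_diff_distrib mult_1_right)
        then have "norm (iexp (?S N \<omega>) - iexp (?S1 N \<omega>)) = norm (iexp (?R N \<omega>) - 1)"
          by (simp only: norm_mult norm_exp_i_times mult_1)
        also have "\<dots> \<le> \<bar>?R N \<omega>\<bar>" using iexp_approx1[of "?R N \<omega>" 0] by simp
        finally show ?thesis .
      qed
      have "norm ((\<integral>\<omega>. iexp (?S N \<omega>) \<partial>M N) - (\<integral>\<omega>. iexp (?S1 N \<omega>) \<partial>M N)) = norm (\<integral>\<omega>. iexp (?S N \<omega>) - iexp (?S1 N \<omega>) \<partial>M N)"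
        by (simp only: Bochner_Integration.integral_diff[OF iS])
      also have "\<dots> \<le> (\<integral>\<omega>. norm (iexp (?S N \<omega>) - iexp (?S1 N \<omega>)) \<partial>M N)" by (rule integral_norm_bound)
      also have "\<dots> \<le> (\<integral>\<omega>. \<bar>?R N \<omega>\<bar> \<partial>M N)"
        by (intro integral_mono le integrable_norm Bochner_Integration.integrable_diff iS integrable_abs iR)
      also have "\<dots> \<le> sqrt (\<integral>\<omega>. (?R N \<omega>)\<^sup>2 \<partial>M N)" by (rule abs_expectation_le_sqrt[OF iR iR2])
      finally show ?case .
    qed
  qed
  from tendsto_add[OF this 1] show ?thesis by simp
qed

lemma clt_for_traces:
  "\<exists>(P :: (nat set set \<Rightarrow> real) measure) (z :: nat set set \<Rightarrow> (nat set set \<Rightarrow> real) \<Rightarrow> real).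
    centered_gaussian_process P all_partitions z \<and>
    fdd_convergence M (\<lambda>N \<pi>. fluctuation M (\<lambda>N i j \<omega>. 1 / sqrt (real N) * X N i j \<omega>) N (partition_graph \<pi>)) P z all_partitions \<and>
    (\<forall>\<pi>1 \<in> all_partitions. \<forall>\<pi>2 \<in> all_partitions. covariance P (z \<pi>1) (z \<pi>2) = limit_cov ord \<pi>1 \<pi>2)"
proof -
  \<comment> \<open>The independent normals are put at the coordinates \<open>{{n}}\<close> of the
    sample space \<open>nat set set \<Rightarrow> real\<close>.\<close>
  have inj: "inj (\<lambda>n::nat. {{n}})" by (auto simp: inj_def)
  have psd: "0 \<le> (\<Sum>a<n. \<Sum>b<n. c a * c b * limit_cov ord (e a) (e b))"
    if "\<And>a. a < n \<Longrightarrow> e a \<in> all_partitions" for n :: nat and c e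
    by (rule limit_cov_psd) (use that in auto)
  obtain P :: "(nat set set \<Rightarrow> real) measure" and z where
    P: "prob_space P"
    and z: "\<forall>i\<in>all_partitions. z i \<in> borel_measurable P \<and> integrable P (\<lambda>\<omega>. (z i \<omega>)\<^sup>2) \<and> (\<integral>\<omega>. z i \<omega> \<partial>P) = 0"
    and cov: "\<forall>i\<in>all_partitions. \<forall>j\<in>all_partitions. (\<integral>\<omega>. z i \<omega> * z j \<omega> \<partial>P) = limit_cov ord i j"
    and ch: "\<forall>F t. finite F \<longrightarrow> F \<subseteq> all_partitions \<longrightarrow> (\<integral>\<omega>. iexp (\<Sum>i\<in>F. t i * z i \<omega>) \<partial>P) =
       complex_of_real (exp (- (\<Sum>i\<in>F. \<Sum>j\<in>F. t i * t j * limit_cov ord i j) / 2))"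
    using gaussian_family_exists[of all_partitions "limit_cov ord" "\<lambda>n::nat. {{n}}",
        OF countable_all_partitions all_partitions_nonempty limit_cov_sym psd inj] by blast
  interpret P: prob_space P by (rule P)
  have "gaussian_process P all_partitions z"
    unfolding gaussian_process_def
  proof (intro conjI allI impI ballI P)
    show "z i \<in> borel_measurable P" if "i \<in> all_partitions" for i using z that by blast
    fix F and c :: "nat set set \<Rightarrow> real" assume F: "finite F \<and> F \<subseteq> all_partitions"
    let ?v = "\<Sum>i\<in>F. \<Sum>j\<in>F. c i * c j * limit_cov ord i j"
    have v: "0 \<le> ?v" using limit_cov_psd[of F "\<lambda>i. i" c] F by auto
    have "distr P borel (\<lambda>\<omega>. \<Sum>i\<in>F. c i * z i \<omega>) = normal_law 0 (sqrt ?v)"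
    proof (rule P.distr_eq_normal_law[OF _ v])
      show "(\<lambda>\<omega>. \<Sum>i\<in>F. c i * z i \<omega>) \<in> borel_measurable P"
        using z F by (intro borel_measurable_sum borel_measurable_times) auto
      fix x
      have "(\<integral>\<omega>. iexp (x * (\<Sum>i\<in>F. c i * z i \<omega>)) \<partial>P) = (\<integral>\<omega>. iexp (\<Sum>i\<in>F. (x * c i) * z i \<omega>) \<partial>P)"
        by (simp only: sum_distrib_left mult.assoc)
      also have "\<dots> = complex_of_real (exp (- (\<Sum>i\<in>F. \<Sum>j\<in>F. (x * c i) * (x * c j) * limit_cov ord i j) / 2))"
        using F by (intro ch[rule_format]) auto
      also have "(\<Sum>i\<in>F. \<Sum>j\<in>F. (x * c i) * (x * c j) * limit_cov ord i j) = x\<^sup>2 * ?v"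
        unfolding sum_distrib_left by (intro sum.cong refl) (simp add: power2_eq_square)
      finally show "(\<integral>\<omega>. iexp (x * (\<Sum>i\<in>F. c i * z i \<omega>)) \<partial>P) = complex_of_real (exp (- (x\<^sup>2 * ?v) / 2))" .
    qed
    then show "\<exists>\<mu> s. s \<ge> 0 \<and> distr P borel (\<lambda>\<omega>. \<Sum>i\<in>F. c i * z i \<omega>) = normal_law \<mu> s"
      using v by (intro exI[of _ 0] exI[of _ "sqrt ?v"]) auto
  qed
  then have "centered_gaussian_process P all_partitions z"
    using z by (simp add: centered_gaussian_process_def)
  moreover have "fdd_convergence M (\<lambda>N \<pi>. fluctuation M (\<lambda>N i j \<omega>. 1 / sqrt (real N) * X N i j \<omega>) N (partition_graph \<pi>)) P z all_partitions"
  proof (rule fdd_convergence_of_char)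
    let ?Y = "\<lambda>N \<pi>. fluctuation M (\<lambda>N i j \<omega>. 1 / sqrt (real N) * X N i j \<omega>) N (partition_graph \<pi>)"
    have Y: "?Y N \<pi> = fluct N \<pi>" if "N \<ge> 1" "\<pi> \<in> all_partitions" for N \<pi>
      using fluctuation_eq[OF that] by (intro ext)
    show "prob_space (M N)" if "N \<ge> 1" for N by (rule prob_space[OF that])
    show "prob_space P" by (rule P)
    show "?Y N i \<in> borel_measurable (M N)" if "N \<ge> 1" "i \<in> all_partitions" for N i
      unfolding Y[OF that] by (rule fluct_moments(1)[OF that that(2)])
    show "integrable (M N) (\<lambda>\<omega>. (?Y N i \<omega>)\<^sup>2)" if "N \<ge> 1" "i \<in> all_partitions" for N i
      unfolding Y[OF that] power2_eq_square by (rule fluct_moments(3)[OF that that(2)])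
    show "\<exists>K. \<forall>N\<ge>1. (\<integral>\<omega>. (?Y N i \<omega>)\<^sup>2 \<partial>M N) \<le> K" if i: "i \<in> all_partitions" for i
    proof -
      have "Bseq (\<lambda>N. trace_cov N i i)" by (intro convergent_imp_Bseq convergentI[OF limit_cov_lim] i)
      then obtain K where K: "\<And>N. norm (trace_cov N i i) \<le> K" by (auto simp: Bseq_def)
      have "(\<integral>\<omega>. (?Y N i \<omega>)\<^sup>2 \<partial>M N) \<le> K" if "N \<ge> 1" for N
        unfolding Y[OF that i] power2_eq_square fluct_moments(4)[OF that i i] using K[of N] by simp
      then show ?thesis by blast
    qed
    show "z i \<in> borel_measurable P" "integrable P (\<lambda>\<omega>. (z i \<omega>)\<^sup>2)" if "i \<in> all_partitions" for i
      using z that by auto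
    fix F and t :: "nat set set \<Rightarrow> real" assume F: "finite F" "F \<subseteq> all_partitions"
    show "(\<lambda>N. \<integral>\<omega>. iexp (\<Sum>i\<in>F. t i * ?Y N i \<omega>) \<partial>M N) \<longlonglongrightarrow> (\<integral>\<omega>. iexp (\<Sum>i\<in>F. t i * z i \<omega>) \<partial>P)"
    proof -
      have "(\<integral>\<omega>. iexp (\<Sum>i\<in>F. t i * z i \<omega>) \<partial>P) = complex_of_real (exp (- (\<Sum>i\<in>F. \<Sum>j\<in>F. t i * t j * limit_cov ord i j) / 2))"
        by (rule ch[rule_format, OF F])
      moreover have "\<forall>\<^sub>F N in sequentially. (\<integral>\<omega>. iexp (\<Sum>i\<in>F. t i * fluct N i \<omega>) \<partial>M N) = (\<integral>\<omega>. iexp (\<Sum>i\<in>F. t i * ?Y N i \<omega>) \<partial>M N)"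
        using eventually_ge_at_top[of 1]
      proof eventually_elim
        case (elim N)
        have "(\<Sum>i\<in>F. t i * ?Y N i \<omega>) = (\<Sum>i\<in>F. t i * fluct N i \<omega>)" for \<omega>
          using Y[OF elim] F(2) by (intro sum.cong) auto
        then show ?case by (simp only:)
      qed
      ultimately show ?thesis using Lim_transform_eventually[OF char_lim[OF F]] by simp
    qed
  qed
  moreover have "covariance P (z \<pi>1) (z \<pi>2) = limit_cov ord \<pi>1 \<pi>2" if "\<pi>1 \<in> all_partitions" "\<pi>2 \<in> all_partitions" for \<pi>1 \<pi>2
    using z cov that by (simp add: covariance_def)
  ultimately show ?thesis by blast
qed

end

end

theorem theorem2p6:
  fixes M :: "nat \<Rightarrow> 'a measure"
    and X A :: "nat \<Rightarrow> nat \<Rightarrow> nat \<Rightarrow> 'a \<Rightarrow> real"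
    and C :: "nat \<Rightarrow> nat \<Rightarrow> real"
    and ord :: "((nat set + nat set) set, nat + nat) pre_digraph \<Rightarrow> (nat set + nat set) set rel"
  assumes "exploding_elliptic_matrices M X 1 C"
    and "\<And>N i j \<omega>. A N i j \<omega> = 1 / sqrt (real N) * X N i j \<omega>"
    and "\<And>T. linear_order_on (verts T) (ord T)"
  shows "\<exists>(P :: (nat set set \<Rightarrow> real) measure) (z :: nat set set \<Rightarrow> (nat set set \<Rightarrow> real) \<Rightarrow> real).
    centered_gaussian_process P all_partitions z \<and>
    fdd_convergence M (\<lambda>N \<pi>. fluctuation M A N (partition_graph \<pi>)) P z all_partitions \<and>
    (\<forall>\<pi>\<^sub>1 \<in> all_partitions. \<forall>\<pi>\<^sub>2 \<in> all_partitions.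
      covariance P (z \<pi>\<^sub>1) (z \<pi>\<^sub>2) =
        (\<Sum>\<sigma> \<in> common_edge_gluings (partition_graph \<pi>\<^sub>1) (partition_graph \<pi>\<^sub>2).
          let T = glue (partition_graph \<pi>\<^sub>1) (partition_graph \<pi>\<^sub>2) \<sigma> in tau_limit C (ord T) T))"
proof -
  interpret exploding_elliptic_matrices_one M X C
    by (rule exploding_elliptic_matrices_one.intro[OF assms(1)])
  have "A = (\<lambda>N i j \<omega>. 1 / sqrt (real N) * X N i j \<omega>)" using assms(2) by (intro ext)
  then show ?thesis
    using clt_for_traces[of ord, OF assms(3)] unfolding limit_cov_def Let_def by (simp only:)
qed

end
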